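(* Let $\nu$ be a Beurling weight which is increasing on $\mathbb{Z}_+$ (i.e. $\nu_j \leq \nu_k$ for $0 \leq j < k$), and let $d\mu(z) = w(z)\,|dz|$ be a measure on $\Gamma$ with $w \in W_{\nu}$, $w(z) \neq 0$ for $z \in \mathcal{R}_{\nu}$ and $\mathrm{wind}(w,0) = 0$. Let $n_0$ be such that the monic orthogonal polynomials $\Phi_n$ exist and are unique for all $n\ge n_0$, let $\alpha_{n-1} = -\overline{\Phi_n(0)}$ for $n \geq n_0$ and $\alpha_{n-1} = 0$ for $1\le n < n_0$, and let $S(z) = -\sum_{n=1}^{\infty}\alpha_{n-1} z^n$. Then the function $g = \overline{D_i}\,\overline{D_e} - S$ on $\Gamma$ satisfies \[ \sum_{n \geq 0} \nu_n^3\, |g_n| < \infty , \] i.e. the nonnegative-frequency part of $\overline{D_i}\,\overline{D_e} - S$ lies in $W_{\nu^3}^{+}$. In particular, if $w$ is positive on $\Gamma$, then the nonnegative-frequency part of $\frac{\overline{D_i}}{D_i} - S$ lies in $W_{\nu^3}^{+}$.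
   Context: $\Gamma = \{|z|=1\}$; for $\varphi\in L^1(\Gamma)$, $\varphi_k=\int_{-\pi}^{\pi}e^{-ik\theta}\varphi(e^{i\theta})\frac{d\theta}{2\pi}$. A Beurling weight is a sequence $\nu=(\nu_k)_{k\in\mathbb{Z}}$ with $\nu_j\ge 1$, $\nu_j=\nu_{-j}$, $\nu_{j+k}\le\nu_j\nu_k$; $W_\nu=\{\varphi\in L^1(\Gamma):\sum_j\nu_j|\varphi_j|<\infty\}$; $W_{\nu^3}$ is defined with the weight $(\nu_k^3)_k$, and $W^+_{\nu^3}$ consists of its elements with vanishing negative Fourier coefficients. $A(\nu)=\lim_{k\to\infty}\frac{\log\nu_k}{k}$, $\mathcal{R}_\nu=\{e^{-A(\nu)}\le|z|\le e^{A(\nu)}\}$, and elements of $W_\nu$ are extended to $\mathcal{R}_\nu$ by their Fourier series. $\mathrm{wind}(w,0)$ is the winding number of $w|_\Gamma$ about $0$. A monic orthogonal polynomial of degree $n$ for $w$ is $\Phi_n(z)=z^n+\dots$ with $\int_\Gamma\Phi_n(z)z^{-k}w(z)|dz|=0$ for $0\le k\le n-1$; under the hypotheses these exist and are unique for all large $n$. Under the hypotheses $w$ has a continuous logarithm $\log w\in W_\nu$; the Szegő function is $D(z)=\exp\big(\frac{1}{4\pi}\int_0^{2\pi}\log w(e^{i\theta})\frac{e^{i\theta}+z}{e^{i\theta}-z}d\theta\big)$ for $z\notin\Gamma$, $D_i$ and $D_e$ denote its restrictions to $|z|<1$ and $|z|>1$ and also their continuous boundary values on $\Gamma$; $\overline{D_i},\overline{D_e}$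 denote the complex conjugates of these boundary values on $\Gamma$. *)

theory Defs
  imports "HOL-Complex_Analysis.Complex_Analysis"
begin

text \<open>Functions on the unit circle are represented as functions complex => complex,
  evaluated at points cis theta.\<close>

definition L1_circle :: "(complex \<Rightarrow> complex) \<Rightarrow> bool" where
  "L1_circle \<phi> \<longleftrightarrow> set_integrable lborel {-pi..pi} (\<lambda>\<theta>. \<phi> (cis \<theta>))"

definition fourier_coeff :: "(complex \<Rightarrow> complex) \<Rightarrow> int \<Rightarrow> complex" where
  "fourier_coeff \<phi> k =
     (LINT \<theta>:{-pi..pi}|lborel. cis (- (of_int k * \<theta>)) * \<phi> (cis \<theta>)) / complex_of_real (2 * pi)"

definition beurling_weight :: "(int \<Rightarrow> real) \<Rightarrow> bool" where
  "beurling_weight \<nu> \<longleftrightarrow>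
     (\<forall>j. \<nu> j \<ge> 1) \<and> (\<forall>j. \<nu> j = \<nu> (- j)) \<and> (\<forall>j k. \<nu> (j + k) \<le> \<nu> j * \<nu> k)"

definition W_alg :: "(int \<Rightarrow> real) \<Rightarrow> (complex \<Rightarrow> complex) set" where
  "W_alg \<nu> = {\<phi>. L1_circle \<phi> \<and> (\<lambda>j. \<nu> j * norm (fourier_coeff \<phi> j)) summable_on UNIV}"

definition A_exp :: "(int \<Rightarrow> real) \<Rightarrow> real" where
  "A_exp \<nu> = lim (\<lambda>k::nat. ln (\<nu> (int k)) / real k)"

definition annulus_R :: "(int \<Rightarrow> real) \<Rightarrow> complex set" where
  "annulus_R \<nu> = {z. exp (- A_exp \<nu>) \<le> norm z \<and> norm z \<le> exp (A_exp \<nu>)}"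

definition fourier_ext :: "(complex \<Rightarrow> complex) \<Rightarrow> complex \<Rightarrow> complex" where
  "fourier_ext \<phi> z = infsum (\<lambda>k. fourier_coeff \<phi> k * z powi k) UNIV"

definition wind0 :: "(complex \<Rightarrow> complex) \<Rightarrow> complex" where
  "wind0 w = winding_number (\<lambda>t. fourier_ext w (cis (2 * pi * t))) 0"

definition monic_OP :: "(complex \<Rightarrow> complex) \<Rightarrow> nat \<Rightarrow> complex poly \<Rightarrow> bool" where
  "monic_OP w n \<Phi> \<longleftrightarrow> degree \<Phi> = n \<and> lead_coeff \<Phi> = 1 \<and>
     (\<forall>k<n. (LINT \<theta>:{-pi..pi}|lborel. poly \<Phi> (cis \<theta>) * cis (- (real k * \<theta>)) * w (cis \<theta>)) = 0)"

definition log_w :: "(complex \<Rightarrow> complex) \<Rightarrow> complex \<Rightarrow> complex" where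
  "log_w w = (SOME L. continuous_on (sphere 0 1) L \<and>
                 (\<forall>z\<in>sphere 0 1. exp (L z) = fourier_ext w z))"

definition szego :: "(complex \<Rightarrow> complex) \<Rightarrow> complex \<Rightarrow> complex" where
  "szego w z = exp (complex_of_real (1 / (4 * pi)) *
      (LINT \<theta>:{0..2*pi}|lborel. log_w w (cis \<theta>) * (cis \<theta> + z) / (cis \<theta> - z)))"

definition D_i :: "(complex \<Rightarrow> complex) \<Rightarrow> complex \<Rightarrow> complex" where
  "D_i w z = Lim (at_left 1) (\<lambda>r::real. szego w (complex_of_real r * z))"

definition D_e :: "(complex \<Rightarrow> complex) \<Rightarrow> complex \<Rightarrow> complex" where
  "D_e w z = Lim (at_right 1) (\<lambda>r::real. szego w (complex_of_real r * z))"

text \<open>Verblunsky-type coefficients: alpha_{m} = alpha_{n-1} with n = m+1.\<close>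
definition alpha_coef :: "(complex \<Rightarrow> complex) \<Rightarrow> nat \<Rightarrow> nat \<Rightarrow> complex" where
  "alpha_coef w n0 m =
     (if m + 1 \<ge> n0 then - cnj (poly (THE \<Phi>. monic_OP w (m + 1) \<Phi>) 0) else 0)"

text \<open>Fourier coefficients of S(z) = - sum_{n>=1} alpha_{n-1} z^n.\<close>
definition S_coef :: "(complex \<Rightarrow> complex) \<Rightarrow> nat \<Rightarrow> int \<Rightarrow> complex" where
  "S_coef w n0 k = (if k \<ge> 1 then - alpha_coef w n0 (nat k - 1) else 0)"

end

theory Submission
  imports Defs
begin

text \<open>
  Write \<open>L = log w\<close> on the circle, \<open>E\<^sub>i = exp L\<^sub>+\<close>, \<open>E\<^sub>e = exp (- L\<^sub>-)\<close>, where \<open>L\<^sub>\<plusminus>\<close> are the parts of \<open>L\<close>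
  with positive and negative frequencies. Then \<open>w\<close> is a constant multiple of \<open>E\<^sub>i / E\<^sub>e\<close>, and
  \<open>D\<^sub>i D\<^sub>e = E\<^sub>i E\<^sub>e = h\<close>. A weighted Wiener--Levy theorem gives \<open>L \<in> W\<^sub>\<nu>\<close>, hence \<open>h\<close> and
  \<open>g = 1/h\<close> lie in \<open>W\<^sub>\<nu>\<close>. Orthogonality of \<open>\<Phi>\<^sub>n\<close> turns into a pair of Hankel equations for a sequence \<open>U\<close>
  supported on the nonnegative integers, \<open>U = \<delta>\<^sub>0 + (Hankel of g)(Hankel of h) U\<close>, with
  \<open>\<Phi>\<^sub>n(0) = \<Sum>\<^sub>j U\<^sub>j h\<^bsub>-n-j\<^esub>\<close>. The leading term is \<open>h\<^bsub>-n\<^esub>\<close>, the conjugate of the coefficient of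
  \<open>cnj D\<^sub>i cnj D\<^sub>e\<close>, and the remainder is a sum of products \<open>h\<^bsub>-n-k\<^esub> g\<^bsub>n+k+m\<^esub> h\<^bsub>-n-m-j\<^esub> U\<^sub>j\<close>. All three
  indices have modulus at least \<open>n\<close>, so monotonicity of \<open>\<nu>\<close> distributes one factor \<open>\<nu>\<^sub>n\<close> to each of them.
\<close>

section \<open>The weighted Wiener algebra\<close>

text \<open>The sequence \<open>U\<close> depends on \<open>n\<close>, and no weighted estimate of
  it is available. None is needed: the factors h, g, h take all three powers of the weight, so an
  unweighted summable majorant of \<open>U\<close> with a bound uniform in \<open>n\<close>
  suffices. It exists because the tail of g beyond \<open>n\<close> is small against the whole sum
  of h. The logarithm has to lie in the algebra because its two halves are exponentiated separately;
  this yields factors with one-sided spectrum whose inverses are again in the algebra. The winding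
  number gives existence of the logarithm, the zero-free closed annulus gives its membership.
  \<open>w\<close> is merely integrable and is never identified with its Fourier series
  \<open>fourier_ext w\<close>: orthogonality sees only the coefficients. Any continuous logarithm
  serves as \<open>log_w\<close>, since another choice alters only the mean \<open>l 0\<close>,
  which cancels from the product of \<open>D_i\<close> and \<open>D_e\<close>. Only values on the
  circle matter, so \<open>has_fourier\<close> relates a function to a coefficient family and says
  nothing elsewhere.\<close>

definition has_fourier :: "(int \<Rightarrow> real) \<Rightarrow> (complex \<Rightarrow> complex) \<Rightarrow> (int \<Rightarrow> complex) \<Rightarrow> bool" where
  "has_fourier \<nu> f a \<longleftrightarrow> (\<lambda>k. \<nu> k * norm (a k)) summable_on UNIV \<and>
     (\<forall>z. norm z = 1 \<longrightarrow> ((\<lambda>k. a k * z powi k) has_sum f z) UNIV)"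

definition wnorm :: "(int \<Rightarrow> real) \<Rightarrow> (int \<Rightarrow> complex) \<Rightarrow> real" where
  "wnorm \<nu> a = (\<Sum>\<^sub>\<infinity>k. \<nu> k * norm (a k))"

definition conv :: "(int \<Rightarrow> complex) \<Rightarrow> (int \<Rightarrow> complex) \<Rightarrow> int \<Rightarrow> complex" where
  "conv a b k = (\<Sum>\<^sub>\<infinity>j. a j * b (k - j))"

section \<open>Double series and their shear reindexing\<close>

lemma norm_powi_unit: "norm z = 1 \<Longrightarrow> norm (z powi k) = (1::real)" for z :: complex
  by (simp add: norm_power_int)

lemma has_sum_prod_nonneg:
  fixes f g :: "'a \<Rightarrow> real"
  assumes f: "f summable_on UNIV" "\<And>i. f i \<ge> 0" and g: "g summable_on UNIV" "\<And>i. g i \<ge> 0"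
  shows "((\<lambda>(i,j). f i * g j) has_sum (infsum f UNIV * infsum g UNIV)) (UNIV \<times> UNIV)"
proof (rule has_sum_SigmaI)
  show "((\<lambda>j. case (i, j) of (i, j) \<Rightarrow> f i * g j) has_sum f i * infsum g UNIV) UNIV" for i
    using g(1) by (auto intro!: has_sum_cmult_right)
  show "((\<lambda>i. f i * infsum g UNIV) has_sum infsum f UNIV * infsum g UNIV) UNIV"
    using f(1) by (auto intro!: has_sum_cmult_left)
  show "(\<lambda>(i, j). f i * g j) summable_on UNIV \<times> UNIV"
  proof (rule summable_on_SigmaI)
    show "((\<lambda>j. case (i, j) of (i, j) \<Rightarrow> f i * g j) has_sum f i * infsum g UNIV) UNIV" for i
      using g(1) by (auto intro!: has_sum_cmult_right)
    show "(\<lambda>i. f i * infsum g UNIV) summable_on UNIV"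
      using f(1) by (rule summable_on_cmult_left)
  qed (use f g in auto)
qed

lemma has_sum_prod_abs:
  fixes f g :: "'a \<Rightarrow> complex"
  assumes f: "(\<lambda>i. norm (f i)) summable_on UNIV" "(f has_sum F) UNIV"
    and g: "(\<lambda>i. norm (g i)) summable_on UNIV" "(g has_sum G) UNIV"
  shows "((\<lambda>(i,j). f i * g j) has_sum F * G) (UNIV \<times> UNIV)"
proof (rule has_sum_SigmaI)
  show "((\<lambda>j. case (i, j) of (i, j) \<Rightarrow> f i * g j) has_sum f i * G) UNIV" for i
    using g(2) by (auto intro!: has_sum_cmult_right)
  show "((\<lambda>i. f i * G) has_sum F * G) UNIV"
    using f(2) by (auto intro!: has_sum_cmult_left)
  have "(\<lambda>(i,j). norm (f i) * norm (g j)) summable_on UNIV \<times> UNIV"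
    using has_sum_prod_nonneg[OF f(1) _ g(1)] by (auto simp: has_sum_imp_summable)
  then have "(\<lambda>p. norm (case p of (i, j) \<Rightarrow> f i * g j)) summable_on UNIV \<times> UNIV"
    by (simp add: case_prod_unfold norm_mult)
  then show "(\<lambda>(i, j). f i * g j) summable_on UNIV \<times> UNIV"
    by (rule abs_summable_summable)
qed

lemma has_sum_conv_reindex:
  fixes h :: "int \<times> int \<Rightarrow> 'a::{comm_monoid_add,topological_space}"
  shows "((\<lambda>(k,j). h (j, k - j)) has_sum s) (UNIV \<times> UNIV) \<longleftrightarrow> (h has_sum s) (UNIV \<times> UNIV)"
  by (rule has_sum_reindex_bij_witness[where j = "\<lambda>(k,j). (j, k - j)" and i = "\<lambda>(i,j). (i + j, i)"]) auto

lemma has_fourier_cong: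
  assumes "has_fourier \<nu> f a" "\<And>z. norm z = 1 \<Longrightarrow> f z = g z"
  shows "has_fourier \<nu> g a"
  using assms by (auto simp: has_fourier_def)

lemma has_fourier_const_weight:
  assumes "has_fourier \<nu> f a" "\<And>k. 1 \<le> \<nu> k"
  shows "has_fourier (\<lambda>_. 1) f a"
  unfolding has_fourier_def
proof
  show "(\<lambda>k. 1 * norm (a k)) summable_on UNIV"
    by (rule summable_on_comparison_test[of "\<lambda>k. \<nu> k * norm (a k)"])
       (use assms mult_right_mono[of 1 "\<nu> k" "norm (a k)" for k] in \<open>auto simp: has_fourier_def\<close>)
qed (use assms in \<open>auto simp: has_fourier_def\<close>)

locale beurling =
  fixes \<nu> :: "int \<Rightarrow> real"
  assumes weight_ge_1: "1 \<le> \<nu> k"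
    and weight_sym: "\<nu> (- k) = \<nu> k"
    and weight_submult: "\<nu> (j + k) \<le> \<nu> j * \<nu> k"
begin

lemma weight_nonneg: "0 \<le> \<nu> k"
  using weight_ge_1[of k] by linarith

lemma norm_le_weighted: "norm x \<le> \<nu> k * norm x" for x :: complex
  using mult_right_mono[OF weight_ge_1[of k], of "norm x"] by simp

lemma abs_summable_coeffs:
  assumes "(\<lambda>k. \<nu> k * norm (a k :: complex)) summable_on UNIV"
  shows "(\<lambda>k. norm (a k)) summable_on UNIV"
  by (rule summable_on_comparison_test[OF assms]) (auto intro: norm_le_weighted)

lemma has_fourierI:
  assumes "(\<lambda>k. \<nu> k * norm (a k)) summable_on UNIV"
  shows "has_fourier \<nu> (\<lambda>z. \<Sum>\<^sub>\<infinity>k. a k * z powi k) a"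
  unfolding has_fourier_def
proof (intro conjI allI impI)
  fix z :: complex assume z: "norm z = 1"
  have "(\<lambda>k. norm (a k * z powi k)) summable_on UNIV"
    using abs_summable_coeffs[OF assms] z by (simp add: norm_mult norm_powi_unit)
  then show "((\<lambda>k. a k * z powi k) has_sum (\<Sum>\<^sub>\<infinity>k. a k * z powi k)) UNIV"
    by (rule has_sum_infsum[OF abs_summable_summable])
qed (use assms in auto)

lemma wnorm_nonneg: "0 \<le> wnorm \<nu> a"
  unfolding wnorm_def by (intro infsum_nonneg) (simp add: weight_nonneg)

text \<open>Submultiplicativity gives \<nu> k \<le> \<nu> j * \<nu> (k - j), so the weighted double
  series of the convolution is dominated by the product of the two weighted series; the shear (i,j)
  to (i+j,i) and Fubini do the rest.\<close>

lemma has_fourier_mult: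
  assumes f: "has_fourier \<nu> f a" and g: "has_fourier \<nu> g b"
  shows "has_fourier \<nu> (\<lambda>z. f z * g z) (conv a b)"
    and "wnorm \<nu> (conv a b) \<le> wnorm \<nu> a * wnorm \<nu> b"
    and "\<And>k. ((\<lambda>j. a j * b (k - j)) has_sum conv a b k) UNIV"
proof -
  let ?A = "\<lambda>k. \<nu> k * norm (a k)" and ?B = "\<lambda>k. \<nu> k * norm (b k)"
  have AB: "((\<lambda>(k,j). ?A j * ?B (k - j)) has_sum wnorm \<nu> a * wnorm \<nu> b) (UNIV \<times> UNIV)"
    using has_sum_prod_nonneg[of ?A ?B] f g weight_nonneg
      has_sum_conv_reindex[of "\<lambda>(i,j). ?A i * ?B j" "wnorm \<nu> a * wnorm \<nu> b"]
    by (auto simp: has_fourier_def wnorm_def)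
  let ?h = "\<lambda>(k,j). \<nu> k * (norm (a j) * norm (b (k - j)))"
  have le: "?h p \<le> (\<lambda>(k,j). ?A j * ?B (k - j)) p" for p
  proof -
    obtain k j where p: "p = (k, j)" by force
    show ?thesis using mult_right_mono[OF weight_submult[of j "k - j"], of "norm (a j) * norm (b (k - j))"]
      by (simp add: p mult_ac)
  qed
  have h: "?h summable_on UNIV \<times> UNIV"
    by (rule summable_on_comparison_test[OF has_sum_imp_summable[OF AB]])
       (use le weight_nonneg in \<open>auto\<close>)
  have row: "(\<lambda>j. \<nu> k * (norm (a j) * norm (b (k - j)))) summable_on UNIV" for k
    using summable_on_SigmaD1[of "\<lambda>k j. \<nu> k * (norm (a j) * norm (b (k - j)))" UNIV "\<lambda>_. UNIV" k] h
    by simp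
  have abs_row: "(\<lambda>j. norm (a j * b (k - j))) summable_on UNIV" for k
  proof -
    have "\<nu> k \<noteq> 0" using weight_ge_1[of k] by auto
    with row[of k] show ?thesis
      by (subst (asm) summable_on_cmult_right') (auto simp: norm_mult)
  qed
  show cs: "((\<lambda>j. a j * b (k - j)) has_sum conv a b k) UNIV" for k
    unfolding conv_def by (rule has_sum_infsum[OF abs_summable_summable[OF abs_row]])
  have sums: "((\<lambda>k. \<Sum>\<^sub>\<infinity>j. \<nu> k * (norm (a j) * norm (b (k - j)))) has_sum infsum ?h (UNIV \<times> UNIV)) UNIV"
    by (rule has_sum_Sigma'[OF has_sum_infsum[OF h]]) (use row in auto)
  have le2: "\<nu> k * norm (conv a b k) \<le> (\<Sum>\<^sub>\<infinity>j. \<nu> k * (norm (a j) * norm (b (k - j))))" for k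
  proof -
    have "norm (conv a b k) \<le> (\<Sum>\<^sub>\<infinity>j. norm (a j * b (k - j)))"
      unfolding conv_def by (rule norm_infsum_bound) (use abs_row in auto)
    then show ?thesis
      by (simp add: norm_mult infsum_cmult_right' mult_left_mono weight_nonneg)
  qed
  have ws: "(\<lambda>k. \<nu> k * norm (conv a b k)) summable_on UNIV"
    by (rule summable_on_comparison_test[OF has_sum_imp_summable[OF sums]])
       (use le2 weight_nonneg in auto)
  show "wnorm \<nu> (conv a b) \<le> wnorm \<nu> a * wnorm \<nu> b"
  proof -
    have "wnorm \<nu> (conv a b) \<le> infsum ?h (UNIV \<times> UNIV)"
      unfolding wnorm_def by (rule has_sum_mono[OF has_sum_infsum[OF ws] sums le2])
    also have "\<dots> \<le> wnorm \<nu> a * wnorm \<nu> b"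
      by (rule has_sum_mono[OF has_sum_infsum[OF h] AB le])
    finally show ?thesis .
  qed
  show "has_fourier \<nu> (\<lambda>z. f z * g z) (conv a b)"
    unfolding has_fourier_def
  proof (intro conjI allI impI ws)
    fix z :: complex assume z: "norm z = 1"
    have z0: "z \<noteq> 0" using z by auto
    have "((\<lambda>(i,j). (a i * z powi i) * (b j * z powi j)) has_sum f z * g z) (UNIV \<times> UNIV)"
    proof (rule has_sum_prod_abs)
      show "(\<lambda>i. norm (a i * z powi i)) summable_on UNIV" "(\<lambda>i. norm (b i * z powi i)) summable_on UNIV"
        using f g z abs_summable_coeffs by (auto simp: has_fourier_def norm_mult norm_powi_unit)
    qed (use f g z in \<open>auto simp: has_fourier_def\<close>)
    then have "((\<lambda>(k,j). (a j * z powi j) * (b (k - j) * z powi (k - j))) has_sum f z * g z) (UNIV \<times> UNIV)"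
      using has_sum_conv_reindex[of "\<lambda>(i,j). (a i * z powi i) * (b j * z powi j)" "f z * g z"] by simp
    then show "((\<lambda>k. conv a b k * z powi k) has_sum f z * g z) UNIV"
    proof (rule has_sum_Sigma')
      fix k
      have "((\<lambda>j. (a j * b (k - j)) * z powi k) has_sum conv a b k * z powi k) UNIV"
        using cs by (rule has_sum_cmult_left)
      moreover have "(a j * z powi j) * (b (k - j) * z powi (k - j)) = (a j * b (k - j)) * z powi k" for j
      proof -
        have "z powi j * z powi (k - j) = z powi k"
          using z0 by (simp add: power_int_diff)
        then show ?thesis by (simp add: mult_ac)
      qed
      ultimately show "((\<lambda>j. case (k, j) of (k, j) \<Rightarrow> a j * z powi j * (b (k - j) * z powi (k - j))) has_sum
        conv a b k * z powi k) UNIV" by (simp only: prod.case)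
    qed
  qed
qed

section \<open>Linear operations, series and exponentials in the algebra\<close>

lemma has_fourier_add:
  assumes "has_fourier \<nu> f a" "has_fourier \<nu> g b"
  shows "has_fourier \<nu> (\<lambda>z. f z + g z) (\<lambda>k. a k + b k)"
  unfolding has_fourier_def
proof (intro conjI allI impI)
  have "(\<lambda>k. \<nu> k * norm (a k) + \<nu> k * norm (b k)) summable_on UNIV"
    using assms by (intro summable_on_add) (auto simp: has_fourier_def)
  then show "(\<lambda>k. \<nu> k * norm (a k + b k)) summable_on UNIV"
  proof (rule summable_on_comparison_test)
    fix k
    show "\<nu> k * norm (a k + b k) \<le> \<nu> k * norm (a k) + \<nu> k * norm (b k)"
      by (metis distrib_left mult_left_mono norm_triangle_ineq weight_nonneg)
  qed (simp add: weight_nonneg)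
qed (use assms in \<open>auto simp: has_fourier_def ring_distribs intro!: has_sum_add\<close>)

lemma has_fourier_cmult:
  assumes "has_fourier \<nu> f a"
  shows "has_fourier \<nu> (\<lambda>z. c * f z) (\<lambda>k. c * a k)" "wnorm \<nu> (\<lambda>k. c * a k) = norm c * wnorm \<nu> a"
proof -
  have e: "\<nu> k * norm (c * a k) = norm c * (\<nu> k * norm (a k))" for k
    by (simp add: norm_mult mult_ac)
  show "wnorm \<nu> (\<lambda>k. c * a k) = norm c * wnorm \<nu> a"
    unfolding wnorm_def e by (rule infsum_cmult_right')
  show "has_fourier \<nu> (\<lambda>z. c * f z) (\<lambda>k. c * a k)"
    unfolding has_fourier_def e using assms
    by (auto simp: has_fourier_def mult.assoc intro!: summable_on_cmult_right has_sum_cmult_right)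
qed

lemma has_fourier_monom: "has_fourier \<nu> (\<lambda>z. c * z powi m) (\<lambda>k. if k = m then c else 0)"
  unfolding has_fourier_def
proof (intro conjI allI impI)
  show "(\<lambda>k. \<nu> k * norm (if k = m then c else 0)) summable_on UNIV"
    by (rule has_sum_imp_summable[OF has_sum_finite_neutralI[of "{m}"]]) auto
  show "((\<lambda>k. (if k = m then c else 0) * z powi k) has_sum c * z powi m) UNIV" for z
    by (rule has_sum_finite_neutralI[of "{m}"]) auto
qed

lemma has_fourier_const: "has_fourier \<nu> (\<lambda>z. c) (\<lambda>k. if k = 0 then c else 0)"
  using has_fourier_monom[of c 0] by simp

text \<open>Plays the role of completeness of the algebra: a series converging absolutely in
  \<open>wnorm\<close> converges coefficientwise, and the pointwise sum on the circle, which is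
  usually known in closed form, identifies the limit.\<close>

lemma has_fourier_series:
  fixes f :: "nat \<Rightarrow> complex \<Rightarrow> complex" and a :: "nat \<Rightarrow> int \<Rightarrow> complex"
  assumes f: "\<And>n. has_fourier \<nu> (f n) (a n)" and le: "\<And>n. wnorm \<nu> (a n) \<le> B n"
    and B: "summable B" and F: "\<And>z. norm z = 1 \<Longrightarrow> (\<lambda>n. f n z) sums F z"
  shows "has_fourier \<nu> F (\<lambda>k. \<Sum>\<^sub>\<infinity>n. a n k)"
proof -
  have Bs: "B summable_on UNIV"
    using B le wnorm_nonneg by (intro summable_nonneg_imp_summable_on) (auto intro: order_trans)
  have ws: "(\<lambda>n. wnorm \<nu> (a n)) summable_on UNIV"
    by (rule summable_on_comparison_test[OF Bs]) (use le wnorm_nonneg in auto)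
  let ?h = "\<lambda>(n,k). \<nu> k * norm (a n k)"
  have h: "?h summable_on UNIV \<times> UNIV"
  proof (rule summable_on_SigmaI)
    show "((\<lambda>k. case (n, k) of (n, k) \<Rightarrow> \<nu> k * norm (a n k)) has_sum wnorm \<nu> (a n)) UNIV" for n
      using f[of n] by (auto simp: has_fourier_def wnorm_def)
  qed (use ws weight_nonneg in auto)
  then have h': "(\<lambda>(k,n). \<nu> k * norm (a n k)) summable_on UNIV \<times> UNIV"
    using summable_on_swap[of ?h UNIV UNIV] by (simp add: case_prod_unfold)
  have row: "(\<lambda>n. \<nu> k * norm (a n k)) summable_on UNIV" for k
    using summable_on_SigmaD1[of "\<lambda>k n. \<nu> k * norm (a n k)" UNIV "\<lambda>_. UNIV" k] h' by simp
  have abs_row: "(\<lambda>n. norm (a n k)) summable_on UNIV" for k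
  proof -
    have "\<nu> k \<noteq> 0" using weight_ge_1[of k] by auto
    with row[of k] show ?thesis by (subst (asm) summable_on_cmult_right') auto
  qed
  show ?thesis unfolding has_fourier_def
  proof (intro conjI allI impI)
    have s: "(\<lambda>k. \<Sum>\<^sub>\<infinity>n. \<nu> k * norm (a n k)) summable_on UNIV"
      using summable_on_Sigma_banach[OF h'] by simp
    show "(\<lambda>k. \<nu> k * norm (\<Sum>\<^sub>\<infinity>n. a n k)) summable_on UNIV"
    proof (rule summable_on_comparison_test[OF s])
      fix k
      have "norm (\<Sum>\<^sub>\<infinity>n. a n k) \<le> (\<Sum>\<^sub>\<infinity>n. norm (a n k))"
        by (rule norm_infsum_bound) (use abs_row in auto)
      then show "\<nu> k * norm (\<Sum>\<^sub>\<infinity>n. a n k) \<le> (\<Sum>\<^sub>\<infinity>n. \<nu> k * norm (a n k))"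
        by (simp add: infsum_cmult_right' mult_left_mono weight_nonneg)
    qed (simp add: weight_nonneg)
  next
    fix z :: complex assume z: "norm z = 1"
    let ?g = "\<lambda>(n,k). a n k * z powi k"
    have "(\<lambda>p. norm (?g p)) summable_on UNIV \<times> UNIV"
      by (rule summable_on_comparison_test[OF h])
         (use z norm_le_weighted in \<open>auto simp: norm_mult norm_powi_unit\<close>)
    then have g: "?g summable_on UNIV \<times> UNIV" by (rule abs_summable_summable)
    have "((\<lambda>n. f n z) has_sum infsum ?g (UNIV \<times> UNIV)) UNIV"
    proof (rule has_sum_Sigma'[OF has_sum_infsum[OF g]])
      show "((\<lambda>k. case (n, k) of (n, k) \<Rightarrow> a n k * z powi k) has_sum f n z) UNIV" for n
        using f[of n] z by (simp add: has_fourier_def)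
    qed
    from sums_unique2[OF has_sum_imp_sums[OF this] F[OF z]]
    have "(?g has_sum F z) (UNIV \<times> UNIV)" using has_sum_infsum[OF g] by simp
    then have "((\<lambda>(k,n). a n k * z powi k) has_sum F z) (UNIV \<times> UNIV)"
      using has_sum_swap[of ?g UNIV UNIV] by (simp add: case_prod_unfold)
    then show "((\<lambda>k. (\<Sum>\<^sub>\<infinity>n. a n k) * z powi k) has_sum F z) UNIV"
    proof (rule has_sum_Sigma')
      fix k
      have "(\<lambda>n. a n k) summable_on UNIV" by (rule abs_summable_summable[OF abs_row])
      then show "((\<lambda>n. case (k, n) of (k, n) \<Rightarrow> a n k * z powi k) has_sum (\<Sum>\<^sub>\<infinity>n. a n k) * z powi k) UNIV"
        by (auto intro!: has_sum_cmult_left)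
    qed
  qed
qed

text \<open>The index is shifted: \<open>conv_pow a n\<close> is the convolution power of order \<open>n + 1\<close>.\<close>

primrec conv_pow :: "(int \<Rightarrow> complex) \<Rightarrow> nat \<Rightarrow> int \<Rightarrow> complex" where
  "conv_pow a 0 = a"
| "conv_pow a (Suc n) = conv a (conv_pow a n)"

lemma has_fourier_power:
  assumes f: "has_fourier \<nu> f a"
  shows "has_fourier \<nu> (\<lambda>z. f z ^ Suc n) (conv_pow a n)" "wnorm \<nu> (conv_pow a n) \<le> wnorm \<nu> a ^ Suc n"
proof (induction n)
  case (Suc n)
  show "has_fourier \<nu> (\<lambda>z. f z ^ Suc (Suc n)) (conv_pow a (Suc n))"
    using has_fourier_mult(1)[OF f Suc(1)] by simp
  show "wnorm \<nu> (conv_pow a (Suc n)) \<le> wnorm \<nu> a ^ Suc (Suc n)"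
    using has_fourier_mult(2)[OF f Suc(1)] mult_left_mono[OF Suc(2) wnorm_nonneg[of a]] by simp
qed (use f in auto)

text \<open>Besides membership, this tracks the spectrum: a set closed under addition contains the
  support of every convolution power. It is used with the positive and with the negative integers,
  where 0 lies outside the set and the mean of the exponential is therefore exactly 1.\<close>

lemma has_fourier_exp:
  assumes f: "has_fourier \<nu> f a"
    and supp: "\<And>k. k \<notin> S \<Longrightarrow> a k = 0" and S: "\<And>i j. i \<in> S \<Longrightarrow> j \<in> S \<Longrightarrow> i + j \<in> S"
  obtains b where "has_fourier \<nu> (\<lambda>z. exp (f z)) b"
    "\<And>k. k \<notin> S \<Longrightarrow> b k = (if k = 0 then 1 else 0)"
proof -
  \<comment> \<open>The constant term of the exponential series is split off and added back as the
    constant function 1, since \<open>conv_pow\<close> starts with the first power.\<close>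
  let ?c = "\<lambda>n. inverse (fact (Suc n)) :: complex"
  have 1: "has_fourier \<nu> (\<lambda>z. ?c n * f z ^ Suc n) (\<lambda>k. ?c n * conv_pow a n k)" for n
    by (rule has_fourier_cmult(1)[OF has_fourier_power(1)[OF f]])
  have 2: "wnorm \<nu> (\<lambda>k. ?c n * conv_pow a n k) \<le> inverse (fact (Suc n)) * wnorm \<nu> a ^ Suc n" for n
  proof -
    have "norm (?c n) = inverse (fact (Suc n))" by (simp add: norm_inverse norm_fact del: fact_Suc)
    then show ?thesis using has_fourier_cmult(2)[OF has_fourier_power(1)[OF f], of "?c n" n]
      mult_left_mono[OF has_fourier_power(2)[OF f, of n], of "norm (?c n)"] by simp
  qed
  have 3: "summable (\<lambda>n. inverse (fact (Suc n)) * wnorm \<nu> a ^ Suc n)"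
    using summable_exp[of "wnorm \<nu> a"] by (subst summable_Suc_iff)
  have 4: "(\<lambda>n. ?c n * f z ^ Suc n) sums (exp (f z) - 1)" for z
    using exp_converges[of "f z"] sums_Suc_iff[of "\<lambda>n. f z ^ n /\<^sub>R fact n" "exp (f z) - 1"]
    by (simp add: scaleR_conv_of_real field_simps)
  let ?b = "\<lambda>k. \<Sum>\<^sub>\<infinity>n. ?c n * conv_pow a n k"
  have "has_fourier \<nu> (\<lambda>z. exp (f z) - 1) ?b"
    by (rule has_fourier_series[OF 1 2 3 4])
  then have "has_fourier \<nu> (\<lambda>z. 1 + (exp (f z) - 1)) (\<lambda>k. (if k = 0 then 1 else 0) + ?b k)"
    by (rule has_fourier_add[OF has_fourier_const])
  then have "has_fourier \<nu> (\<lambda>z. exp (f z)) (\<lambda>k. (if k = 0 then 1 else 0) + ?b k)" by simp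
  moreover have "conv_pow a n k = 0" if "k \<notin> S" for n k
    using that
  proof (induction n arbitrary: k)
    case (Suc n)
    have "a j * conv_pow a n (k - j) = 0" for j
    proof (cases "j \<in> S")
      case True
      then have "k - j \<notin> S" using S[of j "k - j"] Suc.prems by auto
      then show ?thesis using Suc.IH by simp
    qed (use supp in auto)
    then show ?case by (simp only: conv_def conv_pow.simps infsum_0_simp)
  qed (use supp in auto)
  ultimately show ?thesis
    by (intro that[of "\<lambda>k. (if k = 0 then 1 else 0) + ?b k"]) (simp_all del: fact_Suc)
qed

end

section \<open>Fourier coefficients\<close>

text \<open>The constant weight gives absolutely convergent Fourier series. It is the common setting
  for continuity, integrals and uniqueness, to which every \<nu> reduces through \<nu> \<ge>
  1.\<close>

interpretation unit_weight: beurling "\<lambda>_. 1"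
  by unfold_locales auto

section \<open>Continuity and integrals of absolutely convergent Fourier series\<close>

lemma continuous_on_infsum:
  fixes f :: "'a \<Rightarrow> 'b::topological_space \<Rightarrow> 'c::banach"
  assumes "\<And>k. continuous_on S (f k)" "\<And>k z. z \<in> S \<Longrightarrow> norm (f k z) \<le> M k" "M summable_on UNIV"
  shows "continuous_on S (\<lambda>z. \<Sum>\<^sub>\<infinity>k. f k z)"
proof (rule uniform_limit_theorem)
  show "uniform_limit S (\<lambda>X z. \<Sum>k\<in>X. f k z) (\<lambda>z. \<Sum>\<^sub>\<infinity>k. f k z) (finite_subsets_at_top UNIV)"
    by (rule Weierstrass_m_test_general) (use assms in auto)
qed (use assms(1) in \<open>auto intro!: always_eventually continuous_on_sum\<close>)

lemma continuous_on_powi_circle: "continuous_on (sphere 0 1) (\<lambda>z::complex. z powi k)"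
  by (intro continuous_intros) auto

lemma has_fourier_continuous:
  assumes "has_fourier (\<lambda>_. 1) f a"
  shows "continuous_on (sphere 0 1) f"
proof -
  have "continuous_on (sphere 0 1) (\<lambda>z. \<Sum>\<^sub>\<infinity>k. a k * z powi k)"
  proof (rule continuous_on_infsum)
    show "(\<lambda>k. norm (a k)) summable_on UNIV" using assms by (auto simp: has_fourier_def)
  qed (auto intro!: continuous_intros simp: norm_mult norm_powi_unit)
  moreover have "(\<Sum>\<^sub>\<infinity>k. a k * z powi k) = f z" if "z \<in> sphere 0 1" for z
    using assms that by (auto simp: has_fourier_def intro!: infsumI)
  ultimately show ?thesis by (rule continuous_on_eq)
qed

lemma continuous_on_circle_cis:
  assumes "continuous_on (sphere 0 1) f"
  shows "continuous_on A (\<lambda>\<theta>. f (cis \<theta>))"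
  by (rule continuous_on_compose2[OF assms]) (auto intro!: continuous_intros simp: cis_conv_exp)

lemma circle_integral:
  fixes f :: "complex \<Rightarrow> complex"
  assumes "continuous_on (sphere 0 1) f"
  shows "set_integrable lborel {a..b} (\<lambda>\<theta>. f (cis \<theta>))"
    and "(LINT \<theta>:{a..b}|lborel. f (cis \<theta>)) = integral {a..b} (\<lambda>\<theta>. f (cis \<theta>))"
    and "(\<lambda>\<theta>. f (cis \<theta>)) integrable_on {a..b}"
proof -
  show 1: "set_integrable lborel {a..b} (\<lambda>\<theta>. f (cis \<theta>))"
    by (rule borel_integrable_atLeastAtMost') (rule continuous_on_circle_cis[OF assms])
  show "(LINT \<theta>:{a..b}|lborel. f (cis \<theta>)) = integral {a..b} (\<lambda>\<theta>. f (cis \<theta>))"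
    "(\<lambda>\<theta>. f (cis \<theta>)) integrable_on {a..b}"
    using set_borel_integral_eq_integral[OF 1] by auto
qed

lemma fourier_coeff_continuous:
  assumes "continuous_on (sphere 0 1) f"
  shows "fourier_coeff f k = integral {-pi..pi} (\<lambda>\<theta>. f (cis \<theta>) * cis \<theta> powi (- k)) / (2 * pi)"
proof -
  have "(LINT \<theta>:{-pi..pi}|lborel. f (cis \<theta>) * cis \<theta> powi (- k))
      = integral {-pi..pi} (\<lambda>\<theta>. f (cis \<theta>) * cis \<theta> powi (- k))"
    by (rule circle_integral(2)[where f = "\<lambda>z. f z * z powi (- k)"])
       (intro continuous_on_mult assms continuous_on_powi_circle)
  then show ?thesis
    by (simp add: fourier_coeff_def cis_power_int mult.commute)
qed

lemma fourier_coeff_cong: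
  assumes "\<And>z. norm z = 1 \<Longrightarrow> f z = g z"
  shows "fourier_coeff f k = fourier_coeff g k"
  unfolding fourier_coeff_def by (simp add: assms)

lemma has_integral_cis_powi:
  "((\<lambda>\<theta>. cis \<theta> powi k) has_integral (if k = 0 then complex_of_real (2 * pi) else 0)) {c..c + 2 * pi}"
proof (cases "k = 0")
  case True
  then show ?thesis using has_integral_const_real[of "1::complex" c "c + 2 * pi"]
    by (simp add: scaleR_conv_of_real)
next
  case False
  let ?F = "\<lambda>\<theta>. exp (\<i> * of_int k * of_real \<theta>) / (\<i> * of_int k)"
  have "((\<lambda>\<theta>. exp (\<i> * of_int k * of_real \<theta>)) has_integral ?F (c + 2 * pi) - ?F c) {c..c + 2 * pi}"
  proof (rule fundamental_theorem_of_calculus)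
    fix x assume "x \<in> {c..c + 2 * pi}"
    have "((\<lambda>z. exp (\<i> * of_int k * z) / (\<i> * of_int k)) has_field_derivative exp (\<i> * of_int k * of_real x))
        (at (of_real x))"
      by (rule derivative_eq_intros refl | use False in simp)+
    then show "(?F has_vector_derivative exp (\<i> * of_int k * of_real x)) (at x within {c..c + 2 * pi})"
      using has_vector_derivative_real_field by blast
  qed simp
  moreover have "?F (c + 2 * pi) - ?F c = 0"
  proof -
    have "exp (\<i> * of_int k * of_real (c + 2 * pi)) = exp (\<i> * of_int k * of_real c + \<i> * of_int k * of_real (2 * pi))"
      by (simp add: ring_distribs)
    also have "\<dots> = exp (\<i> * of_int k * of_real c) * exp (\<i> * of_int k * of_real (2 * pi))"
      by (rule exp_add)
    also have "exp (\<i> * of_int k * of_real (2 * pi)) = 1"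
      using exp_integer_2pi[of "of_int k"] by (simp add: mult_ac)
    finally show ?thesis by simp
  qed
  moreover have "exp (\<i> * of_int k * of_real \<theta>) = cis \<theta> powi k" for \<theta>
    using cis_power_int[of \<theta> k] by (simp add: cis_conv_exp mult_ac)
  ultimately show ?thesis using False by simp
qed

text \<open>The starting point of the period is left free because \<open>fourier_coeff\<close>
  integrates from -pi to pi, whereas the Szego integral runs from 0 to 2 pi. Uniform convergence
  permits termwise integration.\<close>

lemma has_fourier_integral_0:
  fixes f :: "complex \<Rightarrow> complex"
  assumes "has_fourier (\<lambda>_. 1) f a"
  shows "integral {c..c + 2 * pi} (\<lambda>\<theta>. f (cis \<theta>)) = complex_of_real (2 * pi) * a 0"
proof -
  let ?F = "finite_subsets_at_top (UNIV :: int set)"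
  let ?g = "\<lambda>X \<theta>. \<Sum>k\<in>X. a k * cis \<theta> powi k"
  have "uniform_limit {c..c + 2 * pi} ?g (\<lambda>\<theta>. \<Sum>\<^sub>\<infinity>k. a k * cis \<theta> powi k) ?F"
  proof (rule Weierstrass_m_test_general)
    show "(\<lambda>k. norm (a k)) summable_on UNIV" using assms by (auto simp: has_fourier_def)
  qed (auto simp: norm_mult norm_powi_unit)
  moreover have "(\<Sum>\<^sub>\<infinity>k. a k * cis \<theta> powi k) = f (cis \<theta>)" for \<theta>
    using assms by (auto simp: has_fourier_def intro!: infsumI)
  ultimately have u: "uniform_limit {c..c + 2 * pi} ?g (\<lambda>\<theta>. f (cis \<theta>)) ?F" by simp
  obtain I J where I: "\<And>X. (?g X has_integral I X) {c..c + 2 * pi}"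
    and J: "((\<lambda>\<theta>. f (cis \<theta>)) has_integral J) {c..c + 2 * pi}" and IJ: "(I \<longlongrightarrow> J) ?F"
  proof (rule uniform_limit_integral[OF u])
    show "continuous_on {c..c + 2 * pi} (?g X)" for X
      by (intro continuous_intros continuous_on_circle_cis[where f = "\<lambda>z. z powi _"] continuous_on_powi_circle)
  qed auto
  let ?t = "\<lambda>k::int. a k * (if k = 0 then complex_of_real (2 * pi) else 0)"
  have "I X = sum ?t X" for X
  \<comment> \<open>\<open>I\<close> is given for every set \<open>X\<close>; for infinite
    \<open>X\<close> both sums are 0 by convention.\<close>
  proof (cases "finite X")
    case True
    have "(?g X has_integral sum ?t X) {c..c + 2 * pi}"
      by (intro has_integral_sum[OF True] has_integral_mult_right has_integral_cis_powi)
    with I[of X] show ?thesis by (rule has_integral_unique)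
  qed (use I[of X] in \<open>auto simp: has_integral_0_eq\<close>)
  moreover have "(?t has_sum complex_of_real (2 * pi) * a 0) UNIV"
    by (rule has_sum_finite_neutralI[of "{0}"]) auto
  moreover have "I = sum ?t" using calculation(1) by blast
  ultimately have "(I \<longlongrightarrow> complex_of_real (2 * pi) * a 0) ?F" by (simp add: has_sum_def)
  then have "J = complex_of_real (2 * pi) * a 0"
    using IJ by (intro tendsto_unique[of ?F]) auto
  with J show ?thesis by (simp add: integral_unique)
qed

lemma conv_monom: "conv a (\<lambda>k. if k = m then c else 0) k = c * a (k - m)"
  unfolding conv_def
  by (rule infsumI, rule has_sum_finite_neutralI[of "{k - m}"]) auto

lemma (in beurling) has_fourier_shift:
  assumes "has_fourier \<nu> f a"
  shows "has_fourier \<nu> (\<lambda>z. f z * z powi m) (\<lambda>k. a (k - m))"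
  using has_fourier_mult(1)[OF assms has_fourier_monom[of 1 m]] by (simp add: conv_monom[abs_def])

lemma has_fourier_fourier_coeff:
  assumes "has_fourier (\<lambda>_. 1) f a"
  shows "fourier_coeff f k = a k"
  using has_fourier_integral_0[OF unit_weight.has_fourier_shift[OF assms, of "- k"], of "- pi"]
  by (simp add: fourier_coeff_continuous[OF has_fourier_continuous[OF assms]])

lemma has_fourier_unique:
  assumes "has_fourier (\<lambda>_. 1) f a" "has_fourier (\<lambda>_. 1) g b" "\<And>z. norm z = 1 \<Longrightarrow> f z = g z"
  shows "a = b"
proof
  fix k
  have "fourier_coeff f k = fourier_coeff g k"
    by (rule fourier_coeff_cong) (rule assms(3))
  then show "a k = b k"
    by (simp add: has_fourier_fourier_coeff[OF assms(1)] has_fourier_fourier_coeff[OF assms(2)])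
qed

lemma (in beurling) has_fourier_unit:
  "has_fourier \<nu> f a \<Longrightarrow> has_fourier (\<lambda>_. 1) f a"
  by (erule has_fourier_const_weight) (rule weight_ge_1)

lemma cnj_powi_unit: "norm z = 1 \<Longrightarrow> cnj (z powi k) = z powi (- k)"
proof -
  assume z: "norm z = 1"
  then have "cnj z = inverse z"
    by (metis complex_cnj_cnj complex_norm_square divide_self_if inverse_eq_divide mult_cancel_left1
        nonzero_mult_div_cancel_left norm_zero of_real_1 one_power2 zero_neq_one)
  then show ?thesis by (simp add: power_int_minus power_int_inverse)
qed

lemma (in beurling) has_fourier_cnj:
  assumes "has_fourier \<nu> f a"
  shows "has_fourier \<nu> (\<lambda>z. cnj (f z)) (\<lambda>k. cnj (a (- k)))"
  unfolding has_fourier_def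
proof (intro conjI allI impI)
  have "(\<lambda>k. \<nu> (- k) * norm (a (- k))) summable_on UNIV"
    using assms summable_on_reindex_bij_betw[OF bij_uminus, of "\<lambda>k. \<nu> k * norm (a k)"]
    by (simp add: has_fourier_def)
  then show "(\<lambda>k. \<nu> k * norm (cnj (a (- k)))) summable_on UNIV" by (simp add: weight_sym)
  fix z :: complex assume z: "norm z = 1"
  then have "((\<lambda>k. cnj (a k * z powi k)) has_sum cnj (f z)) UNIV"
    using assms by (simp add: has_fourier_def del: complex_cnj_mult)
  then have "((\<lambda>k. cnj (a (- k) * z powi (- k))) has_sum cnj (f z)) UNIV"
    using has_sum_reindex_bij_betw[OF bij_uminus, of "\<lambda>k. cnj (a k * z powi k)"] by simp
  then show "((\<lambda>k. cnj (a (- k)) * z powi k) has_sum cnj (f z)) UNIV"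
    by (simp add: cnj_powi_unit[OF z] del: complex_cnj_power_int)
qed

section \<open>Uniqueness and decay of Fourier coefficients\<close>

lemma circle_integrable:
  fixes g :: "complex \<Rightarrow> complex"
  assumes "continuous_on (sphere 0 1) g"
  shows "(\<lambda>\<theta>. g (cis \<theta>) * cis \<theta> powi k) integrable_on {a..b}"
  by (rule circle_integral(3)[where f = "\<lambda>z. g z * z powi k"])
     (intro continuous_on_mult assms continuous_on_powi_circle)

lemma fourier_coeff_add:
  assumes "continuous_on (sphere 0 1) f" "continuous_on (sphere 0 1) g"
  shows "fourier_coeff (\<lambda>z. f z + g z) k = fourier_coeff f k + fourier_coeff g k"
proof -
  have "integral {-pi..pi} (\<lambda>\<theta>. f (cis \<theta>) * cis \<theta> powi (-k) + g (cis \<theta>) * cis \<theta> powi (-k))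
      = integral {-pi..pi} (\<lambda>\<theta>. f (cis \<theta>) * cis \<theta> powi (-k)) + integral {-pi..pi} (\<lambda>\<theta>. g (cis \<theta>) * cis \<theta> powi (-k))"
    by (intro Henstock_Kurzweil_Integration.integral_add circle_integrable assms)
  then show ?thesis
    by (simp add: fourier_coeff_continuous[OF continuous_on_add[OF assms]] fourier_coeff_continuous[OF assms(1)]
        fourier_coeff_continuous[OF assms(2)] ring_distribs add_divide_distrib)
qed

lemma fourier_coeff_cmult:
  assumes "continuous_on (sphere 0 1) f"
  shows "fourier_coeff (\<lambda>z. f z * c) k = fourier_coeff f k * c"
proof -
  have "(\<lambda>\<theta>. f (cis \<theta>) * c * cis \<theta> powi (-k)) = (\<lambda>\<theta>. f (cis \<theta>) * cis \<theta> powi (-k) * c)"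
    by (simp add: mult_ac)
  then show ?thesis
    using fourier_coeff_continuous[OF continuous_on_mult_right[OF assms], of c k]
    by (simp add: fourier_coeff_continuous[OF assms])
qed

lemma fourier_coeff_shift:
  assumes "continuous_on (sphere 0 1) f"
  shows "fourier_coeff (\<lambda>z. f z * z powi m) k = fourier_coeff f (k - m)"
proof -
  have "cis \<theta> powi m * cis \<theta> powi (- k) = cis \<theta> powi (- (k - m))" for \<theta>
    by (subst power_int_add[symmetric]) auto
  then show ?thesis
    using fourier_coeff_continuous[OF continuous_on_mult[OF assms continuous_on_powi_circle], of m k]
    by (simp add: fourier_coeff_continuous[OF assms] mult.assoc)
qed

text \<open>On the circle a real linear function of z is c z + d / z, so multiplying by it combines
  shifted coefficients. Keeping \<open>f\<close> arbitrary in the induction handles products: the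
  first factor turns \<open>f\<close> into another continuous function with vanishing coefficients.
  The form in real polynomials is the one that Stone-Weierstrass delivers.\<close>

lemma polynomial_multiplier_zero_coeffs:
  fixes p :: "complex \<Rightarrow> real"
  assumes "real_polynomial_function p" "continuous_on (sphere 0 1) f" "\<And>k. fourier_coeff f k = 0"
  shows "fourier_coeff (\<lambda>z. f z * of_real (p z)) k = 0"
proof -
  have cont: "continuous_on (sphere 0 1) q" if "real_polynomial_function q" for q :: "complex \<Rightarrow> real"
    using that by (intro continuous_on_polymonial_function) (simp add: real_polynomial_function_eq)
  show ?thesis using assms
  proof (induction p arbitrary: f k rule: real_polynomial_function.induct)
  case (linear p)
  note f = linear(2,3)
  interpret bounded_linear p by fact
  define c where "c = (of_real (p 1) - \<i> * of_real (p \<i>)) / 2"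
  define d where "d = (of_real (p 1) + \<i> * of_real (p \<i>)) / 2"
  have *: "f z * of_real (p z) = (f z * c) * z powi 1 + (f z * d) * z powi (-1)" if z: "norm z = 1" for z
  proof -
    have "p z = p (Re z *\<^sub>R 1 + Im z *\<^sub>R \<i>)"
      by (rule arg_cong[of _ _ p]) (simp add: complex_eq_iff)
    also have "\<dots> = Re z * p 1 + Im z * p \<i>" by (simp only: add scaleR) simp
    finally have "complex_of_real (p z) = c * z + d * cnj z"
      by (simp add: c_def d_def complex_eq_iff field_simps)
    moreover have "cnj z = z powi (-1)" using cnj_powi_unit[OF z, of 1] by simp
    ultimately show ?thesis by (simp add: ring_distribs)
  qed
  have cf: "continuous_on (sphere 0 1) (\<lambda>z. f z * e)" for e
    by (intro continuous_intros f)
  have "fourier_coeff (\<lambda>z. f z * of_real (p z)) k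
      = fourier_coeff (\<lambda>z. (f z * c) * z powi 1 + (f z * d) * z powi (-1)) k"
    by (rule fourier_coeff_cong) (rule *)
  also have "\<dots> = fourier_coeff (\<lambda>z. (f z * c) * z powi 1) k + fourier_coeff (\<lambda>z. (f z * d) * z powi (-1)) k"
    by (intro fourier_coeff_add continuous_on_mult[OF cf continuous_on_powi_circle])
  also have "\<dots> = 0"
    by (simp only: fourier_coeff_shift[OF cf] fourier_coeff_cmult[OF f(1)] f(2)) simp
  finally show ?case .
next
  case (const c)
  then show ?case using fourier_coeff_cmult[OF const.prems(1), of "of_real c" k] by simp
next
  case (add p q)
  have "continuous_on (sphere 0 1) (\<lambda>z. f z * of_real (p z))" "continuous_on (sphere 0 1) (\<lambda>z. f z * of_real (q z))"
    using cont[OF add(1)] cont[OF add(2)] add(5) by (auto intro!: continuous_intros)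
  from fourier_coeff_add[OF this] add show ?case by (simp add: ring_distribs)
next
  case (mult p q)
  have "continuous_on (sphere 0 1) (\<lambda>z. f z * of_real (p z))"
    using cont[OF mult(1)] mult(5) by (auto intro!: continuous_intros)
  from mult.IH(2)[OF this mult.IH(1)[OF mult.prems]] show ?case by (simp add: mult.assoc)
  qed
qed

text \<open>A polynomial \<open>g\<close> close to the conjugate of \<open>f\<close> integrates to 0
  against \<open>f\<close>, so the integral of |f|^2 equals that of f (cnj f - g) and is arbitrarily
  small. Continuity then forces \<open>f\<close> to vanish everywhere on the circle.\<close>

lemma zero_fourier_coeffs_imp_zero:
  assumes f: "continuous_on (sphere 0 1) f" and zero: "\<And>k. fourier_coeff f k = 0" and z: "norm z = 1"
  shows "f z = 0"
proof -
  have "compact ((\<lambda>z. norm (f z)) ` sphere 0 1)"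
    by (intro compact_continuous_image continuous_intros f) auto
  then obtain B where B: "B > 0" "\<And>z. norm z = 1 \<Longrightarrow> norm (f z) \<le> B"
    unfolding compact_eq_bounded_closed bounded_pos by auto
  let ?J = "\<lambda>g. integral {-pi..pi} (\<lambda>\<theta>. g (cis \<theta>)) :: complex"
  have small: "norm (?J (\<lambda>z. f z * cnj (f z))) \<le> 2 * pi * B * e" if "e > 0" for e
  proof -
    have "continuous_on (sphere 0 1) (\<lambda>z. cnj (f z))" by (intro continuous_intros f)
    from Stone_Weierstrass_polynomial_function[OF _ this \<open>e > 0\<close>]
    obtain g :: "complex \<Rightarrow> complex" where g: "polynomial_function g"
      and ge: "\<And>z. norm z = 1 \<Longrightarrow> norm (cnj (f z) - g z) < e" by auto
    have pr: "real_polynomial_function (\<lambda>z. Re (g z))" "real_polynomial_function (\<lambda>z. Im (g z))"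
      using g bounded_linear_Re bounded_linear_Im by (auto simp: polynomial_function_def o_def)
    have cg: "continuous_on (sphere 0 1) g" by (rule continuous_on_polymonial_function[OF g])
    have c1: "continuous_on (sphere 0 1) (\<lambda>z. f z * of_real (Re (g z)))"
      and c2: "continuous_on (sphere 0 1) (\<lambda>z. f z * of_real (Im (g z)))"
      by (intro continuous_intros f cg)+
    have "f z * g z = f z * of_real (Re (g z)) + f z * of_real (Im (g z)) * \<i>" for z
      by (subst complex_eq[of "g z"]) (simp add: ring_distribs mult_ac)
    then have "fourier_coeff (\<lambda>z. f z * g z) 0 = 0"
      using fourier_coeff_add[OF c1 continuous_on_mult_right[OF c2]]
        polynomial_multiplier_zero_coeffs[OF pr(1) f zero] polynomial_multiplier_zero_coeffs[OF pr(2) f zero]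
      by (simp add: fourier_coeff_cmult[OF c2])
    then have fg: "?J (\<lambda>z. f z * g z) = 0"
      using fourier_coeff_continuous[OF continuous_on_mult[OF f cg], of 0] by simp
    have cd: "continuous_on (sphere 0 1) (\<lambda>z. f z * (cnj (f z) - g z))"
      by (intro continuous_intros f cg)
    have "?J (\<lambda>z. f z * cnj (f z)) = ?J (\<lambda>z. f z * (cnj (f z) - g z)) + ?J (\<lambda>z. f z * g z)"
      using Henstock_Kurzweil_Integration.integral_add[OF circle_integral(3)[OF cd] circle_integral(3)[OF continuous_on_mult[OF f cg]]]
      by (simp add: ring_distribs)
    then have eq: "?J (\<lambda>z. f z * cnj (f z)) = ?J (\<lambda>z. f z * (cnj (f z) - g z))"
      using fg by simp
    have "norm (?J (\<lambda>z. f z * (cnj (f z) - g z))) \<le> (B * e) * measure lborel {-pi..pi}"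
    proof (rule has_integral_bound_real)
      show "((\<lambda>\<theta>. f (cis \<theta>) * (cnj (f (cis \<theta>)) - g (cis \<theta>))) has_integral ?J (\<lambda>z. f z * (cnj (f z) - g z))) {-pi..pi}"
        by (rule integrable_integral[OF circle_integral(3)[OF cd]])
      show "norm (f (cis \<theta>) * (cnj (f (cis \<theta>)) - g (cis \<theta>))) \<le> B * e" for \<theta>
        using B(2)[of "cis \<theta>"] ge[of "cis \<theta>"] by (simp only: norm_mult) (intro mult_mono, use B in auto)
    qed (use B \<open>e > 0\<close> in auto)
    then show ?thesis using eq by (simp add: mult_ac)
  qed
  have J0: "?J (\<lambda>z. f z * cnj (f z)) = 0"
  proof (rule ccontr)
    assume n: "?J (\<lambda>z. f z * cnj (f z)) \<noteq> 0"
    let ?N = "norm (?J (\<lambda>z. f z * cnj (f z)))"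
    \<comment> \<open>The tolerance is chosen so that the bound becomes half of the quantity
      itself.\<close>
    have "?N \<le> 2 * pi * B * (?N / (4 * pi * B))" by (rule small) (use n B in simp)
    also have "\<dots> = ?N / 2" using B(1) by (simp add: field_simps)
    finally show False using n by simp
  qed
  have "integral {-pi..pi} (\<lambda>\<theta>. complex_of_real ((norm (f (cis \<theta>)))\<^sup>2)) = 0"
    using J0 by (simp only: complex_norm_square)
  moreover have "integral {-pi..pi} (\<lambda>\<theta>. complex_of_real ((norm (f (cis \<theta>)))\<^sup>2))
      = complex_of_real (integral {-pi..pi} (\<lambda>\<theta>. (norm (f (cis \<theta>)))\<^sup>2))"
  proof -
    have "(\<lambda>\<theta>. (norm (f (cis \<theta>)))\<^sup>2) integrable_on {-pi..pi}"
      by (intro integrable_continuous_real continuous_intros continuous_on_circle_cis f)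
    from integral_linear[OF this bounded_linear_of_real] show ?thesis
      by (simp add: o_def)
  qed
  ultimately have "integral {-pi..pi} (\<lambda>\<theta>. (norm (f (cis \<theta>)))\<^sup>2) = 0" by simp
  then have "\<forall>\<theta>\<in>{-pi..pi}. (norm (f (cis \<theta>)))\<^sup>2 = 0"
    by (subst (asm) integral_eq_0_iff) (auto intro!: continuous_intros continuous_on_circle_cis f)
  then have "f (cis (Arg z)) = 0"
    using Arg_bounded[of z] by auto
  moreover have "cis (Arg z) = z" using z rcis_cmod_Arg[of z] by (simp add: rcis_def)
  ultimately show ?thesis by simp
qed

lemma (in beurling) has_fourier_of_coeffs:
  assumes f: "continuous_on (sphere 0 1) f" and s: "(\<lambda>k. \<nu> k * norm (fourier_coeff f k)) summable_on UNIV"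
  shows "has_fourier \<nu> f (fourier_coeff f)"
proof -
  define g where "g = (\<lambda>z. \<Sum>\<^sub>\<infinity>k. fourier_coeff f k * z powi k)"
  have g: "has_fourier \<nu> g (fourier_coeff f)" unfolding g_def by (rule has_fourierI[OF s])
  note cg = has_fourier_continuous[OF has_fourier_unit[OF g]]
  have "f z + g z * (-1) = 0" if "norm z = 1" for z
  proof (rule zero_fourier_coeffs_imp_zero[OF _ _ that])
    show "continuous_on (sphere 0 1) (\<lambda>z. f z + g z * (-1))" by (intro continuous_intros f cg)
    show "fourier_coeff (\<lambda>z. f z + g z * (-1)) k = 0" for k
      by (simp only: fourier_coeff_add[OF f continuous_on_mult_right[OF cg]] fourier_coeff_cmult[OF cg]
          has_fourier_fourier_coeff[OF has_fourier_unit[OF g]]) simp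
  qed
  then show ?thesis by (intro has_fourier_cong[OF g]) simp
qed

section \<open>Exponential decay for functions holomorphic on a strip\<close>

text \<open>On a strip \<open>F\<close> has a primitive \<open>H\<close>, and \<open>H(\<zeta> + 2\<pi>) - H(\<zeta>)\<close> is constant by periodicity; so
  the integral over a period may be moved to the height where the exponential factor is smallest.\<close>

lemma strip_fourier_decay:
  fixes F :: "complex \<Rightarrow> complex"
  assumes hol: "F holomorphic_on {\<zeta>. \<bar>Im \<zeta>\<bar> < t}" and s: "0 \<le> s" "s < t"
    and per: "\<And>\<zeta>. \<bar>Im \<zeta>\<bar> < t \<Longrightarrow> F (\<zeta> + 2 * pi) = F \<zeta>"
    and bd: "\<And>\<zeta>. \<bar>Re \<zeta>\<bar> \<le> pi \<Longrightarrow> \<bar>Im \<zeta>\<bar> \<le> s \<Longrightarrow> norm (F \<zeta>) \<le> B"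
    and f: "continuous_on (sphere 0 1) f" and fF: "\<And>\<theta>. f (cis \<theta>) = F (of_real \<theta>)"
  shows "norm (fourier_coeff f k) \<le> B * exp (- s * \<bar>of_int k\<bar>)"
proof -
  let ?T = "{\<zeta>. \<bar>Im \<zeta>\<bar> < t}"
  have T: "?T = {\<zeta>. Im \<zeta> < t} \<inter> {\<zeta>. Im \<zeta> > - t}" by auto
  have convT: "convex ?T" unfolding T by (intro convex_Int convex_halfspace_Im_lt convex_halfspace_Im_gt)
  have openT: "open ?T" unfolding T by (intro open_Int open_halfspace_Im_lt open_halfspace_Im_gt)
  define E where "E = (\<lambda>\<zeta>. F \<zeta> * exp (- (\<i> * of_int k * \<zeta>)))"
  have holE: "E holomorphic_on ?T" unfolding E_def by (intro holomorphic_intros hol)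
  have Eper: "E (\<zeta> + 2 * pi) = E \<zeta>" if "\<bar>Im \<zeta>\<bar> < t" for \<zeta>
  proof -
    have "exp (- (\<i> * of_int k * (\<zeta> + 2 * pi))) = exp (- (\<i> * of_int k * \<zeta>)) * exp ((2 * of_int (- k) * pi) * \<i>)"
      by (subst exp_add[symmetric]) (simp add: algebra_simps)
    also have "exp ((2 * of_int (- k) * pi) * \<i>) = 1" by (rule exp_integer_2pi) auto
    finally show ?thesis using per[OF that] by (simp add: E_def)
  qed
  obtain H where H: "\<And>\<zeta>. \<zeta> \<in> ?T \<Longrightarrow> (H has_field_derivative E \<zeta>) (at \<zeta>)"
  proof (rule holomorphic_convex_primitive[OF convT finite.emptyI])
    show "continuous_on ?T E" using holE by (rule holomorphic_on_imp_continuous_on)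
    show "\<zeta> \<in> interior ?T - {} \<Longrightarrow> E field_differentiable at \<zeta>" for \<zeta>
      using holE openT by (auto simp: interior_open holomorphic_on_open field_differentiable_def)
  qed (use openT at_within_open in \<open>metis\<close>)
  have "\<exists>c. \<forall>\<zeta>\<in>?T. H (\<zeta> + 2 * pi) - H \<zeta> = c"
  proof (rule has_field_derivative_zero_constant[OF convT])
    fix \<zeta> assume z: "\<zeta> \<in> ?T"
    then have "((\<lambda>\<zeta>. H (\<zeta> + 2 * pi)) has_field_derivative E (\<zeta> + 2 * pi)) (at \<zeta>)"
      by (subst DERIV_shift[symmetric]) (rule H, simp)
    from DERIV_diff[OF this H[OF z]] show "((\<lambda>\<zeta>. H (\<zeta> + 2 * pi) - H \<zeta>) has_field_derivative 0) (at \<zeta> within ?T)"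
      using Eper[of \<zeta>] z by (auto intro: has_field_derivative_at_within)
  qed
  then obtain c where c: "\<And>\<zeta>. \<zeta> \<in> ?T \<Longrightarrow> H (\<zeta> + 2 * pi) - H \<zeta> = c" by blast
  have int: "((\<lambda>\<theta>. E (of_real \<theta> + \<i> * of_real y)) has_integral c) {-pi..pi}" if y: "\<bar>y\<bar> < t" for y
  proof -
    have "((\<lambda>\<theta>. E (of_real \<theta> + \<i> * of_real y)) has_integral
        H (of_real pi + \<i> * of_real y) - H (of_real (-pi) + \<i> * of_real y)) {-pi..pi}"
    proof (rule fundamental_theorem_of_calculus)
      fix x
      have "((\<lambda>\<zeta>. H (\<zeta> + \<i> * of_real y)) has_field_derivative E (of_real x + \<i> * of_real y)) (at (of_real x))"
        by (subst DERIV_shift[symmetric]) (rule H, simp add: y)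
      then show "((\<lambda>x. H (of_real x + \<i> * of_real y)) has_vector_derivative E (of_real x + \<i> * of_real y))
          (at x within {-pi..pi})"
        by (rule has_vector_derivative_real_field)
    qed simp
    moreover have "H (of_real pi + \<i> * of_real y) - H (of_real (-pi) + \<i> * of_real y) = c"
      using c[of "of_real (-pi) + \<i> * of_real y"] y by (simp add: algebra_simps)
    ultimately show ?thesis by simp
  qed
  have B: "0 \<le> B" using bd[of 0] s order_trans[OF norm_ge_zero] by fastforce
  \<comment> \<open>At height y the exponential factor has modulus exp (k y); this sign of y makes
    it exp (- s |k|).\<close>
  define y where "y = - s * sgn (of_int k)"
  have y: "\<bar>y\<bar> \<le> s" using s by (auto simp: y_def sgn_if)
  have "norm c \<le> (B * exp (- s * \<bar>of_int k\<bar>)) * measure lborel {-pi..pi}"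
  proof (rule has_integral_bound_real[OF _ finite.emptyI int])
    show "\<bar>y\<bar> < t" using y s by linarith
    fix x assume x: "x \<in> {-pi..pi} - {}"
    have "norm (F (of_real x + \<i> * of_real y)) \<le> B" by (rule bd) (use x y in auto)
    moreover have "norm (exp (- (\<i> * of_int k * (of_real x + \<i> * of_real y)))) = exp (- s * \<bar>of_int k\<bar>)"
      by (simp add: norm_exp_eq_Re y_def sgn_if)
    ultimately show "norm (E (of_real x + \<i> * of_real y)) \<le> B * exp (- s * \<bar>of_int k\<bar>)"
      unfolding E_def norm_mult by (simp add: mult_right_mono)
  qed (use B in simp)
  moreover have "fourier_coeff f k = c / (2 * pi)"
  proof -
    have "f (cis \<theta>) * cis \<theta> powi (- k) = E (of_real \<theta> + \<i> * of_real 0)" for \<theta>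
      using cis_power_int[of \<theta> "- k"] unfolding fF E_def by (simp add: cis_conv_exp mult_ac)
    then show ?thesis
      using int[of 0] s by (simp add: fourier_coeff_continuous[OF f] integral_unique)
  qed
  ultimately show ?thesis by (simp add: norm_divide divide_le_eq mult_ac)
qed

section \<open>Growth of Beurling weights\<close>

lemma subadditive_imp_linear_bound:
  fixes a :: "nat \<Rightarrow> real"
  assumes sub: "\<And>m n. a (m + n) \<le> a m + a n"
  shows "a (q * p) \<le> real q * a p + a 0"
proof (induction q)
  case (Suc q)
  have "a (Suc q * p) \<le> a p + a (q * p)" using sub[of p "q * p"] by simp
  then show ?case using Suc by (simp add: ring_distribs)
qed simp

text \<open>Fekete's lemma, with nonnegativity bounding the quotients below. Applied to the
  logarithm of the weight, it shows that the \<open>lim\<close> in \<open>A_exp\<close> is a genuine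
  limit and also the infimum of the quotients.\<close>

lemma fekete:
  fixes a :: "nat \<Rightarrow> real"
  assumes sub: "\<And>m n. a (m + n) \<le> a m + a n" and nonneg: "\<And>n. 0 \<le> a n"
  shows "(\<lambda>n. a n / n) \<longlonglongrightarrow> (INF n\<in>{1..}. a n / n)"
    and "1 \<le> n \<Longrightarrow> (INF n\<in>{1..}. a n / n) \<le> a n / n"
proof -
  let ?A = "INF n\<in>{1..}. a n / real n"
  have bdd: "bdd_below ((\<lambda>n. a n / real n) ` {1..})"
    using nonneg by (intro bdd_belowI[of _ 0]) auto
  show low: "1 \<le> n \<Longrightarrow> ?A \<le> a n / n" for n
    using bdd by (intro cINF_lower) auto
  show "(\<lambda>n. a n / n) \<longlonglongrightarrow> ?A"
  proof (rule LIMSEQ_I)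
    fix e :: real assume e: "e > 0"
    have "\<exists>p\<in>{1..}. a p / real p < ?A + e / 2"
      using cINF_less_iff[OF _ bdd, of "?A + e / 2"] e by auto
    then obtain p where p: "p \<ge> 1" "a p / real p < ?A + e / 2" by auto
    \<comment> \<open>\<open>M\<close> absorbs every possible remainder modulo \<open>p\<close> and
      the additive constant of the linear bound; after division by \<open>n\<close> it contributes
      less than e / 2.\<close>
    define M where "M = (\<Sum>r<p. a r) + a 0"
    have upper: "a n \<le> real n * (a p / real p) + M" for n
    proof -
      have "a n \<le> a (n div p * p) + a (n mod p)"
        using sub[of "n div p * p" "n mod p"] by simp
      also have "a (n div p * p) \<le> real (n div p) * a p + a 0" by (rule subadditive_imp_linear_bound[OF sub])
      also have "real (n div p) * a p \<le> real n * (a p / real p)"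
      proof -
        have "real (n div p) * real p \<le> real n"
          by (metis div_times_less_eq_dividend of_nat_le_iff of_nat_mult)
        then have "(real (n div p) * real p) * (a p / real p) \<le> real n * (a p / real p)"
          using nonneg by (intro mult_right_mono) auto
        then show ?thesis using p by simp
      qed
      also have "a (n mod p) \<le> (\<Sum>r<p. a r)"
        using p nonneg by (intro member_le_sum) auto
      finally show ?thesis by (simp add: M_def)
    qed
    obtain N :: nat where N: "2 * M / e < real N" "N \<ge> 1"
      using reals_Archimedean2[of "max 1 (2 * M / e)"] by (auto simp: Suc_le_eq)
    show "\<exists>no. \<forall>n\<ge>no. norm (a n / real n - ?A) < e"
    proof (intro exI allI impI)
      fix n assume n: "n \<ge> N"
      have n1: "n \<ge> 1" using n N by simp
      have "2 * M / e < real n" using n N(1) by linarith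
      then have "M < real n * (e / 2)" using e by (simp add: divide_less_eq mult_ac)
      moreover have "real n * (a p / real p) \<le> real n * (?A + e / 2)"
        by (intro mult_left_mono) (use p in auto)
      ultimately have "a n < real n * (?A + e)" using upper[of n] by (simp add: ring_distribs)
      then have "a n / real n < ?A + e" using n1 by (simp add: divide_less_eq mult_ac)
      then show "norm (a n / real n - ?A) < e" using low[OF n1] by simp
    qed
  qed
qed

section \<open>Two-sided series and comparison of continuous logarithms\<close>

lemma summable_on_intI:
  fixes f :: "int \<Rightarrow> real"
  assumes "(\<lambda>n::nat. f (int n)) summable_on UNIV" "(\<lambda>n::nat. f (- int n)) summable_on UNIV"
  shows "f summable_on UNIV"
proof -
  have "f summable_on range int" "f summable_on range (\<lambda>n. - int n)"
    using assms by (auto simp: summable_on_reindex inj_on_def o_def)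
  then have "f summable_on (range int \<union> range (\<lambda>n. - int n))" by (rule summable_on_union)
  moreover have "range int \<union> range (\<lambda>n. - int n) = UNIV"
  proof -
    have "k \<in> range int \<union> range (\<lambda>n. - int n)" for k
      by (cases k rule: int_cases2) auto
    then show ?thesis by blast
  qed
  ultimately show ?thesis by simp
qed

lemma summable_on_exp_abs_int:
  assumes "s > (0::real)"
  shows "(\<lambda>k::int. exp (- s * \<bar>of_int k\<bar>)) summable_on UNIV"
proof (rule summable_on_intI)
  have "summable (\<lambda>n. exp (- s) ^ n)" using assms by (intro summable_geometric) auto
  then have "(\<lambda>n. exp (- s) ^ n) summable_on UNIV"
    by (intro summable_nonneg_imp_summable_on) auto
  then show "(\<lambda>n. exp (- s * \<bar>real_of_int (int n)\<bar>)) summable_on UNIV"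
    "(\<lambda>n. exp (- s * \<bar>real_of_int (- int n)\<bar>)) summable_on UNIV"
    by (simp_all add: exp_of_nat_mult[symmetric] mult_ac)
qed

text \<open>The possible values are integer multiples of 2 pi i, at mutual distance at least 2 pi,
  so a continuous function on a connected set cannot move between them. Differences of continuous
  logarithms of one function fall under this.\<close>

lemma exp_eq_1_imp_constant:
  fixes f :: "'a::topological_space \<Rightarrow> complex"
  assumes S: "connected S" and f: "continuous_on S f" and one: "\<And>x. x \<in> S \<Longrightarrow> exp (f x) = 1"
  obtains c where "\<And>x. x \<in> S \<Longrightarrow> f x = c"
proof -
  have "f constant_on S"
  proof (rule continuous_discrete_range_constant[OF S f])
    fix x assume x: "x \<in> S"
    show "\<exists>e>0. \<forall>y. y \<in> S \<and> f y \<noteq> f x \<longrightarrow> e \<le> norm (f y - f x)"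
    proof (intro exI[of _ "2 * pi"] conjI allI impI)
      fix y assume y: "y \<in> S \<and> f y \<noteq> f x"
      obtain m n :: int where m: "f x = of_int (2 * m) * pi * \<i>" and n: "f y = of_int (2 * n) * pi * \<i>"
        using one[OF x] one y exp_eq_1[of "f x"] exp_eq_1[of "f y"]
        by (metis complex_eq add_0 mult.commute of_real_0 of_real_mult of_real_of_int_eq)
      have mn: "n \<noteq> m" using m n y by auto
      have "f y - f x = of_real (2 * pi * of_int (n - m)) * \<i>" by (simp add: m n algebra_simps)
      then have "norm (f y - f x) = 2 * pi * \<bar>of_int (n - m)\<bar>"
        by (simp only: norm_mult norm_of_real abs_mult) simp
      moreover have "1 \<le> \<bar>real_of_int (n - m)\<bar>" using mn by linarith
      ultimately show "2 * pi \<le> norm (f y - f x)"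
        using mult_left_mono[of 1 "\<bar>real_of_int (n - m)\<bar>" "2 * pi"] by simp
    qed simp
  qed
  then show ?thesis using that by (auto simp: constant_on_def)
qed

context beurling
begin

section \<open>The exponential growth rate of a weight\<close>

lemma A_exp_limit:
  shows "(\<lambda>k::nat. ln (\<nu> (int k)) / real k) \<longlonglongrightarrow> A_exp \<nu>"
    and "1 \<le> n \<Longrightarrow> A_exp \<nu> \<le> ln (\<nu> (int n)) / real n"
proof -
  have pos: "0 < \<nu> k" for k using weight_ge_1[of k] by linarith
  have *: "ln (\<nu> (int (m + n))) \<le> ln (\<nu> (int m)) + ln (\<nu> (int n))" for m n
    using weight_submult[of "int m" "int n"] pos
    by (subst ln_mult_pos[symmetric]) (auto intro!: ln_mono)
  have nn: "0 \<le> ln (\<nu> (int n))" for n using weight_ge_1 by simp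
  note F = fekete[of "\<lambda>n. ln (\<nu> (int n))", OF * nn]
  have A: "A_exp \<nu> = (INF n\<in>{1..}. ln (\<nu> (int n)) / real n)"
    unfolding A_exp_def by (rule limI[OF F(1)])
  show "(\<lambda>k::nat. ln (\<nu> (int k)) / real k) \<longlonglongrightarrow> A_exp \<nu>" "1 \<le> n \<Longrightarrow> A_exp \<nu> \<le> ln (\<nu> (int n)) / real n"
    using F A by auto
qed

lemma A_exp_nonneg: "0 \<le> A_exp \<nu>"
  by (rule LIMSEQ_le_const[OF A_exp_limit(1)]) (use weight_ge_1 in auto)

lemma weight_abs: "\<nu> (int (nat \<bar>k\<bar>)) = \<nu> k"
  using weight_sym[of k] by (cases "k \<ge> 0") auto

text \<open>Because the growth rate is an infimum and not only a limit, this holds for every k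
  without a constant. Hence the Fourier series is dominated by the weighted norm on the closed
  annulus, boundary included.\<close>

lemma exp_A_exp_le_weight: "exp (A_exp \<nu> * \<bar>of_int k\<bar>) \<le> \<nu> k"
proof (cases "k = 0")
  case False
  have pos: "0 < \<nu> k" using weight_ge_1[of k] by linarith
  have "A_exp \<nu> \<le> ln (\<nu> k) / \<bar>of_int k\<bar>"
    using A_exp_limit(2)[of "nat \<bar>k\<bar>"] False by (simp add: weight_abs[simplified])
  then have "A_exp \<nu> * \<bar>of_int k\<bar> \<le> ln (\<nu> k)" using False by (simp add: le_divide_eq)
  then show ?thesis using pos by (metis exp_le_cancel_iff exp_ln)
qed (use weight_ge_1 in auto)

lemma norm_powi_le_weight:
  assumes "z \<in> annulus_R \<nu>"
  shows "norm (z powi k) \<le> \<nu> k"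
proof -
  have z0: "norm z > 0" using assms exp_gt_zero[of "- A_exp \<nu>"] by (auto simp: annulus_R_def simp del: exp_gt_zero)
  define x where "x = ln (norm z)"
  have z: "norm z = exp x" using z0 by (simp add: x_def)
  have x: "\<bar>x\<bar> \<le> A_exp \<nu>" using assms by (auto simp: annulus_R_def z)
  have "norm (z powi k) = exp (of_int k * x)" by (simp add: norm_power_int z exp_power_int)
  also have "of_int k * x \<le> A_exp \<nu> * \<bar>of_int k\<bar>"
    using mult_right_mono[OF x, of "\<bar>of_int k\<bar>"] abs_mult[of "of_int k" x] by (simp add: mult_ac)
  then have "exp (of_int k * x) \<le> exp (A_exp \<nu> * \<bar>of_int k\<bar>)" by simp
  finally show ?thesis using exp_A_exp_le_weight[of k] by linarith
qed

text \<open>An intermediate rate r between \<open>A_exp \<nu>\<close> and s eventually dominates the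
  weight, the constant \<open>C\<close> pays for the finitely many small indices, and the gap s - r
  leaves a geometric series.\<close>

lemma summable_on_weight_exp:
  assumes "s > A_exp \<nu>"
  shows "(\<lambda>k. \<nu> k * exp (- s * \<bar>of_int k\<bar>)) summable_on UNIV"
proof -
  define r where "r = (A_exp \<nu> + s) / 2"
  have r: "A_exp \<nu> < r" "r < s" using assms by (auto simp: r_def)
  have pos: "0 < \<nu> k" for k using weight_ge_1[of k] by linarith
  have "eventually (\<lambda>n::nat. ln (\<nu> (int n)) / real n < r) sequentially"
    using order_tendstoD(2)[OF A_exp_limit(1) r(1)] .
  then obtain N0 where N0: "\<And>n. n \<ge> N0 \<Longrightarrow> ln (\<nu> (int n)) / real n < r"
    by (auto simp: eventually_sequentially)
  define N where "N = max 1 N0"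
  define C where "C = (\<Sum>n<N. \<nu> (int n)) + 1"
  have C: "C \<ge> 1" using weight_nonneg by (auto simp: C_def intro!: sum_nonneg)
  have r0: "r \<ge> 0" using r A_exp_nonneg by linarith
  have le: "\<nu> k \<le> C * exp (r * \<bar>of_int k\<bar>)" for k
  proof (cases "nat \<bar>k\<bar> < N")
    case True
    have "\<nu> (int (nat \<bar>k\<bar>)) \<le> (\<Sum>n<N. \<nu> (int n))"
      using True weight_nonneg by (intro member_le_sum[of _ _ "\<lambda>n. \<nu> (int n)"]) auto
    then have "\<nu> k \<le> C" using weight_abs[of k] by (simp add: C_def)
    also have "C * 1 \<le> C * exp (r * \<bar>of_int k\<bar>)" using C r0 by (intro mult_left_mono) auto
    finally show ?thesis by simp
  next
    case False
    then have k: "nat \<bar>k\<bar> \<ge> N0" "k \<noteq> 0" by (auto simp: N_def)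
    then have "ln (\<nu> k) / \<bar>of_int k\<bar> < r" using N0[OF k(1)] weight_abs[of k] by simp
    then have "ln (\<nu> k) < r * \<bar>of_int k\<bar>" using k by (simp add: divide_less_eq)
    then have "\<nu> k \<le> exp (r * \<bar>of_int k\<bar>)" using pos by (metis exp_less_cancel_iff exp_ln less_imp_le)
    also have "1 * exp (r * \<bar>of_int k\<bar>) \<le> C * exp (r * \<bar>of_int k\<bar>)" using C by (intro mult_right_mono) auto
    finally show ?thesis by simp
  qed
  have "(\<lambda>k::int. C * exp (- (s - r) * \<bar>of_int k\<bar>)) summable_on UNIV"
    using r by (intro summable_on_cmult_right summable_on_exp_abs_int) auto
  then show ?thesis
  proof (rule summable_on_comparison_test)
    fix k
    have "\<nu> k * exp (- s * \<bar>of_int k\<bar>) \<le> C * exp (r * \<bar>of_int k\<bar>) * exp (- s * \<bar>of_int k\<bar>)"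
      by (intro mult_right_mono le) auto
    also have "\<dots> = C * exp (- (s - r) * \<bar>of_int k\<bar>)"
      by (simp add: mult.assoc mult_exp_exp algebra_simps)
    finally show "\<nu> k * exp (- s * \<bar>of_int k\<bar>) \<le> C * exp (- (s - r) * \<bar>of_int k\<bar>)" .
  qed (simp add: weight_nonneg)
qed

text \<open>The norm bound is linear in the supremum \<open>B\<close>, with a constant depending
  only on s and the weight. This uniformity lets it be applied to all powers of one function at
  once.\<close>

lemma strip_has_fourier:
  assumes hol: "F holomorphic_on {\<zeta>. \<bar>Im \<zeta>\<bar> < t}" and s: "A_exp \<nu> < s" "s < t"
    and per: "\<And>\<zeta>. \<bar>Im \<zeta>\<bar> < t \<Longrightarrow> F (\<zeta> + 2 * pi) = F \<zeta>"
    and bd: "\<And>\<zeta>. \<bar>Re \<zeta>\<bar> \<le> pi \<Longrightarrow> \<bar>Im \<zeta>\<bar> \<le> s \<Longrightarrow> norm (F \<zeta>) \<le> B"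
    and f: "continuous_on (sphere 0 1) f" and fF: "\<And>\<theta>. f (cis \<theta>) = F (of_real \<theta>)"
  shows "has_fourier \<nu> f (fourier_coeff f)"
    and "wnorm \<nu> (fourier_coeff f) \<le> B * (\<Sum>\<^sub>\<infinity>k. \<nu> k * exp (- s * \<bar>of_int k\<bar>))"
proof -
  have s0: "0 \<le> s" using s A_exp_nonneg by linarith
  have le: "\<nu> k * norm (fourier_coeff f k) \<le> B * (\<nu> k * exp (- s * \<bar>of_int k\<bar>))" for k
    using mult_left_mono[OF strip_fourier_decay[OF hol s0 s(2) per bd f fF] weight_nonneg, of k k]
    by (simp add: mult_ac)
  have sum: "(\<lambda>k. B * (\<nu> k * exp (- s * \<bar>of_int k\<bar>))) summable_on UNIV"
    by (intro summable_on_cmult_right summable_on_weight_exp s)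
  have fs: "(\<lambda>k. \<nu> k * norm (fourier_coeff f k)) summable_on UNIV"
    by (rule summable_on_comparison_test[OF sum le]) (simp add: weight_nonneg)
  then show "has_fourier \<nu> f (fourier_coeff f)" by (rule has_fourier_of_coeffs[OF f])
  show "wnorm \<nu> (fourier_coeff f) \<le> B * (\<Sum>\<^sub>\<infinity>k. \<nu> k * exp (- s * \<bar>of_int k\<bar>))"
    unfolding wnorm_def infsum_cmult_right'[symmetric]
    by (rule infsum_mono[OF fs sum le])
qed

end

section \<open>The Wiener--Levy theorem for the logarithm\<close>

context beurling
begin

text \<open>The hypothesis bounds each power of \<open>x\<close> separately. A bound wnorm < 1 on
  \<open>x\<close> itself would be too much to ask: in the application the powers decay
  geometrically only up to a possibly large constant.\<close>

lemma has_fourier_ln_1_plus: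
  assumes x: "\<And>z. norm z = 1 \<Longrightarrow> norm (x z) < 1"
    and f: "\<And>n. has_fourier \<nu> (\<lambda>z. x z ^ Suc n) (a n)" and le: "\<And>n. wnorm \<nu> (a n) \<le> B n" and B: "summable B"
  obtains b where "has_fourier \<nu> (\<lambda>z. Ln (1 + x z)) b"
proof -
  let ?c = "\<lambda>n. (-1) ^ Suc (Suc n) / of_nat (Suc n) :: complex"
  have 1: "has_fourier \<nu> (\<lambda>z. ?c n * x z ^ Suc n) (\<lambda>k. ?c n * a n k)" for n
    by (rule has_fourier_cmult(1)[OF f])
  have 2: "wnorm \<nu> (\<lambda>k. ?c n * a n k) \<le> B n" for n
  proof -
    have "norm (?c n) \<le> 1" by (simp add: norm_divide norm_power del: of_nat_Suc power_Suc)
    then have "norm (?c n) * wnorm \<nu> (a n) \<le> 1 * wnorm \<nu> (a n)" using wnorm_nonneg by (rule mult_right_mono)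
    then show ?thesis using has_fourier_cmult(2)[OF f, of "?c n" n] le[of n] by simp
  qed
  have 3: "(\<lambda>n. ?c n * x z ^ Suc n) sums Ln (1 + x z)" if "norm z = 1" for z
    using Ln_series[OF x[OF that]] sums_Suc_iff[of "\<lambda>n. (-1) ^ Suc n / of_nat n * x z ^ n" "Ln (1 + x z)"]
    by simp
  show ?thesis by (rule that, rule has_fourier_series[OF 1 2 B 3])
qed

text \<open>Newman's device: after approximating \<open>W\<close> by a Laurent polynomial \<open>P\<close>, the powers of
  \<open>1/P\<close> are controlled by Cauchy estimates on a strip, so the Neumann-type series for
  \<open>log (1 + (W - P)/P)\<close> converges without any Gelfand theory.\<close>

theorem wiener_levy_log:
  assumes a: "(\<lambda>k. \<nu> k * norm (a k)) summable_on UNIV"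
    and W: "W = (\<lambda>z. \<Sum>\<^sub>\<infinity>k. a k * z powi k)"
    and nz: "\<And>z. z \<in> annulus_R \<nu> \<Longrightarrow> W z \<noteq> 0"
    and L: "continuous_on (sphere 0 1) L" "\<And>z. norm z = 1 \<Longrightarrow> exp (L z) = W z"
  obtains b where "has_fourier \<nu> L b"
proof -
  define A where "A = A_exp \<nu>"
  have A0: "A \<ge> 0" using A_exp_nonneg by (simp add: A_def)
  let ?R = "annulus_R \<nu>"
  have R0: "z \<noteq> 0" if "z \<in> ?R" for z using that by (auto simp: annulus_R_def)
  have circ: "z \<in> ?R" if "norm z = 1" for z using that A0 by (auto simp: annulus_R_def A_def)
  have term_le: "norm (a k * z powi k) \<le> \<nu> k * norm (a k)" if "z \<in> ?R" for z k
    using mult_right_mono[OF norm_powi_le_weight[OF that], of "norm (a k)" k] by (simp add: norm_mult mult.commute)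
  have contW: "continuous_on ?R W"
    unfolding W
  proof (rule continuous_on_infsum[OF _ _ a])
    show "continuous_on ?R (\<lambda>z. a k * z powi k)" for k using R0 by (intro continuous_intros) auto
  qed (rule term_le)
  have Weq: "?R = cball 0 (exp A) - ball 0 (exp (- A))" by (auto simp: annulus_R_def A_def)
  have compR: "compact ?R" unfolding Weq by (intro compact_diff) auto
  have "\<exists>z\<in>?R. \<forall>y\<in>?R. norm (W z) \<le> norm (W y)"
    using circ[of 1] by (intro continuous_attains_inf compR continuous_intros contW) auto
  then obtain z0 where z0: "z0 \<in> ?R" "\<And>y. y \<in> ?R \<Longrightarrow> norm (W z0) \<le> norm (W y)" by blast
  define m where "m = norm (W z0)"
  have m: "m > 0" "\<And>y. y \<in> ?R \<Longrightarrow> m \<le> norm (W y)" using nz z0 by (auto simp: m_def)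

  \<comment> \<open>With remainder at most m / 4 the Laurent polynomial has modulus at least 3 m / 4
    on the annulus, hence still more than m / 2 on a slightly wider one. The ratio (m / 4) (2 / m) =
    1 / 2 then drives the logarithmic series.\<close>
  obtain F where F: "finite F" "dist (\<Sum>k\<in>F. \<nu> k * norm (a k)) (\<Sum>\<^sub>\<infinity>k. \<nu> k * norm (a k)) \<le> m / 4"
    using infsum_finite_approximation[OF a, of "m / 4"] m by auto
  define a' where "a' = (\<lambda>k. if k \<in> F then 0 else a k)"
  define P where "P = (\<lambda>z. \<Sum>k\<in>F. a k * z powi k)"
  have aF: "((\<lambda>k. if k \<in> F then \<nu> k * norm (a k) else 0) has_sum (\<Sum>k\<in>F. \<nu> k * norm (a k))) UNIV"
    by (rule has_sum_finite_neutralI[OF F(1)]) auto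
  have a'sum: "((\<lambda>k. \<nu> k * norm (a' k)) has_sum ((\<Sum>\<^sub>\<infinity>k. \<nu> k * norm (a k)) - (\<Sum>k\<in>F. \<nu> k * norm (a k)))) UNIV"
  proof -
    have "((\<lambda>k. \<nu> k * norm (a k) + - (if k \<in> F then \<nu> k * norm (a k) else 0)) has_sum
        ((\<Sum>\<^sub>\<infinity>k. \<nu> k * norm (a k)) + - (\<Sum>k\<in>F. \<nu> k * norm (a k)))) UNIV"
      by (intro has_sum_add has_sum_uminusI aF has_sum_infsum a)
    moreover have "\<nu> k * norm (a k) + - (if k \<in> F then \<nu> k * norm (a k) else 0) = \<nu> k * norm (a' k)" for k
      by (simp add: a'_def)
    ultimately show ?thesis by simp
  qed
  have a's: "(\<lambda>k. \<nu> k * norm (a' k)) summable_on UNIV" using a'sum has_sum_imp_summable by blast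
  have a'n: "wnorm \<nu> a' \<le> m / 4"
    unfolding wnorm_def infsumI[OF a'sum] using F(2) unfolding dist_real_def by linarith
  have WP: "((\<lambda>k. a' k * z powi k) has_sum W z - P z) UNIV" if z: "z \<in> ?R" for z
  proof -
    have "(\<lambda>k. norm (a k * z powi k)) summable_on UNIV"
      by (rule summable_on_comparison_test[OF a term_le[OF z]]) auto
    then have "((\<lambda>k. a k * z powi k) has_sum W z) UNIV"
      unfolding W by (rule has_sum_infsum[OF abs_summable_summable])
    moreover have "((\<lambda>k. if k \<in> F then a k * z powi k else 0) has_sum P z) UNIV"
      unfolding P_def by (rule has_sum_finite_neutralI[OF F(1)]) auto
    ultimately have "((\<lambda>k. a k * z powi k + - (if k \<in> F then a k * z powi k else 0)) has_sum W z + - P z) UNIV"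
      by (intro has_sum_add has_sum_uminusI)
    moreover have "a k * z powi k + - (if k \<in> F then a k * z powi k else 0) = a' k * z powi k" for k
      by (simp add: a'_def)
    ultimately show ?thesis by simp
  qed
  have fWP: "has_fourier \<nu> (\<lambda>z. W z - P z) a'"
    unfolding has_fourier_def using a's WP circ by auto
  have WP_le: "norm (W z - P z) \<le> m / 4" if z: "z \<in> ?R" for z
  proof -
    have "norm (W z - P z) \<le> wnorm \<nu> a'"
    proof (rule norm_infsum_le[OF WP[OF z]])
      show "((\<lambda>k. \<nu> k * norm (a' k)) has_sum wnorm \<nu> a') UNIV"
        unfolding wnorm_def by (rule has_sum_infsum[OF a's])
      show "norm (a' k * z powi k) \<le> \<nu> k * norm (a' k)" for k
        using term_le[OF z, of k] by (simp add: a'_def)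
    qed
    then show ?thesis using a'n by linarith
  qed
  have P_ge: "norm (P z) \<ge> 3 * m / 4" if z: "z \<in> ?R" for z
    using WP_le[OF z] m(2)[OF z] norm_triangle_ineq2[of "W z" "W z - P z"] by simp

  \<comment> \<open>The exponential substitution unrolls the annulus to the strip |Im \<zeta>| \<le>
    A.\<close>
  define Q where "Q = (\<lambda>\<zeta>. P (exp (\<i> * \<zeta>)))"
  have holQ: "Q holomorphic_on S" for S
    unfolding Q_def P_def by (intro holomorphic_intros) auto
  have perQ: "Q (\<zeta> + 2 * pi) = Q \<zeta>" for \<zeta> :: complex
  proof -
    have "exp (\<i> * (\<zeta> + 2 * pi)) = exp (\<i> * \<zeta>)"
      using exp_plus_2pin[of "\<i> * \<zeta>" 1] by (simp add: algebra_simps)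
    then show ?thesis by (simp add: Q_def)
  qed
  have "\<exists>\<delta>>0. \<forall>\<zeta>. \<bar>Im \<zeta>\<bar> < A + \<delta> \<longrightarrow> norm (Q \<zeta>) > m / 2"
  proof -
    let ?K = "cbox (Complex (-pi) (-A)) (Complex pi A)"
    have op: "open {\<zeta>. norm (Q \<zeta>) > m / 2}"
      by (intro open_Collect_less continuous_intros holomorphic_on_imp_continuous_on holQ)
    have sub: "?K \<subseteq> {\<zeta>. norm (Q \<zeta>) > m / 2}"
    proof
      fix \<zeta> assume "\<zeta> \<in> ?K"
      then have "\<bar>Im \<zeta>\<bar> \<le> A" by (auto simp: in_cbox_complex_iff)
      then have "exp (\<i> * \<zeta>) \<in> ?R" by (auto simp: annulus_R_def A_def[symmetric])
      from P_ge[OF this] show "\<zeta> \<in> {\<zeta>. norm (Q \<zeta>) > m / 2}" using m by (simp add: Q_def)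
    qed
    obtain \<delta> where d: "\<delta> > 0" "(\<Union>\<zeta>\<in>?K. ball \<zeta> \<delta>) \<subseteq> {\<zeta>. norm (Q \<zeta>) > m / 2}"
      using compact_subset_open_imp_ball_epsilon_subset[OF compact_cbox op sub] by metis
    show ?thesis
    proof (intro exI[of _ \<delta>] conjI allI impI d)
      fix \<zeta> assume z: "\<bar>Im \<zeta>\<bar> < A + \<delta>"
      \<comment> \<open>Compactness gives a margin only near one period rectangle.
        \<open>\<xi>\<close> is \<zeta> moved into that period, and \<open>\<eta>\<close> is
        \<open>\<xi>\<close> with its height clamped to the closed strip, hence at distance less
        than \<delta>.\<close>
      define \<xi> where "\<xi> = Complex (Arg (cis (Re \<zeta>))) (Im \<zeta>)"
      define \<eta> where "\<eta> = Complex (Arg (cis (Re \<zeta>))) (max (-A) (min A (Im \<zeta>)))"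
      have "\<eta> \<in> ?K" using Arg_bounded[of "cis (Re \<zeta>)"] A0 by (auto simp: \<eta>_def in_cbox_complex_iff)
      moreover have "\<xi> \<in> ball \<eta> \<delta>"
        using z d(1) by (auto simp: \<xi>_def \<eta>_def dist_norm cmod_def max_def min_def)
      ultimately have "norm (Q \<xi>) > m / 2" using d(2) by blast
      moreover have "exp (\<i> * \<xi>) = exp (\<i> * \<zeta>)"
        using rcis_cmod_Arg[of "cis (Re \<zeta>)"] by (simp add: exp_eq_polar \<xi>_def rcis_def)
      ultimately show "norm (Q \<zeta>) > m / 2" by (simp add: Q_def)
    qed
  qed
  then obtain \<delta> where d: "\<delta> > 0" "\<And>\<zeta>. \<bar>Im \<zeta>\<bar> < A + \<delta> \<Longrightarrow> norm (Q \<zeta>) > m / 2" by blast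
  define t where "t = A + \<delta>"
  define s where "s = A + \<delta> / 2"
  have st: "A_exp \<nu> < s" "s < t" using d by (auto simp: s_def t_def A_def)
  have Qt: "norm (Q \<zeta>) > m / 2" "Q \<zeta> \<noteq> 0" if "\<bar>Im \<zeta>\<bar> < t" for \<zeta>
    using d(2)[of \<zeta>] m that by (auto simp: t_def)
  have contP: "continuous_on (sphere 0 1) P"
    unfolding P_def by (intro continuous_intros) auto
  have P0: "P z \<noteq> 0" if "norm z = 1" for z
    using P_ge[OF circ[OF that]] m by auto
  have PQ: "P (cis \<theta>) = Q (of_real \<theta>)" for \<theta> by (simp add: Q_def cis_conv_exp)
  define C where "C = (\<Sum>\<^sub>\<infinity>k. \<nu> k * exp (- s * \<bar>of_int k\<bar>))"
  have inv: "has_fourier \<nu> (\<lambda>z. 1 / P z ^ n) (fourier_coeff (\<lambda>z. 1 / P z ^ n))"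
      "wnorm \<nu> (fourier_coeff (\<lambda>z. 1 / P z ^ n)) \<le> (2 / m) ^ n * C" for n
  proof -
    have 1: "(\<lambda>\<zeta>. 1 / Q \<zeta> ^ n) holomorphic_on {\<zeta>. \<bar>Im \<zeta>\<bar> < t}"
      using Qt(2) by (intro holomorphic_intros holQ) auto
    have 2: "norm (1 / Q \<zeta> ^ n) \<le> (2 / m) ^ n" if "\<bar>Im \<zeta>\<bar> \<le> s" for \<zeta>
    proof -
      have "(m / 2) ^ n \<le> norm (Q \<zeta>) ^ n"
        using Qt(1)[of \<zeta>] that st m by (intro power_mono) auto
      then have "1 / norm (Q \<zeta>) ^ n \<le> 1 / (m / 2) ^ n"
        using m Qt(2)[of \<zeta>] that st by (intro divide_left_mono) auto
      then show ?thesis by (simp add: norm_divide norm_power power_divide)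
    qed
    have 3: "continuous_on (sphere 0 1) (\<lambda>z. 1 / P z ^ n)" using P0 by (intro continuous_intros contP) auto
    show "has_fourier \<nu> (\<lambda>z. 1 / P z ^ n) (fourier_coeff (\<lambda>z. 1 / P z ^ n))"
      by (rule strip_has_fourier(1)[OF 1 st _ 2 3]) (simp_all add: perQ[simplified] PQ)
    show "wnorm \<nu> (fourier_coeff (\<lambda>z. 1 / P z ^ n)) \<le> (2 / m) ^ n * C"
      unfolding C_def by (rule strip_has_fourier(2)[OF 1 st _ 2 3]) (simp_all add: perQ[simplified] PQ)
  qed
  have C0: "C \<ge> 0" unfolding C_def by (intro infsum_nonneg) (simp add: weight_nonneg)

  define x where "x = (\<lambda>z. (W z - P z) / P z)"
  have x_le: "norm (x z) < 1" if "norm z = 1" for z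
  proof -
    have "norm (W z - P z) < norm (P z)"
      using WP_le[OF circ[OF that]] P_ge[OF circ[OF that]] m by linarith
    then show ?thesis using P0[OF that] by (simp add: x_def norm_divide divide_less_eq)
  qed
  \<comment> \<open>Numerator and denominator powers are estimated separately: the former by the
    norm of W - P, the latter by the supremum on the strip. The constant C thus enters once instead
    of once per power.\<close>
  let ?ax = "\<lambda>n. conv (conv_pow a' n) (fourier_coeff (\<lambda>z. 1 / P z ^ Suc n))"
  have fx: "has_fourier \<nu> (\<lambda>z. x z ^ Suc n) (?ax n)" for n
    using has_fourier_mult(1)[OF has_fourier_power(1)[OF fWP, of n] inv(1)[of "Suc n"]]
    by (simp add: x_def power_divide)
  have nx: "wnorm \<nu> (?ax n) \<le> C * (1 / 2) ^ Suc n" for n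
  proof -
    have "wnorm \<nu> (?ax n) \<le> wnorm \<nu> (conv_pow a' n) * wnorm \<nu> (fourier_coeff (\<lambda>z. 1 / P z ^ Suc n))"
      by (rule has_fourier_mult(2)[OF has_fourier_power(1)[OF fWP] inv(1)])
    also have "\<dots> \<le> (m / 4) ^ Suc n * ((2 / m) ^ Suc n * C)"
    proof (intro mult_mono inv(2) wnorm_nonneg)
      have "wnorm \<nu> (conv_pow a' n) \<le> wnorm \<nu> a' ^ Suc n" by (rule has_fourier_power(2)[OF fWP])
      also have "\<dots> \<le> (m / 4) ^ Suc n" by (intro power_mono a'n wnorm_nonneg)
      finally show "wnorm \<nu> (conv_pow a' n) \<le> (m / 4) ^ Suc n" .
    qed (use m in auto)
    also have "\<dots> = (m / 4 * (2 / m)) ^ Suc n * C" by (simp only: power_mult_distrib mult.assoc)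
    also have "m / 4 * (2 / m) = 1 / 2" using m by simp
    finally show ?thesis by (simp add: mult.commute)
  qed
  have "summable (\<lambda>n. C * (1 / 2) ^ Suc n)"
    by (intro summable_mult) (subst summable_Suc_iff, simp add: summable_geometric)
  then obtain b1 where b1: "has_fourier \<nu> (\<lambda>z. Ln (1 + x z)) b1"
    using has_fourier_ln_1_plus[OF x_le fx nx] by blast

  \<comment> \<open>What remains is a continuous logarithm of the Laurent polynomial alone, which
    continues holomorphically to the strip.\<close>
  define l where "l = (\<lambda>z. L z - Ln (1 + x z))"
  have cl: "continuous_on (sphere 0 1) l"
    unfolding l_def by (intro continuous_on_diff L has_fourier_continuous[OF has_fourier_unit[OF b1]])
  have expl: "exp (l z) = P z" if z: "norm z = 1" for z
  proof -
    have "1 + x z = W z / P z" using P0[OF z] by (simp add: x_def field_simps)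
    then show ?thesis using L(2)[OF z] P0[OF z] nz[OF circ[OF z]] by (simp add: l_def exp_diff)
  qed
  let ?T = "{\<zeta>. \<bar>Im \<zeta>\<bar> < t}"
  have Teq: "?T = {\<zeta>. Im \<zeta> < t} \<inter> {\<zeta>. Im \<zeta> > - t}" by auto
  have convT: "convex ?T" unfolding Teq by (intro convex_Int convex_halfspace_Im_lt convex_halfspace_Im_gt)
  obtain G where G: "G holomorphic_on ?T" "\<And>\<zeta>. \<zeta> \<in> ?T \<Longrightarrow> Q \<zeta> = exp (G \<zeta>)"
    using contractible_imp_holomorphic_log[OF holQ convex_imp_contractible[OF convT]] Qt(2) by auto
  have contG: "continuous_on ?T G" using G(1) by (rule holomorphic_on_imp_continuous_on)
  have t0: "t > 0" using A0 d by (simp add: t_def)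
  obtain c where c: "\<And>\<theta>. l (cis \<theta>) - G (of_real \<theta>) = c"
  proof (rule exp_eq_1_imp_constant[of "UNIV :: real set"])
    show "continuous_on UNIV (\<lambda>\<theta>. l (cis \<theta>) - G (of_real \<theta>))"
      by (intro continuous_on_diff continuous_on_circle_cis cl continuous_on_compose2[OF contG] continuous_intros)
         (use t0 in auto)
    show "exp (l (cis \<theta>) - G (of_real \<theta>)) = 1" for \<theta>
      using G(2)[of "of_real \<theta>"] expl[of "cis \<theta>"] PQ[of \<theta>] t0 by (simp add: exp_diff)
  qed auto
  obtain c' where c': "\<And>\<zeta>. \<zeta> \<in> ?T \<Longrightarrow> G (\<zeta> + 2 * pi) - G \<zeta> = c'"
  proof (rule exp_eq_1_imp_constant[OF convex_connected[OF convT]])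
    show "continuous_on ?T (\<lambda>\<zeta>. G (\<zeta> + 2 * pi) - G \<zeta>)"
      by (intro continuous_on_diff contG continuous_on_compose2[OF contG] continuous_intros) auto
    show "exp (G (\<zeta> + 2 * pi) - G \<zeta>) = 1" if "\<zeta> \<in> ?T" for \<zeta>
      using G(2)[of \<zeta>] G(2)[of "\<zeta> + 2 * pi"] perQ[of \<zeta>] that by (simp add: exp_diff)
  qed auto
  \<comment> \<open>On the real line \<open>G\<close> differs by a constant from l (cis \<theta>),
    which is 2 pi periodic. The existence of a single-valued logarithm on the circle thus rules out
    a nonzero increment over a period.\<close>
  have "c' = 0"
  proof -
    have "cis (2 * pi) = cis 0" by simp
    then have "G (of_real (2 * pi)) = G (of_real 0)"
      using c[of "2 * pi"] c[of 0] by (metis add_diff_cancel_left' diff_add_cancel)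
    then show ?thesis using c'[of 0] t0 by simp
  qed
  then have perG: "G (\<zeta> + 2 * pi) = G \<zeta>" if "\<bar>Im \<zeta>\<bar> < t" for \<zeta>
    using c'[of \<zeta>] that by simp
  have "compact ((\<lambda>\<zeta>. norm (G \<zeta> + c)) ` cbox (Complex (-pi) (-s)) (Complex pi s))"
    using st by (intro compact_continuous_image continuous_intros continuous_on_subset[OF contG] compact_cbox)
      (auto simp: in_cbox_complex_iff)
  then obtain B where B: "\<And>\<zeta>. \<zeta> \<in> cbox (Complex (-pi) (-s)) (Complex pi s) \<Longrightarrow> norm (G \<zeta> + c) \<le> B"
    unfolding compact_eq_bounded_closed bounded_iff by auto
  have "has_fourier \<nu> l (fourier_coeff l)"
  proof (rule strip_has_fourier(1)[of "\<lambda>\<zeta>. G \<zeta> + c" t s B])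
    show "(\<lambda>\<zeta>. G \<zeta> + c) holomorphic_on ?T" by (intro holomorphic_intros G)
    show "l (cis \<theta>) = G (of_real \<theta>) + c" for \<theta> using c[of \<theta>] by (simp add: algebra_simps)
    show "norm (G \<zeta> + c) \<le> B" if "\<bar>Re \<zeta>\<bar> \<le> pi" "\<bar>Im \<zeta>\<bar> \<le> s" for \<zeta>
      by (rule B) (use that in \<open>auto simp: in_cbox_complex_iff\<close>)
  qed (use st perG cl in auto)
  from has_fourier_add[OF this b1] show ?thesis by (intro that) (simp add: l_def)
qed

end

section \<open>Sums over three tails\<close>

lemma ennreal_suminf_swap:
  fixes f :: "nat \<Rightarrow> nat \<Rightarrow> ennreal"
  shows "(\<Sum>i. \<Sum>j. f i j) = (\<Sum>j. \<Sum>i. f i j)"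
  using nn_integral_suminf[of "\<lambda>j i. f i j" "count_space UNIV"]
  by (simp add: nn_integral_count_space_nat)

lemma ennreal_suminf_shift_le:
  fixes f :: "nat \<Rightarrow> ennreal"
  shows "(\<Sum>m. f (m + d)) \<le> (\<Sum>m. f m)"
proof (rule suminf_le_const)
  fix k
  have "(\<Sum>m<k. f (m + d)) = sum f {d..<k + d}"
    using sum.shift_bounds_nat_ivl[of f 0 d k] by (simp add: lessThan_atLeast0)
  also have "\<dots> \<le> sum f {..<k + d}" by (intro sum_mono2) auto
  also have "\<dots> \<le> (\<Sum>m. f m)" by (intro sum_le_suminf) auto
  finally show "(\<Sum>m<k. f (m + d)) \<le> (\<Sum>m. f m)" .
qed simp

lemma ennreal_suminf_mono:
  fixes f g :: "nat \<Rightarrow> ennreal"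
  assumes "\<And>n. f n \<le> g n"
  shows "suminf f \<le> suminf g"
  using assms by (intro suminf_le) auto

lemma ennreal_suminf_offset_mono:
  fixes f :: "nat \<Rightarrow> ennreal"
  assumes "N \<le> n"
  shows "(\<Sum>m. f (n + m)) \<le> (\<Sum>m. f (N + m))"
  using ennreal_suminf_shift_le[of "\<lambda>m. f (N + m)" "n - N"] assms
  by (simp add: add.commute add.left_commute)

lemma ennreal_le_2_of_contraction:
  fixes x :: ennreal
  assumes "x \<le> 1 + x / 2" "x < top"
  shows "x \<le> 2"
proof -
  obtain r where r: "x = ennreal r" "r \<ge> 0" using assms(2) by (cases x) auto
  have "x / 2 = ennreal (r / 2)" using r by (simp add: divide_ennreal[symmetric])
  then have "ennreal r \<le> ennreal (1 + r / 2)" using assms r by (subst ennreal_plus) auto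
  then have "r \<le> 2" using r by (subst (asm) ennreal_le_iff) auto
  then show ?thesis using r by (metis ennreal_leI ennreal_numeral)
qed

text \<open>Here \<open>H l\<close> and \<open>G l\<close> model |h_{-l}| and |g_l|, and
  \<open>u n\<close> the moduli of the solution \<open>U\<close> at degree n. In
  \<open>ennreal\<close> every interchange of sums is unconditional, so finiteness enters only
  through \<open>fin\<close> and in the final bound.\<close>

context
  fixes H G :: "nat \<Rightarrow> ennreal" and u :: "nat \<Rightarrow> nat \<Rightarrow> ennreal" and N :: nat
  assumes contraction: "(\<Sum>l. G (N + l)) * (\<Sum>l. H l) \<le> 1 / 2"
    and fin: "\<And>n. N \<le> n \<Longrightarrow> (\<Sum>j. u n j) < top"
    and rec: "\<And>n k. N \<le> n \<Longrightarrow> u n k \<le> (if k = 0 then 1 else 0) +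
        (\<Sum>m. G (k + n + Suc m) * (\<Sum>j. H (Suc m + n + j) * u n j))"
begin

text \<open>The supremum is taken over finitely many \<open>n\<close> only, so that its sum is finite a priori and can be
  absorbed by the contraction.\<close>

lemma uniform_majorant:
  obtains M :: "nat \<Rightarrow> ennreal" where "(\<Sum>j. M j) \<le> 2" "\<And>n j. n \<in> {N..N'} \<Longrightarrow> u n j \<le> M j"
proof -
  define M where "M = (\<lambda>j. SUP n\<in>{N..N'}. u n j)"
  have uM: "u n j \<le> M j" if "n \<in> {N..N'}" for n j
    unfolding M_def using that by (rule SUP_upper)
  have "M j \<le> (\<Sum>n=N..N'. u n j)" for j
    unfolding M_def by (intro SUP_least member_le_sum) auto
  then have "(\<Sum>j. M j) \<le> (\<Sum>j. \<Sum>n=N..N'. u n j)" by (rule ennreal_suminf_mono)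
  also have "\<dots> = (\<Sum>n=N..N'. \<Sum>j. u n j)" by (rule suminf_sum) auto
  also have "\<dots> < top" using fin by (subst ennreal_sum_less_top) auto
  finally have fM: "(\<Sum>j. M j) < top" .
  let ?c = "\<lambda>m. \<Sum>j. H (Suc m + N + j) * M j"
  have Mrec: "M k \<le> (if k = 0 then 1 else 0) + (\<Sum>m. G (k + N + Suc m) * ?c m)" for k
    unfolding M_def
  proof (rule SUP_least)
    fix n assume n: "n \<in> {N..N'}"
    have "(\<Sum>m. G (k + n + Suc m) * (\<Sum>j. H (Suc m + n + j) * u n j))
        \<le> (\<Sum>m. G (k + n + Suc m) * (\<Sum>j. H (Suc m + n + j) * M j))"
      by (intro ennreal_suminf_mono mult_left_mono uM n) auto
    \<comment> \<open>Both \<open>G\<close> and \<open>H\<close> see n and m only through their sum,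
      so replacing n by the smaller N merely adds terms.\<close>
    also have "\<dots> \<le> (\<Sum>m. G (k + N + Suc m) * ?c m)"
      using ennreal_suminf_offset_mono[of N n "\<lambda>l. G (k + Suc l) * (\<Sum>j. H (Suc l + j) * M j)"] n
      by (simp add: add_ac)
    finally show "u n k \<le> (if k = 0 then 1 else 0) +
        (\<Sum>m. G (k + N + Suc m) * (\<Sum>j. H (Suc m + N + j) * (SUP n\<in>{N..N'}. u n j)))"
      using rec[of n k] n unfolding M_def by (meson add_left_mono atLeastAtMost_iff order_trans)
  qed
  let ?h = "\<Sum>l. H l" and ?g = "\<Sum>l. G (N + l)"
  have "(\<Sum>j. M j) \<le> (\<Sum>k. (if k = 0 then 1 else 0) + (\<Sum>m. G (k + N + Suc m) * ?c m))"
    by (intro ennreal_suminf_mono Mrec)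
  also have "\<dots> = (\<Sum>k. if k = 0 then 1 else 0) + (\<Sum>k. \<Sum>m. G (k + N + Suc m) * ?c m)"
    by (intro suminf_add[symmetric]) auto
  also have "(\<Sum>k::nat. if k = 0 then 1 else 0) = (1::ennreal)"
    using suminf_finite[of "{0::nat}" "\<lambda>k. if k = 0 then 1 else 0 :: ennreal"] by simp
  also have "(\<Sum>k. \<Sum>m. G (k + N + Suc m) * ?c m) = (\<Sum>m. \<Sum>k. G (k + N + Suc m) * ?c m)"
    by (rule ennreal_suminf_swap)
  also have "\<dots> = (\<Sum>m. (\<Sum>k. G (k + N + Suc m)) * ?c m)"
    by simp
  also have "\<dots> \<le> (\<Sum>m. ?g * ?c m)"
  proof (rule ennreal_suminf_mono, rule mult_right_mono)
    fix m show "(\<Sum>k. G (k + N + Suc m)) \<le> ?g"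
      using ennreal_suminf_offset_mono[of N "N + Suc m" G] by (simp add: add_ac)
  qed auto
  also have "\<dots> = ?g * (\<Sum>m. ?c m)" by simp
  also have "(\<Sum>m. ?c m) = (\<Sum>j. \<Sum>m. H (Suc m + N + j) * M j)" by (rule ennreal_suminf_swap)
  also have "\<dots> = (\<Sum>j. (\<Sum>m. H (Suc m + N + j)) * M j)" by simp
  also have "?g * \<dots> \<le> ?g * (\<Sum>j. ?h * M j)"
  proof (rule mult_left_mono, rule ennreal_suminf_mono, rule mult_right_mono)
    fix j show "(\<Sum>m. H (Suc m + N + j)) \<le> ?h"
      using ennreal_suminf_shift_le[of H "Suc N + j"] by (simp add: add_ac)
  qed auto
  also have "\<dots> = (?g * ?h) * (\<Sum>j. M j)" by (simp add: mult.assoc)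
  also have "\<dots> \<le> (1 / 2) * (\<Sum>j. M j)" by (intro mult_right_mono contraction) auto
  also have "(1 / 2) * (\<Sum>j. M j) = (\<Sum>j. M j) / 2"
    by (subst mult.commute, subst ennreal_times_divide) simp
  finally have "(\<Sum>j. M j) \<le> 1 + (\<Sum>j. M j) / 2" by (simp add: add_left_mono)
  then have "(\<Sum>j. M j) \<le> 2" using fM by (rule ennreal_le_2_of_contraction)
  with uM that show ?thesis by blast
qed

text \<open>After each of the three factors has received one copy of the weight, the sum over n is
  spent on the inner \<open>H\<close> alone: \<open>c\<close>, summed over n, is bounded uniformly
  in m. In the other two factors n is dropped by enlarging the range of p = n + k, which gives
  \<open>d\<close>, and summing over m completes a product of full series.\<close>

lemma cubic_tail_sum:
  fixes \<nu> err :: "nat \<Rightarrow> ennreal"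
  assumes mono: "\<And>i j. i \<le> j \<Longrightarrow> \<nu> i \<le> \<nu> j"
    and err: "\<And>n. N \<le> n \<Longrightarrow> err n \<le>
        (\<Sum>k. H (n + k) * (\<Sum>m. G (k + n + Suc m) * (\<Sum>j. H (Suc m + n + j) * u n j)))"
  shows "(\<Sum>n. \<nu> (N + n) ^ 3 * err (N + n)) \<le> 2 * (\<Sum>l. \<nu> l * H l)\<^sup>2 * (\<Sum>l. \<nu> l * G l)"
proof (rule suminf_le_const)
  fix K
  let ?h = "\<Sum>l. \<nu> l * H l" and ?g = "\<Sum>l. \<nu> l * G l"
  let ?H = "\<lambda>l. \<nu> l * H l" and ?G = "\<lambda>l. \<nu> l * G l"
  \<comment> \<open>The majorant depends on the cutoff \<open>K\<close>, but its sum bound 2 does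
    not, so all partial sums obey the same estimate.\<close>
  obtain M where M: "(\<Sum>j. M j) \<le> 2" "\<And>n j. n \<in> {N..N + K} \<Longrightarrow> u n j \<le> M j"
    using uniform_majorant by blast
  define c where "c = (\<lambda>n m. \<Sum>j. ?H (Suc m + n + j) * M j)"
  define d where "d = (\<lambda>m. \<Sum>p. ?H p * ?G (p + Suc m))"
  have csum: "(\<Sum>n. c n m) \<le> ?h * 2" for m
  proof -
    have "(\<Sum>n. c n m) = (\<Sum>j. \<Sum>n. ?H (Suc m + n + j) * M j)" unfolding c_def by (rule ennreal_suminf_swap)
    also have "\<dots> = (\<Sum>j. (\<Sum>n. ?H (Suc m + n + j)) * M j)" by simp
    also have "\<dots> \<le> (\<Sum>j. ?h * M j)"
    proof (rule ennreal_suminf_mono, rule mult_right_mono)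
      fix j show "(\<Sum>n. ?H (Suc m + n + j)) \<le> ?h"
        using ennreal_suminf_shift_le[of ?H "Suc m + j"] by (simp add: add_ac)
    qed auto
    also have "\<dots> = ?h * (\<Sum>j. M j)" by simp
    finally show ?thesis using mult_left_mono[OF M(1), of ?h] by (meson order_trans zero_le)
  qed
  have dsum: "(\<Sum>m. d m) \<le> ?h * ?g"
  proof -
    have "(\<Sum>m. d m) = (\<Sum>p. \<Sum>m. ?H p * ?G (p + Suc m))" unfolding d_def by (rule ennreal_suminf_swap)
    also have "\<dots> = (\<Sum>p. ?H p * (\<Sum>m. ?G (p + Suc m)))" by simp
    also have "\<dots> \<le> (\<Sum>p. ?H p * ?g)"
    proof (rule ennreal_suminf_mono, rule mult_left_mono)
      fix p show "(\<Sum>m. ?G (p + Suc m)) \<le> ?g"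
        using ennreal_suminf_shift_le[of ?G "Suc p"] by (simp add: add_ac)
    qed auto
    also have "\<dots> = ?h * ?g" by simp
    finally show ?thesis .
  qed
  have one: "\<nu> n ^ 3 * err n \<le> (\<Sum>m. c n m * d m)" if n: "n \<in> {N..N + K}" for n
  proof -
    have "\<nu> n ^ 3 * err n \<le> \<nu> n ^ 3 *
        (\<Sum>k. H (n + k) * (\<Sum>m. G (k + n + Suc m) * (\<Sum>j. H (Suc m + n + j) * u n j)))"
      using err n by (intro mult_left_mono) auto
    also have "\<dots> = (\<Sum>k. (\<nu> n * H (n + k)) * (\<Sum>m. (\<nu> n * G (k + n + Suc m)) * (\<Sum>j. (\<nu> n * H (Suc m + n + j)) * u n j)))"
      by (simp add: power3_eq_cube mult_ac flip: ennreal_suminf_cmult)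
    also have "\<dots> \<le> (\<Sum>k. ?H (n + k) * (\<Sum>m. ?G (k + n + Suc m) * c n m))"
      unfolding c_def by (intro ennreal_suminf_mono mult_mono M(2)[OF n] mono order_refl) auto
    also have "\<dots> = (\<Sum>k. \<Sum>m. ?H (n + k) * (?G (k + n + Suc m) * c n m))" by simp
    also have "\<dots> = (\<Sum>m. \<Sum>k. ?H (n + k) * (?G (k + n + Suc m) * c n m))" by (rule ennreal_suminf_swap)
    also have "\<dots> = (\<Sum>m. \<Sum>k. c n m * (?H (k + n) * ?G (k + n + Suc m)))" by (simp add: mult_ac add_ac)
    also have "\<dots> = (\<Sum>m. c n m * (\<Sum>k. ?H (k + n) * ?G (k + n + Suc m)))" by simp
    also have "\<dots> \<le> (\<Sum>m. c n m * d m)"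
      unfolding d_def
    proof (rule ennreal_suminf_mono, rule mult_left_mono)
      fix m show "(\<Sum>k. ?H (k + n) * ?G (k + n + Suc m)) \<le> (\<Sum>p. ?H p * ?G (p + Suc m))"
        by (rule ennreal_suminf_shift_le[of "\<lambda>p. ?H p * ?G (p + Suc m)"])
    qed auto
    finally show ?thesis .
  qed
  have "(\<Sum>n<K. \<nu> (N + n) ^ 3 * err (N + n)) \<le> (\<Sum>n<K. \<Sum>m. c (N + n) m * d m)"
    by (intro sum_mono one) auto
  also have "\<dots> \<le> (\<Sum>n. \<Sum>m. c (N + n) m * d m)" by (intro sum_le_suminf) auto
  also have "\<dots> \<le> (\<Sum>n. \<Sum>m. c n m * d m)"
    using ennreal_suminf_shift_le[of "\<lambda>n. \<Sum>m. c n m * d m" N] by (simp add: add.commute)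
  also have "\<dots> = (\<Sum>m. \<Sum>n. c n m * d m)" by (rule ennreal_suminf_swap)
  also have "\<dots> = (\<Sum>m. (\<Sum>n. c n m) * d m)" by simp
  also have "\<dots> \<le> (\<Sum>m. (?h * 2) * d m)" by (rule ennreal_suminf_mono, rule mult_right_mono, rule csum) auto
  also have "\<dots> = (?h * 2) * (\<Sum>m. d m)" by simp
  also have "\<dots> \<le> (?h * 2) * (?h * ?g)" by (intro mult_left_mono dsum) auto
  finally show "(\<Sum>n<K. \<nu> (N + n) ^ 3 * err (N + n)) \<le> 2 * ?h\<^sup>2 * ?g"
    by (simp add: power2_eq_square mult_ac)
qed simp

end

section \<open>Hankel equations for orthogonal polynomials\<close>

lemma conv_eq_0: "(\<And>j. a j = 0 \<or> b (k - j) = 0) \<Longrightarrow> conv a b k = 0"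
proof -
  assume "\<And>j. a j = 0 \<or> b (k - j) = 0"
  then have "a j * b (k - j) = 0" for j by simp
  then show ?thesis by (simp only: conv_def infsum_0_simp)
qed

lemma conv_single: "(\<And>j. j \<noteq> i \<Longrightarrow> a j = 0 \<or> b (k - j) = 0) \<Longrightarrow> conv a b k = a i * b (k - i)"
  unfolding conv_def by (rule infsumI, rule has_sum_finite_neutralI[of "{i}"]) auto

lemma has_sum_int_nonneg:
  fixes f :: "int \<Rightarrow> 'a::{comm_monoid_add,topological_space}"
  assumes "(f has_sum s) UNIV" "\<And>k. k < 0 \<Longrightarrow> f k = 0"
  shows "((\<lambda>n::nat. f (int n)) has_sum s) UNIV"
proof -
  have "(f has_sum s) (range int)"
    by (rule has_sum_cong_neutral[THEN iffD1, OF _ _ _ assms(1)])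
       (use assms(2) in \<open>auto simp: image_iff zero_le_imp_eq_int not_less\<close>, metis nonneg_int_cases not_le)
  then show ?thesis by (simp add: has_sum_reindex o_def)
qed

lemma has_sum_int_neg:
  fixes f :: "int \<Rightarrow> 'a::{comm_monoid_add,topological_space}"
  assumes "(f has_sum s) UNIV" "\<And>k. k \<ge> 0 \<Longrightarrow> f k = 0"
  shows "((\<lambda>n::nat. f (- int (Suc n))) has_sum s) UNIV"
proof -
  have "k \<ge> 0" if "k \<notin> range (\<lambda>n. - int (Suc n))" for k
  proof (rule ccontr)
    assume "\<not> k \<ge> 0"
    then have "k = - int (Suc (nat (- k - 1)))" by simp
    with that show False by blast
  qed
  then have "(f has_sum s) (range (\<lambda>n. - int (Suc n)))"
    by (intro has_sum_cong_neutral[THEN iffD1, OF _ _ _ assms(1)]) (use assms(2) in auto)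
  then show ?thesis by (simp add: has_sum_reindex o_def inj_on_def)
qed

lemma ennreal_norm_has_sum_le:
  fixes f :: "nat \<Rightarrow> complex"
  assumes "(f has_sum s) UNIV"
  shows "ennreal (norm s) \<le> (\<Sum>n. ennreal (norm (f n)))"
proof (rule LIMSEQ_le_const2)
  have "(\<lambda>n. norm (\<Sum>i<n. f i)) \<longlonglongrightarrow> norm s"
    using has_sum_imp_sums[OF assms] by (intro tendsto_norm) (simp add: sums_def)
  then show "(\<lambda>n. ennreal (norm (\<Sum>i<n. f i))) \<longlonglongrightarrow> ennreal (norm s)" by (rule tendsto_ennrealI)
  have "ennreal (norm (\<Sum>i<n. f i)) \<le> (\<Sum>n. ennreal (norm (f n)))" for n
  proof -
    have "ennreal (norm (\<Sum>i<n. f i)) \<le> ennreal (\<Sum>i<n. norm (f i))" by (intro ennreal_leI norm_sum)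
    also have "\<dots> = (\<Sum>i<n. ennreal (norm (f i)))" by (rule sum_ennreal[symmetric]) simp
    also have "\<dots> \<le> (\<Sum>n. ennreal (norm (f n)))" by (intro sum_le_suminf) auto
    finally show ?thesis .
  qed
  then show "\<exists>N. \<forall>n\<ge>N. ennreal (norm (\<Sum>i<n. f i)) \<le> (\<Sum>n. ennreal (norm (f n)))" by blast
qed

text \<open>A Wiener-Hopf factorization: \<open>Ei\<close> and its inverse have nonnegative
  spectrum, \<open>Ee\<close> and its inverse nonpositive spectrum; primes mark coefficients of
  reciprocals. The normalization makes the Hankel equations start exactly from the unit sequence and
  yield \<phi> 0 without a factor.\<close>

locale wiener_hopf =
  fixes Ei Ee :: "complex \<Rightarrow> complex" and ei ei' ee ee' :: "int \<Rightarrow> complex"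
  assumes Ei: "has_fourier (\<lambda>_. 1) Ei ei" and Ei': "has_fourier (\<lambda>_. 1) (\<lambda>z. 1 / Ei z) ei'"
    and Ee: "has_fourier (\<lambda>_. 1) Ee ee" and Ee': "has_fourier (\<lambda>_. 1) (\<lambda>z. 1 / Ee z) ee'"
    and nonzero: "norm z = 1 \<Longrightarrow> Ei z \<noteq> 0" "norm z = 1 \<Longrightarrow> Ee z \<noteq> 0"
    and supp_i: "k < 0 \<Longrightarrow> ei k = 0" "k < 0 \<Longrightarrow> ei' k = 0"
    and supp_e: "k > 0 \<Longrightarrow> ee k = 0" "k > 0 \<Longrightarrow> ee' k = 0"
    and normalized: "ei 0 = 1" "ee' 0 = 1"
begin

abbreviation "h \<equiv> conv ei ee"
abbreviation "g \<equiv> conv ei' ee'"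

text \<open>The symbol \<open>Ei / Ee\<close> replaces the weight function. The nonzero constant by
  which they differ does not affect which coefficients vanish.\<close>

definition orthogonal :: "nat \<Rightarrow> (int \<Rightarrow> complex) \<Rightarrow> bool" where
  "orthogonal n \<phi> \<longleftrightarrow> (\<forall>k. k < 0 \<or> int n < k \<longrightarrow> \<phi> k = 0) \<and> \<phi> (int n) = 1 \<and>
     (\<exists>p e. has_fourier (\<lambda>_. 1) p \<phi> \<and> has_fourier (\<lambda>_. 1) (\<lambda>z. p z * (Ei z / Ee z)) e \<and>
        (\<forall>k. 0 \<le> k \<and> k < int n \<longrightarrow> e k = 0))"

text \<open>Write \<open>p E\<^sub>i / E\<^sub>e = z\<^sup>n u + v\<close> with \<open>u\<close> analytic and \<open>v\<close> anti-analytic; then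
  \<open>U = u / E\<^sub>i\<close> and \<open>V = v E\<^sub>e\<close> satisfy a pair of Hankel equations, obtained by
  comparing coefficients in \<open>p E\<^sub>i = z\<^sup>n U h + V\<close> and \<open>z\<^sup>-\<^sup>n p / E\<^sub>e = U + z\<^sup>-\<^sup>n V g\<close>.\<close>

lemma hankel_equations:
  assumes "orthogonal n \<phi>"
  obtains U V where "(\<lambda>j. norm (U j)) summable_on UNIV"
    "\<And>k. k < 0 \<Longrightarrow> U k = 0" "\<And>k. k \<ge> 0 \<Longrightarrow> V k = 0"
    "\<And>k. k < 0 \<Longrightarrow> ((\<lambda>j. U j * h (k - int n - j)) has_sum - V k) UNIV"
    "\<And>k. k \<ge> 0 \<Longrightarrow> ((\<lambda>l. V l * g (k + int n - l)) has_sum ((if k = 0 then 1 else 0) - U k)) UNIV"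
    "((\<lambda>j. U j * h (- int n - j)) has_sum \<phi> 0) UNIV"
proof -
  note mult = unit_weight.has_fourier_mult(1) and shift = unit_weight.has_fourier_shift
  obtain p e where p: "has_fourier (\<lambda>_. 1) p \<phi>" and e: "has_fourier (\<lambda>_. 1) (\<lambda>z. p z * (Ei z / Ee z)) e"
    and e0: "\<And>k. 0 \<le> k \<Longrightarrow> k < int n \<Longrightarrow> e k = 0"
    and \<phi>: "\<And>k. k < 0 \<or> int n < k \<Longrightarrow> \<phi> k = 0" "\<phi> (int n) = 1"
    using assms unfolding orthogonal_def by blast
  \<comment> \<open>Orthogonality removes the coefficients 0, ..., n-1 of the product, so it splits
    without remainder into indices at least n, shifted to start at 0, and negative indices.\<close>
  define uc where "uc = (\<lambda>k. if k \<ge> 0 then e (k + int n) else 0)"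
  define vc where "vc = (\<lambda>k. if k < 0 then e k else 0)"
  define u where "u = (\<lambda>z. \<Sum>\<^sub>\<infinity>k. uc k * z powi k)"
  define v where "v = (\<lambda>z. \<Sum>\<^sub>\<infinity>k. vc k * z powi k)"
  have "(\<lambda>k. norm (e (k - (- int n)))) summable_on UNIV"
    using shift[OF e, of "- int n"] by (simp add: has_fourier_def)
  then have "(\<lambda>k. 1 * norm (uc k)) summable_on UNIV"
    by (rule summable_on_comparison_test) (auto simp: uc_def)
  then have u: "has_fourier (\<lambda>_. 1) u uc" unfolding u_def by (rule unit_weight.has_fourierI)
  have "(\<lambda>k. norm (e k)) summable_on UNIV" using e by (simp add: has_fourier_def)
  then have "(\<lambda>k. 1 * norm (vc k)) summable_on UNIV"
    by (rule summable_on_comparison_test) (auto simp: vc_def)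
  then have v: "has_fourier (\<lambda>_. 1) v vc" unfolding v_def by (rule unit_weight.has_fourierI)
  have "has_fourier (\<lambda>_. 1) (\<lambda>z. u z * z powi int n + v z) (\<lambda>k. uc (k - int n) + vc k)"
    by (rule unit_weight.has_fourier_add[OF shift[OF u] v])
  moreover have "(\<lambda>k. uc (k - int n) + vc k) = e"
    by (auto simp: fun_eq_iff uc_def vc_def e0)
  ultimately have uv: "has_fourier (\<lambda>_. 1) (\<lambda>z. u z * z powi int n + v z) e" by simp
  have split: "u z * z powi int n + v z = p z * (Ei z / Ee z)" if "norm z = 1" for z
    using uv e that unfolding has_fourier_def by (blast intro: has_sum_unique)

  define U where "U = conv uc ei'"
  define V where "V = conv vc ee"
  note fU = mult[OF u Ei', folded U_def] and fV = mult[OF v Ee, folded V_def]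
  note fh = mult[OF Ei Ee] and fg = mult[OF Ei' Ee']
  have U0: "U k = 0" if "k < 0" for k
    unfolding U_def by (rule conv_eq_0) (use that supp_i in \<open>auto simp: uc_def\<close>)
  have V0: "V k = 0" if "k \<ge> 0" for k
    unfolding V_def by (rule conv_eq_0) (use that supp_e in \<open>auto simp: vc_def\<close>)
  have eq1: "conv \<phi> ei = (\<lambda>k. conv U h (k - int n) + V k)"
  proof (rule has_fourier_unique[OF mult[OF p Ei] unit_weight.has_fourier_add[OF shift[OF mult[OF fU fh]] fV]])
    fix z :: complex assume z: "norm z = 1"
    have "p z * Ei z = (p z * (Ei z / Ee z)) * Ee z" using nonzero[OF z] by simp
    also have "\<dots> = (u z * z powi int n + v z) * Ee z" using split[OF z] by simp
    also have "\<dots> = u z * (1 / Ei z) * (Ei z * Ee z) * z powi int n + v z * Ee z"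
      using nonzero[OF z] by (simp add: field_simps)
    finally show "p z * Ei z = u z * (1 / Ei z) * (Ei z * Ee z) * z powi int n + v z * Ee z" .
  qed
  have eq2: "(\<lambda>k. conv \<phi> ee' (k - (- int n))) = (\<lambda>k. U k + conv V g (k - (- int n)))"
  proof (rule has_fourier_unique[OF shift[OF mult[OF p Ee']] unit_weight.has_fourier_add[OF fU shift[OF mult[OF fV fg]]]])
    fix z :: complex assume z: "norm z = 1"
    then have z0: "z \<noteq> 0" by auto
    have "p z * (1 / Ee z) = (p z * (Ei z / Ee z)) * (1 / Ei z)" using nonzero[OF z] by simp
    also have "\<dots> = (u z * z powi int n + v z) * (1 / Ei z)" using split[OF z] by simp
    finally have "p z * (1 / Ee z) * z powi (- int n)
        = u z * (1 / Ei z) * (z powi int n * z powi (- int n)) + v z * (1 / Ei z) * z powi (- int n)"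
      by (simp add: algebra_simps add_divide_distrib)
    also have "z powi int n * z powi (- int n) = 1" using z0 by (simp add: power_int_minus)
    finally show "p z * (1 / Ee z) * z powi (- int n)
        = u z * (1 / Ei z) + v z * Ee z * (1 / Ei z * (1 / Ee z)) * z powi (- int n)"
      using nonzero[OF z] by simp
  qed
  have cU: "((\<lambda>j. U j * h (k - j)) has_sum conv U h k) UNIV" for k
    by (rule unit_weight.has_fourier_mult(3)[OF fU fh])
  have cV: "((\<lambda>j. V j * g (k - j)) has_sum conv V g k) UNIV" for k
    by (rule unit_weight.has_fourier_mult(3)[OF fV fg])
  show ?thesis
  proof (rule that)
    show "(\<lambda>j. norm (U j)) summable_on UNIV" using fU by (simp add: has_fourier_def)
    show "U k = 0" if "k < 0" for k by (rule U0[OF that])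
    show "V k = 0" if "k \<ge> 0" for k by (rule V0[OF that])
    show "((\<lambda>j. U j * h (k - int n - j)) has_sum - V k) UNIV" if k: "k < 0" for k
    proof -
      \<comment> \<open>The product of \<open>p\<close> and \<open>Ei\<close> is analytic, so at
        negative indices the two terms on the right of \<open>eq1\<close> must cancel.\<close>
      have "\<phi> j = 0 \<or> ei (k - j) = 0" for j
        by (cases "j < 0") (use k \<phi> supp_i in auto)
      then have "conv \<phi> ei k = 0" by (rule conv_eq_0)
      then have "conv U h (k - int n) = - V k" using fun_cong[OF eq1, of k] by (simp add: eq_neg_iff_add_eq_0)
      then show ?thesis using cU[of "k - int n"] by simp
    qed
    show "((\<lambda>l. V l * g (k + int n - l)) has_sum ((if k = 0 then 1 else 0) - U k)) UNIV" if k: "k \<ge> 0" for k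
    proof -
      \<comment> \<open>Both spectra are bounded above, by n and by 0. At index n only the leading
        coefficients meet, and beyond it nothing does.\<close>
      have "conv \<phi> ee' (k + int n) = \<phi> (int n) * ee' (k + int n - int n)"
        by (rule conv_single) (use k \<phi> supp_e in force)
      also have "\<dots> = (if k = 0 then 1 else 0)" using \<phi> normalized k supp_e by auto
      finally have "conv V g (k + int n) = (if k = 0 then 1 else 0) - U k"
        using fun_cong[OF eq2, of k] by (simp add: algebra_simps)
      then show ?thesis using cV[of "k + int n"] by simp
    qed
    have "conv \<phi> ei 0 = \<phi> 0 * ei (0 - 0)" by (rule conv_single) (use \<phi> supp_i in force)
    then have "conv U h (- int n) = \<phi> 0" using fun_cong[OF eq1, of 0] normalized V0[of 0] by simp
    then show "((\<lambda>j. U j * h (- int n - j)) has_sum \<phi> 0) UNIV" using cU[of "- int n"] by simp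
  qed
qed

text \<open>Moduli turn the two equations into one recursive inequality by substituting the estimate
  of \<open>V\<close> into that of \<open>U\<close>. The same estimate of \<open>U\<close> minus the
  unit sequence controls the error, because the unit sequence contributes exactly the leading term
  h_{-n}.\<close>

lemma hankel_bounds:
  fixes H G :: "nat \<Rightarrow> ennreal"
  assumes "orthogonal n \<phi>"
  defines "H \<equiv> \<lambda>l. ennreal (norm (h (- int l)))" and "G \<equiv> \<lambda>l. ennreal (norm (g (int l)))"
  obtains u :: "nat \<Rightarrow> ennreal" where "(\<Sum>j. u j) < top"
    "\<And>k. u k \<le> (if k = 0 then 1 else 0) + (\<Sum>m. G (k + n + Suc m) * (\<Sum>j. H (Suc m + n + j) * u j))"
    "ennreal (norm (\<phi> 0 - h (- int n)))
      \<le> (\<Sum>k. H (n + k) * (\<Sum>m. G (k + n + Suc m) * (\<Sum>j. H (Suc m + n + j) * u j)))"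
proof -
  obtain U V where Us: "(\<lambda>j. norm (U j)) summable_on UNIV"
    and U0: "\<And>k. k < 0 \<Longrightarrow> U k = 0" and V0: "\<And>k. k \<ge> 0 \<Longrightarrow> V k = 0"
    and V: "\<And>k. k < 0 \<Longrightarrow> ((\<lambda>j. U j * h (k - int n - j)) has_sum - V k) UNIV"
    and U: "\<And>k. k \<ge> 0 \<Longrightarrow> ((\<lambda>l. V l * g (k + int n - l)) has_sum ((if k = 0 then 1 else 0) - U k)) UNIV"
    and \<phi>0: "((\<lambda>j. U j * h (- int n - j)) has_sum \<phi> 0) UNIV"
    using hankel_equations[OF assms(1)] by blast
  define u where "u = (\<lambda>j. ennreal (norm (U (int j))))"
  let ?c = "\<lambda>m. \<Sum>j. H (Suc m + n + j) * u j"
  have V_le: "ennreal (norm (V (- int (Suc m)))) \<le> ?c m" for m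
  proof -
    have "((\<lambda>j. U (int j) * h (- int (Suc m) - int n - int j)) has_sum - V (- int (Suc m))) UNIV"
      by (rule has_sum_int_nonneg[OF V]) (simp_all add: U0)
    from ennreal_norm_has_sum_le[OF this] show ?thesis
      by (simp add: norm_mult ennreal_mult H_def u_def mult.commute algebra_simps)
  qed
  have dU_le: "ennreal (norm ((if k = 0 then 1 else 0) - U (int k))) \<le> (\<Sum>m. G (k + n + Suc m) * ?c m)" for k
  proof -
    have "((\<lambda>m. V (- int (Suc m)) * g (int k + int n - (- int (Suc m)))) has_sum ((if int k = 0 then 1 else 0) - U (int k))) UNIV"
      by (rule has_sum_int_neg[OF U]) (simp_all add: V0)
    from ennreal_norm_has_sum_le[OF this]
    have "ennreal (norm ((if k = 0 then 1 else 0) - U (int k)))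
        \<le> (\<Sum>m. ennreal (norm (V (- int (Suc m)) * g (int k + int n - (- int (Suc m))))))" by simp
    also have "\<dots> = (\<Sum>m. G (k + n + Suc m) * ennreal (norm (V (- int (Suc m)))))"
      by (simp add: norm_mult ennreal_mult G_def mult.commute algebra_simps)
    also have "\<dots> \<le> (\<Sum>m. G (k + n + Suc m) * ?c m)"
      by (rule ennreal_suminf_mono, rule mult_left_mono[OF V_le]) simp
    finally show ?thesis .
  qed
  show ?thesis
  proof (rule that[of u])
    have "((\<lambda>j. norm (U (int j))) has_sum (\<Sum>\<^sub>\<infinity>j. norm (U j))) UNIV"
      by (rule has_sum_int_nonneg[OF has_sum_infsum[OF Us]]) (simp add: U0)
    then have s: "summable (\<lambda>j. norm (U (int j)))" by (metis has_sum_imp_sums sums_summable)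
    show "(\<Sum>j. u j) < top"
      unfolding u_def by (subst suminf_ennreal2[OF _ s]) auto
  next
    fix k
    have "u k \<le> ennreal ((if k = 0 then 1 else 0) + norm ((if k = 0 then 1 else 0) - U (int k)))"
      unfolding u_def
      using norm_triangle_ineq4[of "if k = 0 then 1 else 0" "(if k = 0 then 1 else 0) - U (int k)"]
      by (intro ennreal_leI) (auto split: if_splits)
    also have "\<dots> = (if k = 0 then 1 else 0) + ennreal (norm ((if k = 0 then 1 else 0) - U (int k)))"
      by (auto simp: ennreal_plus simp flip: ennreal_1)
    also have "\<dots> \<le> (if k = 0 then 1 else 0) + (\<Sum>m. G (k + n + Suc m) * ?c m)"
      by (intro add_left_mono dU_le)
    finally show "u k \<le> (if k = 0 then 1 else 0) + (\<Sum>m. G (k + n + Suc m) * ?c m)" .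
  next
    \<comment> \<open>This contribution of the unit sequence is subtracted from the series for
      \<phi> 0, leaving only the difference that \<open>dU_le\<close> estimates.\<close>
    have "((\<lambda>j. (if j = 0 then 1 else 0) * h (- int n - j)) has_sum h (- int n)) UNIV"
      by (rule has_sum_finite_neutralI[of "{0}"]) auto
    from has_sum_add[OF \<phi>0 has_sum_uminusI[OF this]]
    have "((\<lambda>j. (U j - (if j = 0 then 1 else 0)) * h (- int n - j)) has_sum (\<phi> 0 - h (- int n))) UNIV"
      by (simp add: ring_distribs)
    then have "((\<lambda>j. (U (int j) - (if int j = 0 then 1 else 0)) * h (- int n - int j)) has_sum (\<phi> 0 - h (- int n))) UNIV"
      by (rule has_sum_int_nonneg) (simp add: U0)
    from ennreal_norm_has_sum_le[OF this]
    have "ennreal (norm (\<phi> 0 - h (- int n)))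
        \<le> (\<Sum>k. ennreal (norm ((U (int k) - (if int k = 0 then 1 else 0)) * h (- int n - int k))))" .
    also have "\<dots> = (\<Sum>k. H (n + k) * ennreal (norm ((if k = 0 then 1 else 0) - U (int k))))"
    proof (rule arg_cong[of _ _ suminf], rule ext)
      fix k
      have "- int n - int k = - int (n + k)" by simp
      then show "ennreal (norm ((U (int k) - (if int k = 0 then 1 else 0)) * h (- int n - int k)))
          = H (n + k) * ennreal (norm ((if k = 0 then 1 else 0) - U (int k)))"
        unfolding H_def by (simp only: norm_mult ennreal_mult norm_ge_zero) (simp add: mult.commute norm_minus_commute)
    qed
    also have "\<dots> \<le> (\<Sum>k. H (n + k) * (\<Sum>m. G (k + n + Suc m) * ?c m))"
      by (rule ennreal_suminf_mono, rule mult_left_mono[OF dU_le]) simp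
    finally show "ennreal (norm (\<phi> 0 - h (- int n))) \<le> (\<Sum>k. H (n + k) * (\<Sum>m. G (k + n + Suc m) * ?c m))" .
  qed
qed

theorem summable_cubic_error:
  assumes \<nu>: "beurling \<nu>" and mono: "\<And>j k. 0 \<le> j \<Longrightarrow> j < k \<Longrightarrow> \<nu> j \<le> \<nu> k"
    and h: "(\<lambda>k. \<nu> k * norm (h k)) summable_on UNIV" and g: "(\<lambda>k. \<nu> k * norm (g k)) summable_on UNIV"
    and orth: "\<And>n. n \<ge> n0 \<Longrightarrow> orthogonal n (\<phi> n)"
  shows "summable (\<lambda>n. \<nu> (int n) ^ 3 * norm (\<phi> n 0 - h (- int n)))"
proof -
  interpret beurling \<nu> by (rule \<nu>)
  define H where "H = (\<lambda>l. ennreal (norm (h (- int l))))"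
  define G where "G = (\<lambda>l. ennreal (norm (g (int l))))"
  let ?\<nu> = "\<lambda>l. ennreal (\<nu> (int l))"
  have hn: "summable (\<lambda>l. \<nu> (int l) * norm (h (- int l)))" "summable (\<lambda>l. \<nu> (int l) * norm (g (int l)))"
  proof -
    have "(\<lambda>k. \<nu> k * norm (h k)) summable_on range (\<lambda>l. - int l)" "(\<lambda>k. \<nu> k * norm (g k)) summable_on range int"
      by (rule summable_on_subset_banach[OF h], simp) (rule summable_on_subset_banach[OF g], simp)
    then show "summable (\<lambda>l. \<nu> (int l) * norm (h (- int l)))" "summable (\<lambda>l. \<nu> (int l) * norm (g (int l)))"
      by (auto simp: summable_on_reindex inj_on_def o_def weight_sym intro!: summable_on_imp_summable)
  qed
  have sH: "summable (\<lambda>l. norm (h (- int l)))"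
    by (rule summable_comparison_test'[OF hn(1), of 0]) (simp add: norm_le_weighted)
  have sG: "summable (\<lambda>l. norm (g (int l)))"
    by (rule summable_comparison_test'[OF hn(2), of 0]) (simp add: norm_le_weighted)
  let ?a = "\<Sum>l. norm (h (- int l))"
  have a0: "?a \<ge> 0" by (intro suminf_nonneg sH) auto
  \<comment> \<open>The tail of g is made small against the full sum of h; the summand 1 keeps the
    denominator positive when h vanishes on the nonpositive indices.\<close>
  have "\<exists>N. \<forall>n\<ge>N. norm (\<Sum>l. norm (g (int (l + n)))) < 1 / (2 * (?a + 1))"
    by (rule suminf_exist_split[OF _ sG]) (use a0 in auto)
  then obtain N1 where N1: "\<And>n. n \<ge> N1 \<Longrightarrow> norm (\<Sum>l. norm (g (int (l + n)))) < 1 / (2 * (?a + 1))" by blast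
  define N where "N = max N1 n0"
  have N: "norm (\<Sum>l. norm (g (int (l + N)))) < 1 / (2 * (?a + 1))" "N \<ge> n0" using N1 by (auto simp: N_def)
  have sGN: "summable (\<lambda>l. norm (g (int (l + N))))"
    using sG by (subst (asm) summable_iff_shift[of "\<lambda>l. norm (g (int l))" N, symmetric])
  let ?b = "\<Sum>l. norm (g (int (l + N)))"
  have b0: "?b \<ge> 0" by (intro suminf_nonneg sGN) auto
  have "?b * ?a \<le> 1 / (2 * (?a + 1)) * ?a" using N(1) a0 by (intro mult_right_mono) auto
  also have "\<dots> \<le> 1 / 2" using a0 by (simp add: field_simps)
  finally have ba: "?b * ?a \<le> 1 / 2" .
  have contr: "(\<Sum>l. G (N + l)) * (\<Sum>l. H l) \<le> 1 / 2"
  proof -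
    have "(\<Sum>l. G (N + l)) = ennreal ?b" "(\<Sum>l. H l) = ennreal ?a"
      unfolding G_def H_def using suminf_ennreal2[OF _ sGN] suminf_ennreal2[OF _ sH]
      by (simp_all only: norm_ge_zero add.commute[of N])
    then have "(\<Sum>l. G (N + l)) * (\<Sum>l. H l) = ennreal (?b * ?a)" using a0 b0 by (simp add: ennreal_mult)
    also have "\<dots> \<le> ennreal (1 / 2)" by (rule ennreal_leI[OF ba])
    also have "ennreal (1 / 2) = 1 / 2" using divide_ennreal[of 1 2] by simp
    finally show ?thesis .
  qed
  have "\<forall>n. \<exists>u. n \<ge> N \<longrightarrow> (\<Sum>j. u j) < top \<and>
    (\<forall>k. u k \<le> (if k = 0 then 1 else 0) + (\<Sum>m. G (k + n + Suc m) * (\<Sum>j. H (Suc m + n + j) * u j))) \<and>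
    ennreal (norm (\<phi> n 0 - h (- int n)))
      \<le> (\<Sum>k. H (n + k) * (\<Sum>m. G (k + n + Suc m) * (\<Sum>j. H (Suc m + n + j) * u j)))"
  proof
    fix n
    show "\<exists>u. n \<ge> N \<longrightarrow> (\<Sum>j. u j) < top \<and>
      (\<forall>k. u k \<le> (if k = 0 then 1 else 0) + (\<Sum>m. G (k + n + Suc m) * (\<Sum>j. H (Suc m + n + j) * u j))) \<and>
      ennreal (norm (\<phi> n 0 - h (- int n)))
        \<le> (\<Sum>k. H (n + k) * (\<Sum>m. G (k + n + Suc m) * (\<Sum>j. H (Suc m + n + j) * u j)))"
    proof (cases "n \<ge> N")
      case True
      then have "orthogonal n (\<phi> n)" using orth N(2) by simp
      show ?thesis
        by (rule hankel_bounds[OF \<open>orthogonal n (\<phi> n)\<close>]) (unfold H_def G_def, blast)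
    qed simp
  qed
  from choice[OF this] obtain u where
    u: "\<And>n. n \<ge> N \<Longrightarrow> (\<Sum>j. u n j) < top"
      "\<And>n k. n \<ge> N \<Longrightarrow> u n k \<le> (if k = 0 then 1 else 0) + (\<Sum>m. G (k + n + Suc m) * (\<Sum>j. H (Suc m + n + j) * u n j))"
      "\<And>n. n \<ge> N \<Longrightarrow> ennreal (norm (\<phi> n 0 - h (- int n)))
        \<le> (\<Sum>k. H (n + k) * (\<Sum>m. G (k + n + Suc m) * (\<Sum>j. H (Suc m + n + j) * u n j)))"
    by blast
  have "(\<Sum>n. ?\<nu> (N + n) ^ 3 * ennreal (norm (\<phi> (N + n) 0 - h (- int (N + n)))))
      \<le> 2 * (\<Sum>l. ?\<nu> l * H l)\<^sup>2 * (\<Sum>l. ?\<nu> l * G l)"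
  proof (rule cubic_tail_sum[OF contr u(1,2) _ u(3)])
    fix i j :: nat assume "i \<le> j"
    then show "?\<nu> i \<le> ?\<nu> j" using mono[of "int i" "int j"] by (cases "i = j") (auto intro: ennreal_leI)
  qed auto
  also have "\<dots> < top"
  proof -
    have "(\<Sum>l. ?\<nu> l * H l) < top" "(\<Sum>l. ?\<nu> l * G l) < top"
      unfolding H_def G_def ennreal_mult[OF weight_nonneg norm_ge_zero, symmetric]
      by (subst suminf_ennreal2[OF _ hn(1)], simp_all add: weight_nonneg)
         (subst suminf_ennreal2[OF _ hn(2)], simp_all add: weight_nonneg)
    then show ?thesis by (simp add: ennreal_mult_less_top power2_eq_square)
  qed
  finally have fin: "(\<Sum>n. ?\<nu> (N + n) ^ 3 * ennreal (norm (\<phi> (N + n) 0 - h (- int (N + n))))) < top" .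
  have "?\<nu> n ^ 3 * ennreal (norm x) = ennreal (\<nu> (int n) ^ 3 * norm x)" for n and x :: complex
    using weight_nonneg by (simp add: ennreal_mult ennreal_power)
  with fin have "(\<Sum>n. ennreal (\<nu> (int (N + n)) ^ 3 * norm (\<phi> (N + n) 0 - h (- int (N + n))))) \<noteq> top"
    by (simp only: less_top)
  then have "summable (\<lambda>n. \<nu> (int (N + n)) ^ 3 * norm (\<phi> (N + n) 0 - h (- int (N + n))))"
    by (intro summable_suminf_not_top) (auto simp: weight_nonneg)
  then show ?thesis
    using summable_iff_shift[of "\<lambda>n. \<nu> (int n) ^ 3 * norm (\<phi> n 0 - h (- int n))" N] by (simp add: add.commute)
qed

end

section \<open>The Szego function\<close>

lemma has_sum_geometric_int:
  fixes y :: "'a::{real_normed_field,banach}"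
  assumes "norm y < 1"
  shows "((\<lambda>k::int. if k > 0 then y powi k else 0) has_sum y / (1 - y)) UNIV"
proof -
  have "((\<lambda>n. y ^ n) has_sum y / (1 - y)) {1..} \<longleftrightarrow> ((\<lambda>k::int. y powi k) has_sum y / (1 - y)) {1..}"
    by (rule has_sum_reindex_bij_witness[where i = nat and j = int]) auto
  then have "((\<lambda>k::int. y powi k) has_sum y / (1 - y)) {1..}"
    using has_sum_geometric_from_1[OF assms] by simp
  then show ?thesis
    by (rule has_sum_cong_neutral[THEN iffD1, rotated -1]) auto
qed

lemma has_sum_single: "((\<lambda>k. if k = i then c else 0) has_sum c) UNIV"
  by (rule has_sum_finite_neutralI[of "{i}"]) auto

lemma has_fourier_szego_kernel_interior:
  assumes x: "norm x < 1"
  shows "has_fourier (\<lambda>_. 1) (\<lambda>\<zeta>. (\<zeta> + x) / (\<zeta> - x))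
    (\<lambda>k. (if k = 0 then 1 else 0) + 2 * (if k < 0 then x powi (- k) else 0))"
    (is "has_fourier _ _ ?\<kappa>")
  unfolding has_fourier_def
proof (intro conjI allI impI)
  have "((\<lambda>k::int. if - k > 0 then norm x powi (- k) else 0) has_sum norm x / (1 - norm x)) UNIV"
    using has_sum_geometric_int[of "norm x"] x
      has_sum_reindex_bij_betw[OF bij_uminus, of "\<lambda>k::int. if k > 0 then norm x powi k else 0"]
    by (simp only: real_norm_def abs_norm_cancel)
  from has_sum_add[OF has_sum_single has_sum_cmult_right[OF this]]
  have "((\<lambda>k::int. (if k = 0 then 1 else 0) + 2 * (if - k > 0 then norm x powi (- k) else 0))
      has_sum (1 + 2 * (norm x / (1 - norm x)))) UNIV"
    .
  then show "(\<lambda>k. 1 * norm (?\<kappa> k)) summable_on UNIV"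
    by (rule summable_on_comparison_test[OF has_sum_imp_summable]) (auto simp: norm_mult norm_power_int)
next
  fix \<zeta> :: complex assume z: "norm \<zeta> = 1"
  then have z0: "\<zeta> \<noteq> 0" by auto
  have zx: "\<zeta> \<noteq> x" using z x by auto
  have "((\<lambda>k::int. if - k > 0 then (x / \<zeta>) powi (- k) else 0) has_sum (x / \<zeta>) / (1 - x / \<zeta>)) UNIV"
    using has_sum_geometric_int[of "x / \<zeta>"] x z
      has_sum_reindex_bij_betw[OF bij_uminus, of "\<lambda>k::int. if k > 0 then (x / \<zeta>) powi k else 0"]
    by (simp add: norm_divide)
  from has_sum_add[OF has_sum_single has_sum_cmult_right[OF this]]
  have "((\<lambda>k::int. (if k = 0 then 1 else 0) + 2 * (if - k > 0 then (x / \<zeta>) powi (- k) else 0))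
      has_sum (1 + 2 * ((x / \<zeta>) / (1 - x / \<zeta>)))) UNIV"
    .
  moreover have "(if k = 0 then 1 else 0) + 2 * (if - k > 0 then (x / \<zeta>) powi (- k) else 0) = ?\<kappa> k * \<zeta> powi k" for k :: int
    using z0 by (auto simp: power_int_divide_distrib power_int_minus field_simps)
  moreover have "1 + 2 * ((x / \<zeta>) / (1 - x / \<zeta>)) = (\<zeta> + x) / (\<zeta> - x)"
    using z0 zx by (simp add: field_simps)
  ultimately show "((\<lambda>k. ?\<kappa> k * \<zeta> powi k) has_sum (\<zeta> + x) / (\<zeta> - x)) UNIV" by simp
qed

lemma has_fourier_szego_kernel_exterior:
  assumes x: "norm x > 1"
  shows "has_fourier (\<lambda>_. 1) (\<lambda>\<zeta>. (\<zeta> + x) / (\<zeta> - x))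
    (\<lambda>k. (if k = 0 then - 1 else 0) + (- 2) * (if k > 0 then x powi (- k) else 0))"
    (is "has_fourier _ _ ?\<kappa>")
  unfolding has_fourier_def
proof (intro conjI allI impI)
  have x0: "x \<noteq> 0" using x by auto
  have "norm (1 / norm x) < 1" using x by (simp add: divide_less_eq)
  from has_sum_add[OF has_sum_single has_sum_cmult_right[OF has_sum_geometric_int[OF this]]]
  have "((\<lambda>k::int. (if k = 0 then 1 else 0) + 2 * (if k > 0 then (1 / norm x) powi k else 0))
      has_sum (1 + 2 * ((1 / norm x) / (1 - 1 / norm x)))) UNIV"
    .
  then show "(\<lambda>k. 1 * norm (?\<kappa> k)) summable_on UNIV"
    by (rule summable_on_comparison_test[OF has_sum_imp_summable])
       (auto simp: norm_mult norm_divide norm_power_int power_int_minus power_int_divide_distrib field_simps)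
next
  fix \<zeta> :: complex assume z: "norm \<zeta> = 1"
  then have z0: "\<zeta> \<noteq> 0" by auto
  have zx: "\<zeta> \<noteq> x" "x \<noteq> 0" "x - \<zeta> \<noteq> 0" using z x by auto
  have "norm (\<zeta> / x) < 1" using z x zx(2) by (simp add: norm_divide divide_less_eq)
  from has_sum_add[OF has_sum_single has_sum_cmult_right[OF has_sum_geometric_int[OF this]]]
  have "((\<lambda>k::int. (if k = 0 then - 1 else 0) + (- 2) * (if k > 0 then (\<zeta> / x) powi k else 0))
      has_sum (- 1 + (- 2) * ((\<zeta> / x) / (1 - \<zeta> / x)))) UNIV"
    .
  moreover have "(if k = 0 then - 1 else 0) + (- 2) * (if k > 0 then (\<zeta> / x) powi k else 0) = ?\<kappa> k * \<zeta> powi k" for k :: int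
    using zx by (auto simp: power_int_divide_distrib power_int_minus field_simps)
  moreover have "- 1 + (- 2) * ((\<zeta> / x) / (1 - \<zeta> / x)) = (\<zeta> + x) / (\<zeta> - x)"
  proof -
    have "(\<zeta> / x) / (1 - \<zeta> / x) = \<zeta> / (x - \<zeta>)" using zx by (simp add: field_simps)
    then show ?thesis using zx by (simp add: field_simps)
  qed
  ultimately show "((\<lambda>k. ?\<kappa> k * \<zeta> powi k) has_sum (\<zeta> + x) / (\<zeta> - x)) UNIV" by simp
qed

section \<open>The Szego function and its boundary values\<close>

definition part_pos :: "(int \<Rightarrow> complex) \<Rightarrow> complex \<Rightarrow> complex" where
  "part_pos l z = (\<Sum>\<^sub>\<infinity>k. (if k > 0 then l k else 0) * z powi k)"

definition part_neg :: "(int \<Rightarrow> complex) \<Rightarrow> complex \<Rightarrow> complex" where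
  "part_neg l z = (\<Sum>\<^sub>\<infinity>k. (if k < 0 then l k else 0) * z powi k)"

lemma szego_eq:
  assumes L: "has_fourier (\<lambda>_. 1) (log_w w) l" and K: "has_fourier (\<lambda>_. 1) (\<lambda>\<zeta>. (\<zeta> + x) / (\<zeta> - x)) \<kappa>"
  shows "szego w x = exp (conv l \<kappa> 0 / 2)"
proof -
  note LK = unit_weight.has_fourier_mult(1)[OF L K]
  have "(LINT \<theta>:{0..2*pi}|lborel. log_w w (cis \<theta>) * (cis \<theta> + x) / (cis \<theta> - x))
      = (LINT \<theta>:{0..2*pi}|lborel. (\<lambda>\<zeta>. log_w w \<zeta> * ((\<zeta> + x) / (\<zeta> - x))) (cis \<theta>))" by simp
  also have "\<dots> = integral {0..2*pi} (\<lambda>\<theta>. (\<lambda>\<zeta>. log_w w \<zeta> * ((\<zeta> + x) / (\<zeta> - x))) (cis \<theta>))"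
    by (rule circle_integral(2)[OF has_fourier_continuous[OF LK]])
  also have "\<dots> = complex_of_real (2 * pi) * conv l \<kappa> 0"
    using has_fourier_integral_0[OF LK, of 0] by simp
  finally show ?thesis by (simp add: szego_def)
qed

text \<open>The mean of a product pairs \<open>l j\<close> with the kernel coefficient at -j. Inside
  the disc the kernel is 1 plus twice a series in negative powers of \<zeta>, so the mean of the
  logarithm gets weight one half and the positive coefficients full weight.\<close>

lemma szego_interior:
  assumes L: "has_fourier (\<lambda>_. 1) (log_w w) l" and x: "norm x < 1"
  shows "szego w x = exp (l 0 / 2 + part_pos l x)"
proof -
  let ?\<kappa> = "\<lambda>k. (if k = 0 then 1 else 0) + 2 * (if k < 0 then x powi (- k) else 0)"
  note K = has_fourier_szego_kernel_interior[OF x]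
  have "((\<lambda>j. l j * ?\<kappa> (0 - j)) has_sum conv l ?\<kappa> 0) UNIV"
    by (rule unit_weight.has_fourier_mult(3)[OF L K])
  moreover have "((\<lambda>j. if j = 0 then l 0 else 0) has_sum l 0) UNIV"
    by (rule has_sum_finite_neutralI[of "{0}"]) auto
  ultimately have "((\<lambda>j. (1 / 2) * (l j * ?\<kappa> (0 - j) + - (if j = 0 then l 0 else 0))) has_sum (1 / 2) * (conv l ?\<kappa> 0 + - l 0)) UNIV"
    by (intro has_sum_cmult_right has_sum_add has_sum_uminusI)
  moreover have "(1 / 2) * (l j * ?\<kappa> (0 - j) + - (if j = 0 then l 0 else 0)) = (if j > 0 then l j else 0) * x powi j" for j
    by (cases j rule: linorder_cases[of _ 0]) auto
  ultimately have "part_pos l x = (1 / 2) * (conv l ?\<kappa> 0 + - l 0)"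
    unfolding part_pos_def by (intro infsumI) simp
  then have "conv l ?\<kappa> 0 / 2 = l 0 / 2 + part_pos l x" by (simp add: field_simps)
  then show ?thesis using szego_eq[OF L K] by (simp only:)
qed

text \<open>Outside the disc the kernel expands in positive powers with the opposite sign, so the
  negative half of the logarithm appears, negated.\<close>

lemma szego_exterior:
  assumes L: "has_fourier (\<lambda>_. 1) (log_w w) l" and x: "norm x > 1"
  shows "szego w x = exp (- (l 0 / 2) - part_neg l x)"
proof -
  let ?\<kappa> = "\<lambda>k. (if k = 0 then - 1 else 0) + (- 2) * (if k > 0 then x powi (- k) else 0)"
  note K = has_fourier_szego_kernel_exterior[OF x]
  have "((\<lambda>j. l j * ?\<kappa> (0 - j)) has_sum conv l ?\<kappa> 0) UNIV"
    by (rule unit_weight.has_fourier_mult(3)[OF L K])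
  moreover have "((\<lambda>j. if j = 0 then l 0 else 0) has_sum l 0) UNIV"
    by (rule has_sum_finite_neutralI[of "{0}"]) auto
  ultimately have "((\<lambda>j. (- 1 / 2) * (l j * ?\<kappa> (0 - j) + (if j = 0 then l 0 else 0))) has_sum (- 1 / 2) * (conv l ?\<kappa> 0 + l 0)) UNIV"
    by (intro has_sum_cmult_right has_sum_add)
  moreover have "(- 1 / 2) * (l j * ?\<kappa> (0 - j) + (if j = 0 then l 0 else 0)) = (if j < 0 then l j else 0) * x powi j" for j
    by (cases j rule: linorder_cases[of _ 0]) auto
  ultimately have "part_neg l x = (- 1 / 2) * (conv l ?\<kappa> 0 + l 0)"
    unfolding part_neg_def by (intro infsumI) simp
  then have "conv l ?\<kappa> 0 / 2 = - (l 0 / 2) - part_neg l x" by (simp add: field_simps)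
  then show ?thesis using szego_eq[OF L K] by (simp only:)
qed

lemma continuous_on_part_pos:
  assumes "(\<lambda>k. norm (l k)) summable_on UNIV"
  shows "continuous_on (cball 0 1) (part_pos l)"
  unfolding part_pos_def
proof (rule continuous_on_infsum[OF _ _ assms])
  fix k :: int
  have "(\<lambda>z::complex. (if k > 0 then l k else 0) * z powi k) = (\<lambda>z. (if k > 0 then l k else 0) * z ^ nat k)"
    by (auto simp: power_int_def)
  then show "continuous_on (cball 0 1) (\<lambda>z. (if k > 0 then l k else 0) * z powi k)"
    by (simp only:) (intro continuous_intros)
  fix z :: complex assume "z \<in> cball 0 1"
  then have "norm z ^ nat k \<le> 1" by (intro power_le_one) auto
  then show "norm ((if k > 0 then l k else 0) * z powi k) \<le> norm (l k)"
    by (auto simp: norm_mult norm_power power_int_def intro: mult_left_le)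
qed

lemma continuous_on_part_neg:
  assumes "(\<lambda>k. norm (l k)) summable_on UNIV"
  shows "continuous_on {z. 1 \<le> norm z} (part_neg l)"
  unfolding part_neg_def
proof (rule continuous_on_infsum[OF _ _ assms])
  fix k :: int
  show "continuous_on {z::complex. 1 \<le> norm z} (\<lambda>z. (if k < 0 then l k else 0) * z powi k)"
    by (intro continuous_intros) auto
  fix z :: complex assume "z \<in> {z. 1 \<le> norm z}"
  then have "inverse (norm z) ^ nat (- k) \<le> 1" by (intro power_le_one) (auto simp: inverse_le_1_iff)
  then show "norm ((if k < 0 then l k else 0) * z powi k) \<le> norm (l k)"
    by (auto simp: norm_mult norm_power norm_inverse power_int_def intro: mult_left_le)
qed

text \<open>The coefficients are absolutely summable, so \<open>part_pos\<close> is continuous on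
  the closed disc and the radial limit is its boundary value.\<close>

lemma D_i_eq:
  assumes L: "has_fourier (\<lambda>_. 1) (log_w w) l" and z: "norm z = 1"
  shows "D_i w z = exp (l 0 / 2 + part_pos l z)"
proof -
  have l: "(\<lambda>k. norm (l k)) summable_on UNIV" using L by (simp add: has_fourier_def)
  have "continuous_on {0..1} (\<lambda>r. exp (l 0 / 2 + part_pos l (complex_of_real r * z)))"
    by (intro continuous_intros continuous_on_compose2[OF continuous_on_part_pos[OF l]])
       (use z in \<open>auto simp: norm_mult\<close>)
  then have "((\<lambda>r. exp (l 0 / 2 + part_pos l (complex_of_real r * z))) \<longlongrightarrow> exp (l 0 / 2 + part_pos l z)) (at 1 within {0..1})"
    by (auto simp: continuous_on_def dest!: bspec[of _ _ 1])
  then have "((\<lambda>r. exp (l 0 / 2 + part_pos l (complex_of_real r * z))) \<longlongrightarrow> exp (l 0 / 2 + part_pos l z)) (at_left 1)"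
    by (simp add: at_within_Icc_at_left)
  moreover have "eventually (\<lambda>r. exp (l 0 / 2 + part_pos l (complex_of_real r * z)) = szego w (complex_of_real r * z)) (at_left 1)"
    using eventually_at_left_real[of 0 1]
    by (auto elim!: eventually_mono intro!: szego_interior[OF L, symmetric] simp: norm_mult z)
  ultimately have "((\<lambda>r. szego w (complex_of_real r * z)) \<longlongrightarrow> exp (l 0 / 2 + part_pos l z)) (at_left 1)"
    by (rule Lim_transform_eventually)
  then show ?thesis unfolding D_i_def by (intro tendsto_Lim) auto
qed

lemma D_e_eq:
  assumes L: "has_fourier (\<lambda>_. 1) (log_w w) l" and z: "norm z = 1"
  shows "D_e w z = exp (- (l 0 / 2) - part_neg l z)"
proof -
  have l: "(\<lambda>k. norm (l k)) summable_on UNIV" using L by (simp add: has_fourier_def)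
  have "continuous_on {1..2} (\<lambda>r. exp (- (l 0 / 2) - part_neg l (complex_of_real r * z)))"
    by (intro continuous_intros continuous_on_compose2[OF continuous_on_part_neg[OF l]])
       (use z in \<open>auto simp: norm_mult\<close>)
  then have "((\<lambda>r. exp (- (l 0 / 2) - part_neg l (complex_of_real r * z))) \<longlongrightarrow> exp (- (l 0 / 2) - part_neg l z)) (at 1 within {1..2})"
    by (auto simp: continuous_on_def dest!: bspec[of _ _ 1])
  then have "((\<lambda>r. exp (- (l 0 / 2) - part_neg l (complex_of_real r * z))) \<longlongrightarrow> exp (- (l 0 / 2) - part_neg l z)) (at_right 1)"
    by (simp add: at_within_Icc_at_right)
  moreover have "eventually (\<lambda>r. exp (- (l 0 / 2) - part_neg l (complex_of_real r * z)) = szego w (complex_of_real r * z)) (at_right 1)"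
    using eventually_at_right_real[of 1 2]
    by (auto elim!: eventually_mono intro!: szego_exterior[OF L, symmetric] simp: norm_mult z)
  ultimately have "((\<lambda>r. szego w (complex_of_real r * z)) \<longlongrightarrow> exp (- (l 0 / 2) - part_neg l z)) (at_right 1)"
    by (rule Lim_transform_eventually)
  then show ?thesis unfolding D_e_def by (intro tendsto_Lim) auto
qed

text \<open>A nonvanishing loop has a continuous logarithm along its parameter, and the winding
  number is the defect at the endpoints. When it is 0 the logarithm closes up and descends to the
  circle.\<close>

lemma winding_number_0_imp_circle_log:
  assumes W: "continuous_on (sphere 0 1) W" and nz: "\<And>z. norm z = 1 \<Longrightarrow> W z \<noteq> 0"
    and wind: "winding_number (\<lambda>t. W (cis (2 * pi * t))) 0 = 0"
  obtains L where "continuous_on (sphere 0 1) L" "\<And>z. norm z = 1 \<Longrightarrow> exp (L z) = W z"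
proof -
  let ?p = "\<lambda>t. W (cis (2 * pi * t))"
  have "continuous_on {0..1} ?p"
    by (rule continuous_on_compose2[OF W]) (auto intro!: continuous_intros simp: cis_conv_exp)
  then have "path ?p" by (simp add: path_def)
  moreover have "0 \<notin> path_image ?p" using nz by (force simp: path_image_def)
  ultimately obtain q where q: "path q" "pathfinish q - pathstart q = 2 * of_real pi * \<i> * winding_number ?p 0"
    "\<And>t. t \<in> {0..1} \<Longrightarrow> ?p t = 0 + exp (q t)"
    by (rule winding_number_as_continuous_log) blast
  \<comment> \<open>The trivial homotopy is taken only for its passage to maps of the circle: it
    supplies continuity of the composite with \<open>Arg2pi\<close> across the jump of the
    argument.\<close>
  then have "homotopic_loops UNIV q q" using wind by (simp add: homotopic_loops_refl)
  from homotopic_with_imp_continuous[OF homotopic_loops_imp_homotopic_circlemaps[OF this]]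
  have "continuous_on (sphere 0 1) (q \<circ> (\<lambda>z. Arg2pi z / (2 * pi)))" by simp
  moreover have "exp ((q \<circ> (\<lambda>z. Arg2pi z / (2 * pi))) z) = W z" if z: "norm z = 1" for z
  proof -
    have "Arg2pi z / (2 * pi) \<in> {0..1}" using Arg2pi[of z] by (auto simp: divide_le_eq)
    from q(3)[OF this] have "exp (q (Arg2pi z / (2 * pi))) = W (cis (Arg2pi z))" by simp
    moreover have "cis (Arg2pi z) = z" using Arg2pi_eq[of z] z by (simp add: cis_conv_exp)
    ultimately show ?thesis by simp
  qed
  ultimately show ?thesis by (rule that)
qed

section \<open>The scattering function and the Verblunsky coefficients\<close>

lemma set_integrable_cis_mult:
  fixes f :: "real \<Rightarrow> complex"
  assumes "set_integrable lborel A f"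
  shows "set_integrable lborel A (\<lambda>\<theta>. cis (c * \<theta>) * f \<theta>)"
  unfolding set_integrable_def
proof (rule Bochner_Integration.integrable_bound[OF assms[unfolded set_integrable_def]])
  have "(\<lambda>\<theta>. cis (c * \<theta>)) \<in> borel_measurable lborel"
    by (simp add: borel_measurable_continuous_onI continuous_intros cis_conv_exp)
  moreover have "(\<lambda>\<theta>. indicator A \<theta> *\<^sub>R f \<theta>) \<in> borel_measurable lborel"
    using assms unfolding set_integrable_def by (rule borel_measurable_integrable)
  ultimately have "(\<lambda>\<theta>. cis (c * \<theta>) * (indicator A \<theta> *\<^sub>R f \<theta>)) \<in> borel_measurable lborel"
    by (rule borel_measurable_times)
  then show "(\<lambda>\<theta>. indicator A \<theta> *\<^sub>R (cis (c * \<theta>) * f \<theta>)) \<in> borel_measurable lborel" by simp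
qed (simp add: norm_mult)

definition poly_coeffs :: "complex poly \<Rightarrow> int \<Rightarrow> complex" where
  "poly_coeffs \<Phi> k = (if k < 0 then 0 else coeff \<Phi> (nat k))"

lemma has_sum_poly_coeffs:
  fixes f :: "int \<Rightarrow> complex"
  assumes "degree \<Phi> = n"
  shows "((\<lambda>k. poly_coeffs \<Phi> k * f k) has_sum (\<Sum>j\<le>n. coeff \<Phi> j * f (int j))) UNIV"
proof (rule has_sum_finite_neutralI[of "int ` {..n}"])
  fix k assume k: "k \<in> UNIV - int ` {..n}"
  have "k < 0 \<or> nat k > n"
  proof (rule ccontr)
    assume "\<not> (k < 0 \<or> nat k > n)"
    then have "k = int (nat k)" "nat k \<in> {..n}" by auto
    with k show False by blast
  qed
  then show "poly_coeffs \<Phi> k * f k = 0" using assms by (auto simp: poly_coeffs_def coeff_eq_0)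
qed (auto simp: sum.reindex poly_coeffs_def)

lemma has_fourier_poly: "has_fourier (\<lambda>_. 1) (poly \<Phi>) (poly_coeffs \<Phi>)"
  unfolding has_fourier_def
proof (intro conjI allI impI)
  have "finite {k. poly_coeffs \<Phi> k \<noteq> 0}"
    by (rule finite_subset[of _ "{0..int (degree \<Phi>)}"])
       (auto simp: poly_coeffs_def intro: ccontr dest!: le_degree split: if_splits)
  then show "(\<lambda>k. 1 * norm (poly_coeffs \<Phi> k)) summable_on UNIV"
    by (intro finite_nonzero_values_imp_summable_on) auto
  show "((\<lambda>k. poly_coeffs \<Phi> k * z powi k) has_sum poly \<Phi> z) UNIV" for z
    using has_sum_poly_coeffs[OF refl, of \<Phi> "\<lambda>k. z powi k"] by (simp add: poly_altdef)
qed

text \<open>Expanding the polynomial under the integral leaves a finite combination of Fourier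
  coefficients of \<open>w\<close>. Integrability alone is enough, and by its coefficients the
  result transfers to the continuous function \<open>fourier_ext w\<close>.\<close>

lemma monic_OP_imp_conv_eq_0:
  assumes w: "L1_circle w" and \<Phi>: "monic_OP w n \<Phi>" and k: "0 \<le> k" "k < int n"
  shows "conv (poly_coeffs \<Phi>) (fourier_coeff w) k = 0"
proof -
  have deg: "degree \<Phi> = n" using \<Phi> by (simp add: monic_OP_def)
  let ?f = "\<lambda>j \<theta>. coeff \<Phi> j * (cis (- (of_int (k - int j) * \<theta>)) * w (cis \<theta>))"
  have int: "set_integrable lborel {-pi..pi} (?f j)" for j
    using set_integrable_cis_mult[OF w[unfolded L1_circle_def], of "- of_int (k - int j)"]
    by (intro set_integrable_mult_right) (simp only: mult_minus_left)
  have "poly \<Phi> (cis \<theta>) * cis (- (real (nat k) * \<theta>)) * w (cis \<theta>) = (\<Sum>j\<le>n. ?f j \<theta>)" for \<theta>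
  proof -
    have "cis \<theta> ^ j * cis (- (of_int k * \<theta>)) = cis (- (of_int (k - int j) * \<theta>))" for j
      unfolding Complex.DeMoivre cis_mult by (simp add: algebra_simps)
    then show ?thesis
      using k by (simp add: poly_altdef deg sum_distrib_right mult.assoc flip: mult.assoc[of "cis \<theta> ^ _"])
  qed
  moreover have "(LINT \<theta>:{-pi..pi}|lborel. poly \<Phi> (cis \<theta>) * cis (- (real (nat k) * \<theta>)) * w (cis \<theta>)) = 0"
  proof -
    have "nat k < n" using k by (simp add: nat_less_iff)
    then show ?thesis using \<Phi> unfolding monic_OP_def by blast
  qed
  ultimately have "0 = (LINT \<theta>:{-pi..pi}|lborel. (\<Sum>j\<le>n. ?f j \<theta>))" by (simp only:)
  also have "\<dots> = (\<Sum>j\<le>n. LINT \<theta>:{-pi..pi}|lborel. ?f j \<theta>)"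
    using int unfolding set_lebesgue_integral_def set_integrable_def scaleR_sum_right
    by (intro Bochner_Integration.integral_sum) auto
  also have "\<dots> = (\<Sum>j\<le>n. coeff \<Phi> j * (complex_of_real (2 * pi) * fourier_coeff w (k - int j)))"
    by (simp add: fourier_coeff_def)
  also have "\<dots> = complex_of_real (2 * pi) * (\<Sum>j\<le>n. coeff \<Phi> j * fourier_coeff w (k - int j))"
    by (simp add: sum_distrib_left mult_ac)
  also have "(\<Sum>j\<le>n. coeff \<Phi> j * fourier_coeff w (k - int j)) = conv (poly_coeffs \<Phi>) (fourier_coeff w) k"
    unfolding conv_def by (rule infsumI[symmetric], rule has_sum_poly_coeffs[OF deg])
  finally show ?thesis by simp
qed

lemma (in beurling) log_parts:
  assumes L: "has_fourier \<nu> L l"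
  shows "has_fourier \<nu> (part_pos l) (\<lambda>k. if k > 0 then l k else 0)"
    and "has_fourier \<nu> (part_neg l) (\<lambda>k. if k < 0 then l k else 0)"
    and "norm z = 1 \<Longrightarrow> L z = l 0 + part_pos l z + part_neg l z"
proof -
  have l: "(\<lambda>k. \<nu> k * norm (l k)) summable_on UNIV" using L by (simp add: has_fourier_def)
  show p: "has_fourier \<nu> (part_pos l) (\<lambda>k. if k > 0 then l k else 0)"
    unfolding part_pos_def[abs_def]
    by (rule has_fourierI, rule summable_on_comparison_test[OF l]) (auto simp: weight_nonneg)
  show n: "has_fourier \<nu> (part_neg l) (\<lambda>k. if k < 0 then l k else 0)"
    unfolding part_neg_def[abs_def]
    by (rule has_fourierI, rule summable_on_comparison_test[OF l]) (auto simp: weight_nonneg)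
  assume z: "norm z = 1"
  have "(\<lambda>k. (if k = 0 then l 0 else 0) + (if k > 0 then l k else 0) + (if k < 0 then l k else 0)) = l"
    by (auto simp: fun_eq_iff)
  then have "has_fourier \<nu> (\<lambda>z. l 0 + part_pos l z + part_neg l z) l"
    using has_fourier_add[OF has_fourier_add[OF has_fourier_const[of "l 0"] p] n] by simp
  then show "L z = l 0 + part_pos l z + part_neg l z"
    using L z unfolding has_fourier_def by (blast intro: has_sum_unique)
qed

text \<open>The chosen logarithm of a positive function need not be real, but its imaginary part is
  a constant multiple of 2 pi. Off index 0 the coefficients are therefore conjugate symmetric, so
  the two halves are conjugate; the mean leaves only the exponential of i Im L, which is 1.\<close>

lemma real_log_conjugate_parts:
  assumes L: "has_fourier (\<lambda>_. 1) L l"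
    and pos: "\<And>z. norm z = 1 \<Longrightarrow> exp (L z) \<in> \<real> \<and> 0 < Re (exp (L z))" and z: "norm z = 1"
  shows "exp (l 0 / 2 + part_pos l z) * cnj (exp (- (l 0 / 2) - part_neg l z)) = 1"
proof -
  have one: "exp (\<i> * of_real (Im (L z))) = 1" if z: "norm z = 1" for z
  proof -
    have "exp (L z) = of_real (norm (exp (L z)))"
      using pos[OF z] by (metis Reals_cases Re_complex_of_real abs_of_pos norm_of_real)
    also have "\<dots> = of_real (exp (Re (L z)))" by simp
    finally have "exp (L z) = exp (of_real (Re (L z)))" by (simp add: exp_of_real)
    moreover have "exp (L z) = exp (of_real (Re (L z))) * exp (\<i> * of_real (Im (L z)))"
      by (subst exp_add[symmetric]) (simp flip: complex_eq)
    ultimately show ?thesis by simp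
  qed
  obtain c where c: "\<And>z. z \<in> sphere 0 1 \<Longrightarrow> \<i> * of_real (Im (L z)) = c"
  proof (rule exp_eq_1_imp_constant[of "sphere (0::complex) 1"])
    show "connected (sphere (0::complex) 1)" by (rule connected_sphere) simp
    show "continuous_on (sphere 0 1) (\<lambda>z. \<i> * of_real (Im (L z)))"
      by (intro continuous_intros has_fourier_continuous[OF L])
  qed (use one in auto)
  have ec: "exp c = 1" using one[OF z] c[of z] z by simp
  have "(\<lambda>k. l k + (-1) * cnj (l (- k))) = (\<lambda>k. if k = 0 then 2 * c else 0)"
  proof (rule has_fourier_unique)
    show "has_fourier (\<lambda>_. 1) (\<lambda>z. L z + (-1) * cnj (L z)) (\<lambda>k. l k + (-1) * cnj (l (- k)))"
      by (intro unit_weight.has_fourier_add unit_weight.has_fourier_cmult unit_weight.has_fourier_cnj L)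
    show "has_fourier (\<lambda>_. 1) (\<lambda>z. 2 * c) (\<lambda>k. if k = 0 then 2 * c else 0)"
      by (rule unit_weight.has_fourier_const)
    fix z :: complex assume "norm z = 1"
    then have "c = \<i> * of_real (Im (L z))" using c[of z] by simp
    then show "L z + (-1) * cnj (L z) = 2 * c" by (simp add: complex_eq_iff)
  qed
  then have l: "l k - cnj (l (- k)) = (if k = 0 then 2 * c else 0)" for k
    by (metis (no_types, lifting) add_uminus_conv_diff mult_minus1)
  have "(\<lambda>k. cnj (if - k < 0 then l (- k) else 0)) = (\<lambda>k. if k > 0 then l k else 0)"
  proof
    fix k
    show "cnj (if - k < 0 then l (- k) else 0) = (if k > 0 then l k else 0)" using l[of k] by auto
  qed
  then have "has_fourier (\<lambda>_. 1) (\<lambda>z. cnj (part_neg l z)) (\<lambda>k. if k > 0 then l k else 0)"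
    using unit_weight.has_fourier_cnj[OF unit_weight.log_parts(2)[OF L]] by simp
  then have "cnj (part_neg l z) = part_pos l z"
    using unit_weight.log_parts(1)[OF L] z unfolding has_fourier_def by (blast intro: has_sum_unique)
  then have "exp (l 0 / 2 + part_pos l z) * cnj (exp (- (l 0 / 2) - part_neg l z))
      = exp (l 0 / 2 + part_pos l z + (- (cnj (l 0) / 2) - part_pos l z))"
    by (simp add: exp_cnj exp_add[symmetric])
  also have "l 0 / 2 + part_pos l z + (- (cnj (l 0) / 2) - part_pos l z) = (l 0 - cnj (l (- 0))) / 2"
    by (simp add: diff_divide_distrib)
  also have "\<dots> = c" using l[of 0] by simp
  finally show ?thesis using ec by simp
qed

theorem theorem4:
  fixes \<nu> :: "int \<Rightarrow> real" and w :: "complex \<Rightarrow> complex" and n0 :: nat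
  assumes "beurling_weight \<nu>"
    and "\<forall>j k. 0 \<le> j \<longrightarrow> j < k \<longrightarrow> \<nu> j \<le> \<nu> k"
    and "w \<in> W_alg \<nu>"
    and "\<forall>z\<in>annulus_R \<nu>. fourier_ext w z \<noteq> 0"
    and "wind0 w = 0"
    and "\<forall>n\<ge>n0. \<exists>!\<Phi>. monic_OP w n \<Phi>"
  shows "summable (\<lambda>n::nat. \<nu> (int n) ^ 3 *
           norm (fourier_coeff (\<lambda>z. cnj (D_i w z) * cnj (D_e w z)) (int n) - S_coef w n0 (int n)))
       \<and> ((\<forall>z\<in>sphere 0 1. fourier_ext w z \<in> \<real> \<and> 0 < Re (fourier_ext w z)) \<longrightarrow>
          summable (\<lambda>n::nat. \<nu> (int n) ^ 3 *
           norm (fourier_coeff (\<lambda>z. cnj (D_i w z) / D_i w z) (int n) - S_coef w n0 (int n))))"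
proof -
  interpret beurling \<nu>
    by unfold_locales (use assms(1) in \<open>auto simp: beurling_weight_def\<close>)
  define W where "W = fourier_ext w"
  let ?a = "fourier_coeff w"
  have L1: "L1_circle w" and a: "(\<lambda>k. \<nu> k * norm (?a k)) summable_on UNIV"
    using assms(3) by (auto simp: W_alg_def)
  have W_eq: "W = (\<lambda>z. \<Sum>\<^sub>\<infinity>k. ?a k * z powi k)" by (simp add: W_def fourier_ext_def fun_eq_iff)
  have fW: "has_fourier \<nu> W ?a" unfolding W_eq by (rule has_fourierI[OF a])
  have nzR: "W z \<noteq> 0" if "z \<in> annulus_R \<nu>" for z using assms(4) that by (simp add: W_def)
  have nz: "W z \<noteq> 0" if "norm z = 1" for z
    using that A_exp_nonneg by (intro nzR) (simp add: annulus_R_def)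
  have "\<exists>L. continuous_on (sphere 0 1) L \<and> (\<forall>z\<in>sphere 0 1. exp (L z) = fourier_ext w z)"
  proof (rule winding_number_0_imp_circle_log[OF has_fourier_continuous[OF has_fourier_unit[OF fW]] nz])
    show "winding_number (\<lambda>t. W (cis (2 * pi * t))) 0 = 0" using assms(5) by (simp add: wind0_def W_def)
  qed (auto simp: W_def)
  from someI_ex[OF this] have contL: "continuous_on (sphere 0 1) (log_w w)"
    and expL: "\<And>z. norm z = 1 \<Longrightarrow> exp (log_w w z) = W z"
    unfolding log_w_def W_def by auto
  obtain l where l: "has_fourier \<nu> (log_w w) l"
    using wiener_levy_log[OF a W_eq nzR contL expL] by blast
  note l1 = has_fourier_unit[OF l]
  let ?p = "part_pos l" and ?m = "part_neg l"
  note p = log_parts(1)[OF l] and m = log_parts(2)[OF l]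
  obtain ei where ei: "has_fourier \<nu> (\<lambda>z. exp (?p z)) ei"
      "\<And>k. k \<notin> {1..} \<Longrightarrow> ei k = (if k = 0 then 1 else 0)"
    by (rule has_fourier_exp[OF p, of "{1..}"]) auto
  obtain ei' where ei': "has_fourier \<nu> (\<lambda>z. exp ((-1) * ?p z)) ei'"
      "\<And>k. k \<notin> {1..} \<Longrightarrow> ei' k = (if k = 0 then 1 else 0)"
    by (rule has_fourier_exp[OF has_fourier_cmult(1)[OF p, of "-1"], of "{1..}"]) auto
  obtain ee where ee: "has_fourier \<nu> (\<lambda>z. exp ((-1) * ?m z)) ee"
      "\<And>k. k \<notin> {..-1} \<Longrightarrow> ee k = (if k = 0 then 1 else 0)"
    by (rule has_fourier_exp[OF has_fourier_cmult(1)[OF m, of "-1"], of "{..-1}"]) auto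
  obtain ee' where ee': "has_fourier \<nu> (\<lambda>z. exp (?m z)) ee'"
      "\<And>k. k \<notin> {..-1} \<Longrightarrow> ee' k = (if k = 0 then 1 else 0)"
    by (rule has_fourier_exp[OF m, of "{..-1}"]) auto
  define Ei where "Ei = (\<lambda>z. exp (?p z))"
  define Ee where "Ee = (\<lambda>z. exp ((-1) * ?m z))"
  have fEi': "has_fourier \<nu> (\<lambda>z. 1 / Ei z) ei'"
    by (rule has_fourier_cong[OF ei'(1)]) (simp add: Ei_def exp_minus field_simps)
  have fEe': "has_fourier \<nu> (\<lambda>z. 1 / Ee z) ee'"
    by (rule has_fourier_cong[OF ee'(1)]) (simp add: Ee_def exp_minus field_simps)
  note fEi = ei(1)[folded Ei_def] and fEe = ee(1)[folded Ee_def]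
  interpret wiener_hopf Ei Ee ei ei' ee ee'
    by unfold_locales
       (use has_fourier_unit[OF fEi] has_fourier_unit[OF fEi'] has_fourier_unit[OF fEe] has_fourier_unit[OF fEe']
          ei(2) ei'(2) ee(2) ee'(2) in \<open>auto simp: Ei_def Ee_def\<close>)

  define \<Phi> where "\<Phi> = (\<lambda>n. THE \<Phi>. monic_OP w n \<Phi>)"
  have \<Phi>: "monic_OP w n (\<Phi> n)" if "n \<ge> n0" for n
    unfolding \<Phi>_def by (rule theI') (use assms(6) that in blast)
  have orth: "orthogonal n (poly_coeffs (\<Phi> n))" if n: "n \<ge> n0" for n
    unfolding orthogonal_def
  \<comment> \<open>The scalar exp (- l 0) removes the mean of the logarithm, so that it carries the
    function \<open>W\<close> to \<open>Ei / Ee\<close>.\<close>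
  proof (intro conjI exI[of _ "poly (\<Phi> n)"] exI[of _ "\<lambda>k. exp (- l 0) * conv (poly_coeffs (\<Phi> n)) ?a k"])
    have d: "degree (\<Phi> n) = n" "lead_coeff (\<Phi> n) = 1" using \<Phi>[OF n] by (auto simp: monic_OP_def)
    show "\<forall>k. k < 0 \<or> int n < k \<longrightarrow> poly_coeffs (\<Phi> n) k = 0" using d by (auto simp: poly_coeffs_def coeff_eq_0)
    show "poly_coeffs (\<Phi> n) (int n) = 1" using d by (simp add: poly_coeffs_def)
    show "has_fourier (\<lambda>_. 1) (poly (\<Phi> n)) (poly_coeffs (\<Phi> n))" by (rule has_fourier_poly)
    show "has_fourier (\<lambda>_. 1) (\<lambda>z. poly (\<Phi> n) z * (Ei z / Ee z)) (\<lambda>k. exp (- l 0) * conv (poly_coeffs (\<Phi> n)) ?a k)"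
    proof (rule has_fourier_cong[OF unit_weight.has_fourier_cmult(1)[OF
          unit_weight.has_fourier_mult(1)[OF has_fourier_poly has_fourier_unit[OF fW]]]])
      fix z :: complex assume z: "norm z = 1"
      have "W z = exp (l 0 + ?p z + ?m z)" using expL[OF z] log_parts(3)[OF l z] by simp
      then have "exp (- l 0) * W z = Ei z / Ee z"
        by (simp add: Ei_def Ee_def exp_add exp_minus field_simps)
      then show "exp (- l 0) * (poly (\<Phi> n) z * W z) = poly (\<Phi> n) z * (Ei z / Ee z)"
        by (metis mult.left_commute)
    qed
    show "\<forall>k. 0 \<le> k \<and> k < int n \<longrightarrow> exp (- l 0) * conv (poly_coeffs (\<Phi> n)) ?a k = 0"
      using monic_OP_imp_conv_eq_0[OF L1 \<Phi>[OF n]] by simp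
  qed
  have "summable (\<lambda>n. \<nu> (int n) ^ 3 * norm (poly_coeffs (\<Phi> n) 0 - h (- int n)))"
  proof (rule summable_cubic_error[OF beurling_axioms _ _ _ orth])
    show "(\<lambda>k. \<nu> k * norm (h k)) summable_on UNIV" using has_fourier_mult(1)[OF fEi fEe] by (simp add: has_fourier_def)
    show "(\<lambda>k. \<nu> k * norm (g k)) summable_on UNIV" using has_fourier_mult(1)[OF fEi' fEe'] by (simp add: has_fourier_def)
  qed (use assms(2) in auto)
  moreover have coeff_g: "fourier_coeff (\<lambda>z. cnj (D_i w z) * cnj (D_e w z)) k = cnj (h (- k))" for k
  proof -
    have "cnj (D_i w z) * cnj (D_e w z) = cnj (Ei z * Ee z)" if z: "norm z = 1" for z
    proof -
      have "D_i w z * D_e w z = Ei z * Ee z"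
        unfolding D_i_eq[OF l1 z] D_e_eq[OF l1 z] Ei_def Ee_def
        by (simp add: exp_add[symmetric])
      then show ?thesis by (metis complex_cnj_mult)
    qed
    then have "fourier_coeff (\<lambda>z. cnj (D_i w z) * cnj (D_e w z)) k = fourier_coeff (\<lambda>z. cnj (Ei z * Ee z)) k"
      by (rule fourier_coeff_cong)
    also have "\<dots> = cnj (h (- k))"
      by (rule has_fourier_fourier_coeff[OF unit_weight.has_fourier_cnj[OF unit_weight.has_fourier_mult(1)[OF Ei Ee]]])
    finally show ?thesis .
  qed
  \<comment> \<open>Index 0, where S has no term, and the indices below n0, where \<alpha> is set to
    0, are left out; finitely many terms do not affect summability. The two minus signs in S and
    \<alpha> cancel, so S has the coefficient cnj (\<Phi> n (0)).\<close>
  moreover have "norm (fourier_coeff (\<lambda>z. cnj (D_i w z) * cnj (D_e w z)) (int n) - S_coef w n0 (int n))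
      = norm (poly_coeffs (\<Phi> n) 0 - h (- int n))" if n: "n \<ge> max 1 n0" for n
  proof -
    have "S_coef w n0 (int n) = cnj (poly (\<Phi> n) 0)"
      using n by (simp add: S_coef_def alpha_coef_def \<Phi>_def)
    then have "fourier_coeff (\<lambda>z. cnj (D_i w z) * cnj (D_e w z)) (int n) - S_coef w n0 (int n)
        = cnj (h (- int n) - poly_coeffs (\<Phi> n) 0)"
      by (simp add: coeff_g poly_coeffs_def poly_0_coeff_0)
    then show ?thesis by (simp only: complex_mod_cnj norm_minus_commute)
  qed
  ultimately have main: "summable (\<lambda>n::nat. \<nu> (int n) ^ 3 *
      norm (fourier_coeff (\<lambda>z. cnj (D_i w z) * cnj (D_e w z)) (int n) - S_coef w n0 (int n)))"
    by (subst summable_cong[of _ "\<lambda>n. \<nu> (int n) ^ 3 * norm (poly_coeffs (\<Phi> n) 0 - h (- int n))"])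
       (auto simp: eventually_sequentially intro!: exI[of _ "max 1 n0"])
  have "summable (\<lambda>n::nat. \<nu> (int n) ^ 3 *
      norm (fourier_coeff (\<lambda>z. cnj (D_i w z) / D_i w z) (int n) - S_coef w n0 (int n)))"
    if pos: "\<forall>z\<in>sphere 0 1. fourier_ext w z \<in> \<real> \<and> 0 < Re (fourier_ext w z)"
  proof -
    have "cnj (D_i w z) / D_i w z = cnj (D_i w z) * cnj (D_e w z)" if z: "norm z = 1" for z
    proof -
      \<comment> \<open>Positivity makes the conjugate of \<open>D_e\<close> the reciprocal of
        \<open>D_i\<close>, which reduces the quotient to the product already treated.\<close>
      have "D_i w z * cnj (D_e w z) = 1"
        unfolding D_i_eq[OF l1 z] D_e_eq[OF l1 z]
        by (rule real_log_conjugate_parts[OF l1 _ z]) (use pos expL in \<open>auto simp: W_def\<close>)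
      then show ?thesis by (metis divide_inverse inverse_unique)
    qed
    then have "fourier_coeff (\<lambda>z. cnj (D_i w z) / D_i w z) k
        = fourier_coeff (\<lambda>z. cnj (D_i w z) * cnj (D_e w z)) k" for k
      by (rule fourier_coeff_cong)
    then show ?thesis using main by simp
  qed
  with main show ?thesis by blast
qed

end
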